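(* There exist constants $C, r, m, c_1, c_2 > 0$ and, for every sufficiently large integer $L$, a finite set $\mathcal{Q}$ of $n \le C L^3$ qubits with assigned positions in $\mathbb{R}^3$, together with a stabilizer group $S$ on $\mathcal{Q}$ having at least one nontrivial logical operator and a generating set $R$ of $S$ (so $\langle R\rangle = S$), such that: (i) (finite density) every axis-parallel cube of side length $1$ in $\mathbb{R}^3$ contains at most $m$ of the qubits; (ii) (locality) for every $h \in R$, the qubits on which $h$ acts nontrivially are contained in an axis-parallel cube of side length $r$; (iii) the energy barrier $\Delta$ of the stabilizer Hamiltonian $H = -\sum_{h\in R} h$ satisfies $c_1 L^{2/3} \le \Delta \le c_2 L^{2/3}$.
   Context: The Pauli group on $n$ qubits is $\{ i^k P_1\otimes\cdots\otimes P_n : k\in\{0,1,2,3\},\ P_j\in\{I,X,Y,Z\}\}$, where $X,Y,Z$ are the single-qubit Pauli matrices. A stabilizer group $S$ is a subgroup of the Pauli group with $-I\notin S$; its code space is the set of $|\psi\rangle$ with $h|\psi\rangle=|\psi\rangle$ for all $h\in S$. For a generating set $R$ of $S$, the stabilizer Hamiltonian is $H=-\sum_{h\in R}h$; its ground space is the code space of $S$. A nontrivial logical operator is a Pauli operator that commutes with every element of $S$ and is not, up to a phase, an element of $S$. Energy barrier: consider finite sequences of Pauli operators $E_0=I, E_1,\dots,E_T$ such that each $E_{t+1}$ differs from $E_t$ by multiplication by a Pauli operator acting on a single qubit, and $E_T$ is a nontrivial logical operator. The energy of $E_t$ is the energy of $E_t|\psi\rangle$ above the ground energy, for $|\psi\rangle$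 a ground state of $H$; it equals twice the number of $h\in R$ that anticommute with $E_t$. The energy barrier $\Delta$ is the minimum, over all such sequences, of the maximum over $t$ of the energy of $E_t$. *)

theory Defs
  imports "HOL-Analysis.Analysis" "Jordan_Normal_Form.Char_Poly" "HOL-Algebra.Generated_Groups"
begin

section \<open>Pauli operators\<close>

datatype pauli = PI | PX | PY | PZ

fun pauli_mat :: "pauli \<Rightarrow> complex mat" where
  "pauli_mat PI = mat_of_rows_list 2 [[1, 0], [0, 1]]"
| "pauli_mat PX = mat_of_rows_list 2 [[0, 1], [1, 0]]"
| "pauli_mat PY = mat_of_rows_list 2 [[0, - \<i>], [\<i>, 0]]"
| "pauli_mat PZ = mat_of_rows_list 2 [[1, 0], [0, - 1]]"

text \<open>The qubits are labelled by \<open>{..<n}\<close>. The computational basis state in which qubit \<open>q\<close>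
  has value \<open>bit a q\<close> is the unit vector with index \<open>a < 2 ^ n\<close>, so that the entry of the
  tensor product \<open>P 0 \<otimes> \<dots> \<otimes> P (n - 1)\<close> at \<open>(a, b)\<close> is the product of the entries of the
  factors \<open>P q\<close> at \<open>(bit a q, bit b q)\<close>.\<close>

definition pauli_tensor :: "nat \<Rightarrow> (nat \<Rightarrow> pauli) \<Rightarrow> complex mat" where
  "pauli_tensor n P = mat (2 ^ n) (2 ^ n)
     (\<lambda>(a, b). \<Prod>q<n. pauli_mat (P q) $$ (of_bool (bit a q), of_bool (bit b q)))"

definition pauli_group :: "nat \<Rightarrow> complex mat monoid" where
  "pauli_group n =
     \<lparr>carrier = {\<i> ^ k \<cdot>\<^sub>m pauli_tensor n P | k P. k < (4 :: nat)},
      mult = (*), one = 1\<^sub>m (2 ^ n)\<rparr>"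

text \<open>The set of qubits on which the Pauli operator \<open>E\<close> acts nontrivially. The factors
  \<open>P q\<close> with \<open>q < n\<close> are uniquely determined by \<open>E\<close>.\<close>

definition pauli_support :: "nat \<Rightarrow> complex mat \<Rightarrow> nat set" where
  "pauli_support n E =
     {q. q < n \<and> (\<exists>k P. k < (4 :: nat) \<and> E = \<i> ^ k \<cdot>\<^sub>m pauli_tensor n P \<and> P q \<noteq> PI)}"

section \<open>Stabilizer groups and Hamiltonians\<close>

definition stabilizer_group :: "nat \<Rightarrow> complex mat set \<Rightarrow> bool" where
  "stabilizer_group n S \<longleftrightarrow> subgroup S (pauli_group n) \<and> - 1\<^sub>m (2 ^ n) \<notin> S"

definition generating_set :: "nat \<Rightarrow> complex mat set \<Rightarrow> complex mat set \<Rightarrow> bool" where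
  "generating_set n S R \<longleftrightarrow> R \<subseteq> S \<and> generate (pauli_group n) R = S"

definition nontrivial_logical :: "nat \<Rightarrow> complex mat set \<Rightarrow> complex mat \<Rightarrow> bool" where
  "nontrivial_logical n S E \<longleftrightarrow>
     E \<in> carrier (pauli_group n) \<and> (\<forall>s\<in>S. E * s = s * E) \<and>
     \<not> (\<exists>c. norm c = 1 \<and> c \<cdot>\<^sub>m E \<in> S)"

text \<open>The Hamiltonian \<open>- (\<Sum>h\<in>R. h)\<close>, written entrywise because matrices of unspecified
  dimension do not form a commutative monoid.\<close>

definition hamiltonian :: "nat \<Rightarrow> complex mat set \<Rightarrow> complex mat" where
  "hamiltonian n R = mat (2 ^ n) (2 ^ n) (\<lambda>(a, b). - (\<Sum>h\<in>R. h $$ (a, b)))"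

definition ground_energy :: "nat \<Rightarrow> complex mat set \<Rightarrow> real" where
  "ground_energy n R = Min {e. eigenvalue (hamiltonian n R) (complex_of_real e)}"

definition ground_state :: "nat \<Rightarrow> complex mat set \<Rightarrow> complex vec \<Rightarrow> bool" where
  "ground_state n R \<psi> \<longleftrightarrow>
     eigenvector (hamiltonian n R) \<psi> (complex_of_real (ground_energy n R))"

definition state_energy :: "nat \<Rightarrow> complex mat set \<Rightarrow> complex vec \<Rightarrow> real" where
  "state_energy n R \<phi> = Re (((hamiltonian n R *\<^sub>v \<phi>) \<bullet>c \<phi>) / (\<phi> \<bullet>c \<phi>))"

text \<open>For a stabilizer Hamiltonian the energy of \<open>E \<psi>\<close> is the same for all ground states
  \<open>\<psi>\<close>, so the choice is immaterial.\<close>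

definition pauli_energy :: "nat \<Rightarrow> complex mat set \<Rightarrow> complex mat \<Rightarrow> real" where
  "pauli_energy n R E =
     state_energy n R (E *\<^sub>v (SOME \<psi>. ground_state n R \<psi>)) - ground_energy n R"

section \<open>Energy barrier\<close>

definition logical_path ::
    "nat \<Rightarrow> complex mat set \<Rightarrow> nat \<Rightarrow> (nat \<Rightarrow> complex mat) \<Rightarrow> bool" where
  "logical_path n S T E \<longleftrightarrow>
     E 0 = 1\<^sub>m (2 ^ n) \<and>
     (\<forall>t\<le>T. E t \<in> carrier (pauli_group n)) \<and>
     (\<forall>t<T. \<exists>P\<in>carrier (pauli_group n). (\<exists>q. pauli_support n P = {q}) \<and> E (Suc t) = P * E t) \<and>
     nontrivial_logical n S (E T)"

definition energy_barrier :: "nat \<Rightarrow> complex mat set \<Rightarrow> complex mat set \<Rightarrow> real" where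
  "energy_barrier n S R =
     Min {Max ((\<lambda>t. pauli_energy n R (E t)) ` {..T}) | T E. logical_path n S T E}"

section \<open>Geometry\<close>

definition cube :: "real ^ 3 \<Rightarrow> real \<Rightarrow> (real ^ 3) set" where
  "cube a s = cbox a (a + s *\<^sub>R One)"

end

theory Submission
  imports Defs "HOL-Library.Z2"
begin

text \<open>The code is the homological product of two graphs. \<open>F\<close> is a \<open>d \<times> d\<close> square grid together with its
  unit squares as faces, and \<open>G\<close> is the \<open>k \<times> k \<times> k\<close> cubic lattice whose edges are subdivided into \<open>d\<close> parts,
  where \<open>d = k\<^sup>2\<close> and \<open>k\<close> is about \<open>L\<^bsup>1/3\<^esup>\<close>. (Geometrically, these are solid codes of cross-section \<open>d \<times> d\<close>
  welded along sheets that sit at the vertices of the lattice.) Qubits are the pairs vertex-vertex and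
  edge-edge. Since \<open>F\<close> is connected and its cycles are sums of faces, and \<open>G\<close> is connected, there is exactly
  one logical qubit.

  Summing a \<open>Z\<close>-type error over \<open>F\<close> gives a spin configuration on \<open>G\<close>, and every domain wall of this
  configuration forces a violated check; a single-qubit operator flips at most one spin, and a logical
  operator flips all of them. So the barrier is at least twice the Ising barrier of \<open>G\<close>. Symmetrically, for
  \<open>X\<close>-type errors it is at least twice the Ising barrier of \<open>F\<close>. By isoperimetry both are of order
  \<open>k\<^sup>2 = d\<close>. Conversely, filling one sheet site by site in lexicographic order implements a logical \<open>X\<close> at
  energy at most \<open>2 (d + 1)\<close>. The number of qubits is of order \<open>k\<^sup>3 d\<^sup>3 = k\<^sup>9\<close>.

  The sheet at the point \<open>u\<close> of \<open>G\<close> is placed at \<open>u + (i, j, i + j)\<close> with \<open>i, j < d\<close>. This plane is transversal to all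
  three coordinate directions, so the sheets on each line of \<open>G\<close> are disjoint and the density is bounded.\<close>

text \<open>Halving a grid of side \<open>d\<close> cuts of order \<open>d\<close> edges, and
  halving the cubic lattice cuts of order \<open>k\<^sup>2\<close> lines however finely they are
  subdivided; \<open>d = k\<^sup>2\<close> balances the two. Subdivision only makes room for sheets
  of side \<open>d\<close> between parallel lines. Its price: the loops of \<open>G\<close> become
  long, and no check of bounded size fills one. They stay unfilled and only \<open>F\<close> gets
  faces, since, as in the Kuenneth formula, an extra logical qubit would need a nontrivial cycle in
  both factors.

  A wall at an edge forces a violation because summing the checks over that edge along the other
  factor cancels all edge-edge qubits: each edge there has two ends.

  Energies are defined through an arbitrary ground state of a matrix, so the spectrum comes before
  the combinatorics and turns them into numbers of anticommuting generators. As generators form a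
  set, lower bounds must exhibit checks that are distinct as operators. Paths of arbitrary Pauli
  operators are handled by following the X part and the Z part separately; at the end at least one
  of them is logical.\<close>

section \<open>Pauli operators as vectors over the field with two elements\<close>

text \<open>These rules would rewrite the field operations of \<open>bit\<close> to Boolean ones.\<close>

declare add_bit_eq_xor [simp del] mult_bit_eq_and [simp del]

lemma bit_add_self [simp]: "(x :: bit) + x = 0" by (cases x) auto
lemma bit_add_self_left [simp]: "(x :: bit) + (x + y) = y" by (cases x; cases y) auto

text \<open>Induction on the top bit: the indices below \<open>2 ^ Suc n\<close> with bit
  \<open>n\<close> set are the smaller ones shifted by \<open>2 ^ n\<close>. This distributive law
  lets matrix products of tensor products be computed qubit by qubit.\<close>

lemma sum_over_bit_strings:
  fixes f :: "nat \<Rightarrow> bool \<Rightarrow> 'a :: comm_semiring_1"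
  shows "(\<Sum>c<(2::nat) ^ n. \<Prod>q<n. f q (bit (c :: nat) q)) = (\<Prod>q<n. f q False + f q True)"
proof (induction n)
  case 0
  then show ?case by simp
next
  case (Suc n)
  have split: "{..<2 ^ Suc n :: nat} = {..<2 ^ n} \<union> (\<lambda>c. c + 2 ^ n) ` {..<2 ^ n :: nat}"
  proof (intro Set.set_eqI iffI)
    fix c :: nat assume c: "c \<in> {..<2 ^ Suc n}"
    show "c \<in> {..<2 ^ n} \<union> (\<lambda>c. c + 2 ^ n) ` {..<2 ^ n}"
    proof (cases "c < 2 ^ n")
      case False
      then have "c = (c - 2 ^ n) + 2 ^ n" "c - 2 ^ n < 2 ^ n" using c by auto
      then show ?thesis by blast
    qed auto
  qed auto
  have low: "(\<Prod>q<Suc n. f q (bit c q)) = (\<Prod>q<n. f q (bit c q)) * f n False" if "c < 2 ^ n" for c :: nat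
    using that by (simp add: bit_iff_odd)
  have high: "(\<Prod>q<Suc n. f q (bit (c + 2 ^ n) q)) = (\<Prod>q<n. f q (bit c q)) * f n True"
    if "c < 2 ^ n" for c :: nat
  proof -
    have "bit (c + 2 ^ n) q = bit c q" if "q < n" for q
    proof -
      have e: "(2::nat) ^ n = 2 ^ q * (2 ^ (n - q))" using that by (simp flip: power_add)
      have "(c + 2 ^ n) div 2 ^ q = c div 2 ^ q + 2 ^ (n - q)" unfolding e by simp
      then show ?thesis using that by (simp add: bit_iff_odd)
    qed
    moreover have "bit (c + 2 ^ n) n" using that by (simp add: bit_iff_odd)
    ultimately show ?thesis by simp
  qed
  have "(\<Sum>c<(2::nat) ^ Suc n. \<Prod>q<Suc n. f q (bit c q))
      = (\<Sum>c<(2::nat) ^ n. \<Prod>q<Suc n. f q (bit c q)) + (\<Sum>c\<in>(\<lambda>c. c + 2 ^ n) ` {..<2 ^ n :: nat}. \<Prod>q<Suc n. f q (bit c q))"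
    unfolding split by (rule sum.union_disjoint) auto
  also have "(\<Sum>c<(2::nat) ^ n. \<Prod>q<Suc n. f q (bit c q)) = (\<Sum>c<(2::nat) ^ n. (\<Prod>q<n. f q (bit c q)) * f n False)"
    using low by (intro sum.cong) auto
  also have "(\<Sum>c\<in>(\<lambda>c. c + 2 ^ n) ` {..<2 ^ n :: nat}. \<Prod>q<Suc n. f q (bit c q))
      = (\<Sum>c<(2::nat) ^ n. (\<Prod>q<n. f q (bit c q)) * f n True)"
    by (subst sum.reindex) (use high in \<open>auto intro!: sum.cong inj_onI\<close>)
  finally show ?case
    by (simp add: Suc.IH distrib_left flip: sum_distrib_right)
qed

text \<open>The pair \<open>(1, 1)\<close> stands for Y itself and not for XZ = -iY. Hence every
  operator built from bit vectors is Hermitian and squares to the identity, without any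
  phase.\<close>

fun pauli_xz :: "bit \<Rightarrow> bit \<Rightarrow> pauli" where
  "pauli_xz x z = (if x = 0 then if z = 0 then PI else PZ else if z = 0 then PX else PY)"

definition xbit :: "pauli \<Rightarrow> bit" where "xbit P = of_bool (P = PX \<or> P = PY)"
definition zbit :: "pauli \<Rightarrow> bit" where "zbit P = of_bool (P = PZ \<or> P = PY)"

lemma pauli_xz_bits [simp]: "pauli_xz (xbit P) (zbit P) = P"
  by (cases P) (auto simp: xbit_def zbit_def)

lemma xbit_pauli_xz [simp]: "xbit (pauli_xz x z) = x" "zbit (pauli_xz x z) = z"
  by (auto simp: xbit_def zbit_def)

lemma pauli_xz_eq_PI [simp]: "pauli_xz x z = PI \<longleftrightarrow> x = 0 \<and> z = 0" by auto

declare pauli_xz.simps [simp del]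

definition pauli_entry :: "pauli \<Rightarrow> bool \<Rightarrow> bool \<Rightarrow> complex" where
  "pauli_entry P s t = pauli_mat P $$ (of_bool s, of_bool t)"

lemma pauli_entry_simps [simp]:
  "pauli_entry PI s t = of_bool (s = t)"
  "pauli_entry PX s t = of_bool (s \<noteq> t)"
  "pauli_entry PZ s t = (if s = t then if s then -1 else 1 else 0)"
  "pauli_entry PY s t = (if s = t then 0 else if s then \<i> else - \<i>)"
  by (cases s; cases t; simp add: pauli_entry_def mat_of_rows_list_def)+

text \<open>The values are the exponents of \<open>\<i>\<close> in \<open>XY = \<i>Z\<close>, \<open>YX = \<i>\<^sup>3 Z\<close> and so on.\<close>

definition phase1 :: "bit \<Rightarrow> bit \<Rightarrow> bit \<Rightarrow> bit \<Rightarrow> nat" where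
  "phase1 x z x' z' =
     (if pauli_xz x z = PI \<or> pauli_xz x' z' = PI \<or> pauli_xz x z = pauli_xz x' z' then 0
      else if (pauli_xz x z, pauli_xz x' z') \<in> {(PX, PY), (PY, PZ), (PZ, PX)} then 1 else 3)"

lemma pauli_entry_mult:
  "pauli_entry (pauli_xz x z) s False * pauli_entry (pauli_xz x' z') False t +
   pauli_entry (pauli_xz x z) s True * pauli_entry (pauli_xz x' z') True t =
   \<i> ^ phase1 x z x' z' * pauli_entry (pauli_xz (x + x') (z + z')) s t"
  by (cases x; cases z; cases x'; cases z'; cases s; cases t)
     (simp_all add: pauli_xz.simps phase1_def power3_eq_cube)

lemma pauli_phase_commute:
  "\<i> ^ phase1 x z x' z' = (if x * z' + z * x' = 0 then 1 else -1) * \<i> ^ phase1 x' z' x z"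
  by (cases x; cases z; cases x'; cases z') (simp_all add: pauli_xz.simps phase1_def power3_eq_cube)

definition pauli_op :: "nat \<Rightarrow> (nat \<Rightarrow> bit) \<Rightarrow> (nat \<Rightarrow> bit) \<Rightarrow> complex mat" where
  "pauli_op n x z = pauli_tensor n (\<lambda>q. pauli_xz (x q) (z q))"

definition dot :: "nat \<Rightarrow> (nat \<Rightarrow> bit) \<Rightarrow> (nat \<Rightarrow> bit) \<Rightarrow> bit" where
  "dot n v w = (\<Sum>q<n. v q * w q)"

lemma pauli_tensor_eq_pauli_op: "pauli_tensor n P = pauli_op n (xbit \<circ> P) (zbit \<circ> P)"
  by (simp add: pauli_op_def)

lemma pauli_op_carrier [simp]: "pauli_op n x z \<in> carrier_mat (2 ^ n) (2 ^ n)"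
  by (simp add: pauli_op_def pauli_tensor_def)

lemma pauli_op_dim [simp]: "dim_row (pauli_op n x z) = 2 ^ n" "dim_col (pauli_op n x z) = 2 ^ n"
  by (simp_all add: pauli_op_def pauli_tensor_def)

lemma pauli_op_index:
  "a < 2 ^ n \<Longrightarrow> b < 2 ^ n \<Longrightarrow>
   pauli_op n x z $$ (a, b) = (\<Prod>q<n. pauli_entry (pauli_xz (x q) (z q)) (bit a q) (bit b q))"
  by (simp add: pauli_op_def pauli_tensor_def pauli_entry_def)

lemma pauli_op_cong:
  "(\<And>q. q < n \<Longrightarrow> x q = x' q) \<Longrightarrow> (\<And>q. q < n \<Longrightarrow> z q = z' q) \<Longrightarrow> pauli_op n x z = pauli_op n x' z'"
  by (rule eq_matI) (auto simp: pauli_op_index intro!: prod.cong)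

definition phase :: "nat \<Rightarrow> (nat \<Rightarrow> bit) \<Rightarrow> (nat \<Rightarrow> bit) \<Rightarrow> (nat \<Rightarrow> bit) \<Rightarrow> (nat \<Rightarrow> bit) \<Rightarrow> nat" where
  "phase n x z x' z' = (\<Sum>q<n. phase1 (x q) (z q) (x' q) (z' q))"

text \<open>The sum over intermediate basis states factorises over the qubits, and each factor is an
  entry of a product of two single-qubit matrices.\<close>

lemma pauli_op_mult:
  "pauli_op n x z * pauli_op n x' z' =
   \<i> ^ phase n x z x' z' \<cdot>\<^sub>m pauli_op n (\<lambda>q. x q + x' q) (\<lambda>q. z q + z' q)"
proof (rule eq_matI, goal_cases)
  case (1 a b)
  then have ab: "a < 2 ^ n" "b < 2 ^ n" by auto
  let ?e = "\<lambda>q. pauli_entry (pauli_xz (x q) (z q)) (bit a q)"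
  let ?e' = "\<lambda>q s. pauli_entry (pauli_xz (x' q) (z' q)) s (bit b q)"
  have "(pauli_op n x z * pauli_op n x' z') $$ (a, b)
      = (\<Sum>c<(2::nat) ^ n. pauli_op n x z $$ (a, c) * pauli_op n x' z' $$ (c, b))"
    using ab by (simp add: scalar_prod_def atLeast0LessThan)
  also have "\<dots> = (\<Sum>c<(2::nat) ^ n. \<Prod>q<n. ?e q (bit (c :: nat) q) * ?e' q (bit c q))"
    using ab by (intro sum.cong) (auto simp: pauli_op_index prod.distrib)
  also have "\<dots> = (\<Prod>q<n. ?e q False * ?e' q False + ?e q True * ?e' q True)"
    by (rule sum_over_bit_strings)
  also have "\<dots> = (\<Prod>q<n. \<i> ^ phase1 (x q) (z q) (x' q) (z' q) *
      pauli_entry (pauli_xz (x q + x' q) (z q + z' q)) (bit a q) (bit b q))"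
    by (intro prod.cong refl pauli_entry_mult)
  also have "\<dots> = \<i> ^ phase n x z x' z' *
      pauli_op n (\<lambda>q. x q + x' q) (\<lambda>q. z q + z' q) $$ (a, b)"
    using ab by (simp add: prod.distrib pauli_op_index phase_def power_sum)
  finally show ?case using ab by simp
qed auto

text \<open>Single-qubit factors anticommute exactly when \<open>x * z' + z * x' = 1\<close>. The
  signs multiply over the qubits, so the symplectic form decides.\<close>

lemma pauli_op_commute:
  "pauli_op n x z * pauli_op n x' z' =
   (if dot n x z' + dot n z x' = 0 then 1 else -1) \<cdot>\<^sub>m (pauli_op n x' z' * pauli_op n x z)"
proof -
  have "\<i> ^ phase n x z x' z' = (if dot n x z' + dot n z x' = 0 then 1 else -1) * \<i> ^ phase n x' z' x z"
  proof (induction n)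
    case 0
    then show ?case by (simp add: phase_def dot_def)
  next
    case (Suc n)
    let ?s = "\<lambda>b :: bit. if b = 0 then 1 else -1 :: complex"
    have hom: "?s (b + c) = ?s b * ?s c" for b c by (cases b; cases c) auto
    have "\<i> ^ phase (Suc n) x z x' z' = \<i> ^ phase n x z x' z' * \<i> ^ phase1 (x n) (z n) (x' n) (z' n)"
      by (simp add: phase_def power_add)
    also have "\<dots> = ?s ((dot n x z' + dot n z x') + (x n * z' n + z n * x' n)) *
       \<i> ^ phase (Suc n) x' z' x z"
      unfolding hom by (subst Suc.IH, subst pauli_phase_commute) (simp add: phase_def power_add)
    finally show ?case by (simp add: dot_def algebra_simps)
  qed
  moreover have "c \<cdot>\<^sub>m (d \<cdot>\<^sub>m A) = (c * d) \<cdot>\<^sub>m A" for c d :: complex and A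
    by (rule eq_matI) auto
  ultimately show ?thesis
    by (simp add: pauli_op_mult add.commute[of "x _"] add.commute[of "z _"])
qed

lemma pauli_op_zero: "pauli_op n (\<lambda>_. 0) (\<lambda>_. 0) = 1\<^sub>m (2 ^ n)"
proof (rule eq_matI)
  fix a b assume "a < dim_row (1\<^sub>m (2 ^ n) :: complex mat)" "b < dim_col (1\<^sub>m (2 ^ n) :: complex mat)"
  then have ab: "a < 2 ^ n" "b < 2 ^ n" by auto
  have "(\<forall>q<n. bit a q = bit b q) \<longleftrightarrow> a = b"
  proof
    assume h: "\<forall>q<n. bit a q = bit b q"
    have "take_bit n a = take_bit n b"
      by (rule bit_eqI) (use h in \<open>auto simp: bit_take_bit_iff\<close>)
    then show "a = b" using ab by (simp add: take_bit_nat_eq_self)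
  qed simp
  moreover have "(\<Prod>q<n. of_bool (P q) :: complex) = of_bool (\<forall>q<n. P q)" for P
    by (induction n) (auto simp: less_Suc_eq)
  ultimately show "pauli_op n (\<lambda>_. 0) (\<lambda>_. 0) $$ (a, b) = 1\<^sub>m (2 ^ n) $$ (a, b)"
    using ab by (simp add: pauli_op_index pauli_xz.simps del: prod_constant)
qed auto

lemma pauli_op_square: "pauli_op n x z * pauli_op n x z = 1\<^sub>m (2 ^ n)"
  by (rule eq_matI) (simp_all add: pauli_op_mult pauli_op_zero phase_def phase1_def)

lemma pauli_op_hermitian:
  assumes "a < 2 ^ n" "b < 2 ^ n"
  shows "pauli_op n x z $$ (b, a) = cnj (pauli_op n x z $$ (a, b))"
proof -
  have herm: "cnj (pauli_entry P s t) = pauli_entry P t s" for P s t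
    by (cases P; cases s; cases t) (simp_all only: pauli_entry_simps, simp_all)
  show ?thesis using assms by (simp add: pauli_op_index herm)
qed

lemma smult_smult_mat: "c \<cdot>\<^sub>m (d \<cdot>\<^sub>m (A :: complex mat)) = (c * d) \<cdot>\<^sub>m A"
  by (rule eq_matI) auto

lemma one_smult_mat [simp]: "1 \<cdot>\<^sub>m (A :: complex mat) = A"
  by (rule eq_matI) auto

lemma i_power_mod_4: "\<i> ^ (k mod 4) = \<i> ^ k"
proof -
  have "\<i> ^ k = \<i> ^ (k mod 4 + 4 * (k div 4))" by simp
  also have "\<dots> = \<i> ^ (k mod 4)" unfolding power_add power_mult by simp
  finally show ?thesis by simp
qed

section \<open>The Pauli group: group laws, commutation and supports\<close>

lemma pauli_group_simps [simp]:
  "mult (pauli_group n) = (*)" "one (pauli_group n) = 1\<^sub>m (2 ^ n)"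
  by (simp_all add: pauli_group_def)

lemma pauli_groupI: "\<i> ^ k \<cdot>\<^sub>m pauli_op n x z \<in> carrier (pauli_group n)"
proof -
  have "\<i> ^ k \<cdot>\<^sub>m pauli_op n x z = \<i> ^ (k mod 4) \<cdot>\<^sub>m pauli_tensor n (\<lambda>q. pauli_xz (x q) (z q))"
    by (simp add: i_power_mod_4 pauli_op_def)
  moreover have "k mod 4 < 4" by simp
  ultimately show ?thesis unfolding pauli_group_def by auto
qed

lemma pauli_groupE:
  assumes "E \<in> carrier (pauli_group n)"
  obtains k x z where "E = \<i> ^ k \<cdot>\<^sub>m pauli_op n x z"
  using assms by (auto simp: pauli_group_def pauli_tensor_eq_pauli_op)

lemma pauli_op_in_group [simp]: "pauli_op n x z \<in> carrier (pauli_group n)"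
  using pauli_groupI[of 0] by simp

lemma pauli_group_carrier_mat: "E \<in> carrier (pauli_group n) \<Longrightarrow> E \<in> carrier_mat (2 ^ n) (2 ^ n)"
  by (auto elim!: pauli_groupE)

lemma smult_pauli_op_mult:
  "(c \<cdot>\<^sub>m pauli_op n x z) * (d \<cdot>\<^sub>m pauli_op n x' z') =
   (c * d * \<i> ^ phase n x z x' z') \<cdot>\<^sub>m pauli_op n (\<lambda>q. x q + x' q) (\<lambda>q. z q + z' q)"
  by (simp add: mult_smult_assoc_mat[of _ "2 ^ n" "2 ^ n" _ "2 ^ n"]
      mult_smult_distrib[of _ "2 ^ n" "2 ^ n" _ "2 ^ n"] smult_smult_mat pauli_op_mult ac_simps)

lemma group_pauli_group: "group (pauli_group n)"
proof (rule groupI)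
  fix E F assume "E \<in> carrier (pauli_group n)" "F \<in> carrier (pauli_group n)"
  then show "E \<otimes>\<^bsub>pauli_group n\<^esub> F \<in> carrier (pauli_group n)"
    by (auto elim!: pauli_groupE simp: smult_pauli_op_mult pauli_groupI simp flip: power_add)
next
  show "\<one>\<^bsub>pauli_group n\<^esub> \<in> carrier (pauli_group n)"
    using pauli_groupI[of 0 n "\<lambda>_. 0" "\<lambda>_. 0"] by (simp add: pauli_op_zero)
next
  fix E F G
  assume "E \<in> carrier (pauli_group n)" "F \<in> carrier (pauli_group n)" "G \<in> carrier (pauli_group n)"
  then show "E \<otimes>\<^bsub>pauli_group n\<^esub> F \<otimes>\<^bsub>pauli_group n\<^esub> G
      = E \<otimes>\<^bsub>pauli_group n\<^esub> (F \<otimes>\<^bsub>pauli_group n\<^esub> G)"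
    by (simp add: assoc_mult_mat[OF pauli_group_carrier_mat pauli_group_carrier_mat pauli_group_carrier_mat])
next
  fix E assume E: "E \<in> carrier (pauli_group n)"
  then show "\<one>\<^bsub>pauli_group n\<^esub> \<otimes>\<^bsub>pauli_group n\<^esub> E = E"
    using left_mult_one_mat[OF pauli_group_carrier_mat] by simp
  from E obtain k x z where E': "E = \<i> ^ k \<cdot>\<^sub>m pauli_op n x z" by (rule pauli_groupE)
  have "\<i> ^ k * \<i> ^ (3 * k) = 1"
    by (simp add: power_mult power3_eq_cube flip: power_mult_distrib)
  then have "(\<i> ^ (3 * k) \<cdot>\<^sub>m pauli_op n x z) * E = 1\<^sub>m (2 ^ n)"
    by (simp add: E' mult_smult_assoc_mat[of _ "2 ^ n" "2 ^ n" _ "2 ^ n"]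
      mult_smult_distrib[of _ "2 ^ n" "2 ^ n" _ "2 ^ n"] smult_smult_mat pauli_op_square)
  then show "\<exists>F\<in>carrier (pauli_group n). F \<otimes>\<^bsub>pauli_group n\<^esub> E = \<one>\<^bsub>pauli_group n\<^esub>"
    using pauli_groupI by (metis pauli_group_simps)
qed

lemma inv_pauli_op: "inv\<^bsub>pauli_group n\<^esub> (pauli_op n x z) = pauli_op n x z"
  by (rule group.inv_equality[OF group_pauli_group]) (auto simp: pauli_op_square)

definition psign :: "bit \<Rightarrow> complex" where "psign b = (if b = 0 then 1 else -1)"

lemma psign_eq_1_iff [simp]: "psign b = 1 \<longleftrightarrow> b = 0" "psign 0 = 1"
  by (auto simp: psign_def)

lemma psign_inject [simp]: "psign b = psign c \<longleftrightarrow> b = c"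
  by (cases b; cases c) (auto simp: psign_def)

lemma pauli_op_mult_carrier [simp]:
  "pauli_op n x z * pauli_op n x' z' \<in> carrier_mat (2 ^ n) (2 ^ n)"
  by (rule mult_carrier_mat[of _ _ "2 ^ n"]) auto

text \<open>Both Pauli factors are invertible: multiplying by them again on either side leaves a
  multiple of the identity, from which the scalar is read off. The product form fits the two sides
  of a commutation relation.\<close>

lemma pauli_op_nonzero:
  "c \<cdot>\<^sub>m (pauli_op n x z * pauli_op n x' z') = d \<cdot>\<^sub>m (pauli_op n x z * pauli_op n x' z') \<longleftrightarrow> c = d"
proof
  assume eq: "c \<cdot>\<^sub>m (pauli_op n x z * pauli_op n x' z') = d \<cdot>\<^sub>m (pauli_op n x z * pauli_op n x' z')"
  let ?A = "pauli_op n x z" and ?B = "pauli_op n x' z'"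
  have AB: "?A * (?A * ?B) * ?B = 1\<^sub>m (2 ^ n)"
    by (simp add: assoc_mult_mat[of _ "2^n" "2^n" _ "2^n" _ "2^n", symmetric] pauli_op_square)
  have *: "?A * (c \<cdot>\<^sub>m (?A * ?B)) * ?B = c \<cdot>\<^sub>m 1\<^sub>m (2 ^ n)" for c
    by (subst AB[symmetric]) (simp add: mult_carrier_mat[of _ "2 ^ n" "2 ^ n" _ "2 ^ n"] mult_smult_distrib[of _ "2 ^ n" "2 ^ n" _ "2 ^ n"] mult_smult_assoc_mat[of _ "2 ^ n" "2 ^ n" _ "2 ^ n"])
  have "c \<cdot>\<^sub>m (1\<^sub>m (2 ^ n) :: complex mat) = d \<cdot>\<^sub>m 1\<^sub>m (2 ^ n)" using eq * by metis
  then have "(c \<cdot>\<^sub>m (1\<^sub>m (2 ^ n) :: complex mat)) $$ (0, 0) = (d \<cdot>\<^sub>m 1\<^sub>m (2 ^ n)) $$ (0, 0)" by simp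
  then show "c = d" by simp
qed simp

lemma smult_pauli_op_commute:
  "(c \<cdot>\<^sub>m pauli_op n x z) * pauli_op n x' z' =
   psign (dot n x z' + dot n z x') \<cdot>\<^sub>m (pauli_op n x' z' * (c \<cdot>\<^sub>m pauli_op n x z))"
  using pauli_op_commute[of n x z x' z']
  by (simp add: mult_smult_assoc_mat[of _ "2 ^ n" "2 ^ n" _ "2 ^ n"]
      mult_smult_distrib[of _ "2 ^ n" "2 ^ n" _ "2 ^ n"] smult_smult_mat psign_def)

lemma smult_pauli_op_commute_iff:
  assumes "c \<noteq> 0"
  shows "(c \<cdot>\<^sub>m pauli_op n x z) * pauli_op n x' z' = pauli_op n x' z' * (c \<cdot>\<^sub>m pauli_op n x z) \<longleftrightarrow>
         dot n x z' + dot n z x' = 0"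
  using pauli_op_nonzero[of "psign (dot n x z' + dot n z x') * c" n x' z' x z c] assms
  unfolding smult_pauli_op_commute
  by (simp add: mult_smult_distrib[of _ "2 ^ n" "2 ^ n" _ "2 ^ n"] smult_smult_mat)

lemma pauli_op_commute_iff:
  "pauli_op n x z * pauli_op n x' z' = pauli_op n x' z' * pauli_op n x z \<longleftrightarrow>
   dot n x z' + dot n z x' = 0"
  using smult_pauli_op_commute_iff[of 1 n x z x' z'] by simp

lemma dot_zero [simp]: "dot n (\<lambda>_. 0) v = 0" "dot n v (\<lambda>_. 0) = 0"
  by (simp_all add: dot_def)

lemma dot_add: "dot n (\<lambda>q. v q + w q) u = dot n v u + dot n w u"
  by (simp add: dot_def distrib_right sum.distrib)

lemma dot_commute: "dot n v w = dot n w v"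
  by (simp add: dot_def mult.commute)

lemma dot_delta: "q < n \<Longrightarrow> dot n v (\<lambda>p. of_bool (p = q)) = v q"
proof -
  assume q: "q < n"
  have "dot n v (\<lambda>p. of_bool (p = q)) = (\<Sum>p<n. if p = q then v p else 0)"
    unfolding dot_def by (intro sum.cong) auto
  then show ?thesis using q by simp
qed

text \<open>Equal matrices commute with the same operators, and commutation with X and with Z on
  qubit \<open>q\<close> reveals \<open>z q\<close> and \<open>x q\<close>.\<close>

lemma smult_pauli_op_eqD:
  assumes "c \<cdot>\<^sub>m pauli_op n x z = d \<cdot>\<^sub>m pauli_op n x' z'" "c \<noteq> 0" "d \<noteq> 0" "q < n"
  shows "x q = x' q" "z q = z' q"
proof -
  have "dot n x v + dot n z u = 0 \<longleftrightarrow> dot n x' v + dot n z' u = 0" for u v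
    using smult_pauli_op_commute_iff[OF assms(2), of n x z u v]
      smult_pauli_op_commute_iff[OF assms(3), of n x' z' u v] unfolding assms(1) by simp
  from this[of "\<lambda>p. of_bool (p = q)" "\<lambda>_. 0"] this[of "\<lambda>_. 0" "\<lambda>p. of_bool (p = q)"]
  have "z q = 0 \<longleftrightarrow> z' q = 0" "x q = 0 \<longleftrightarrow> x' q = 0"
    using dot_delta[OF \<open>q < n\<close>] by auto
  then show "x q = x' q" "z q = z' q" by (metis bit_not_zero_iff)+
qed

lemma pauli_support_smult:
  "pauli_support n (\<i> ^ k \<cdot>\<^sub>m pauli_op n x z) = {q. q < n \<and> (x q \<noteq> 0 \<or> z q \<noteq> 0)}"
proof (intro Set.set_eqI iffI)
  fix q assume "q \<in> pauli_support n (\<i> ^ k \<cdot>\<^sub>m pauli_op n x z)"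
  then obtain l P where q: "q < n" "P q \<noteq> PI"
    and eq: "\<i> ^ k \<cdot>\<^sub>m pauli_op n x z = \<i> ^ l \<cdot>\<^sub>m pauli_op n (xbit \<circ> P) (zbit \<circ> P)"
    unfolding pauli_support_def pauli_tensor_eq_pauli_op by blast
  have "x q = xbit (P q)" "z q = zbit (P q)"
    using smult_pauli_op_eqD[OF eq _ _ q(1)] by auto
  then have "pauli_xz (x q) (z q) \<noteq> PI" using q(2) by simp
  then show "q \<in> {q. q < n \<and> (x q \<noteq> 0 \<or> z q \<noteq> 0)}" using q(1) unfolding pauli_xz_eq_PI by blast
next
  fix q assume q: "q \<in> {q. q < n \<and> (x q \<noteq> 0 \<or> z q \<noteq> 0)}"
  have "\<i> ^ k \<cdot>\<^sub>m pauli_op n x z = \<i> ^ (k mod 4) \<cdot>\<^sub>m pauli_tensor n (\<lambda>q. pauli_xz (x q) (z q))"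
    by (simp add: i_power_mod_4 pauli_op_def)
  moreover have "pauli_xz (x q) (z q) \<noteq> PI" using q unfolding pauli_xz_eq_PI by blast
  moreover have "k mod 4 < 4" by simp
  ultimately show "q \<in> pauli_support n (\<i> ^ k \<cdot>\<^sub>m pauli_op n x z)"
    using q unfolding pauli_support_def by blast
qed

lemma pauli_support_pauli_op: "pauli_support n (pauli_op n x z) = {q. q < n \<and> (x q \<noteq> 0 \<or> z q \<noteq> 0)}"
  using pauli_support_smult[of n 0] by simp

section \<open>Hermitian involutions on complex vectors\<close>

no_notation Finite_Cartesian_Product.vec.vec_nth (infixl "$" 90)

definition cinner :: "nat \<Rightarrow> complex vec \<Rightarrow> complex vec \<Rightarrow> complex" where
  "cinner N \<phi> \<xi> = (\<Sum>a<N. \<phi> $ a * cnj (\<xi> $ a))"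

lemma cinner_self: "cinner N \<phi> \<phi> = complex_of_real (\<Sum>a<N. (cmod (\<phi> $ a))\<^sup>2)"
  by (simp only: cinner_def of_real_sum complex_norm_square)

lemma cinner_self_eq_0:
  assumes "\<phi> \<in> carrier_vec N" "cinner N \<phi> \<phi> = 0"
  shows "\<phi> = 0\<^sub>v N"
proof (rule eq_vecI)
  fix a assume "a < dim_vec (0\<^sub>v N :: complex vec)"
  then have a: "a < N" by simp
  have "(\<Sum>a<N. (cmod (\<phi> $ a))\<^sup>2) = 0" using assms(2) unfolding cinner_self by (metis of_real_eq_0_iff)
  then show "\<phi> $ a = 0\<^sub>v N $ a" using a by (simp add: sum_nonneg_eq_0_iff)
qed (use assms in auto)

lemma mult_mat_vec_nth:
  "h \<in> carrier_mat N N \<Longrightarrow> \<phi> \<in> carrier_vec N \<Longrightarrow> a < N \<Longrightarrow> (h *\<^sub>v \<phi>) $ a = (\<Sum>b<N. h $$ (a, b) * \<phi> $ b)"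
  by (auto simp: scalar_prod_def atLeast0LessThan)

definition herm_involution :: "nat \<Rightarrow> complex mat \<Rightarrow> bool" where
  "herm_involution N h \<longleftrightarrow> h \<in> carrier_mat N N \<and> h * h = 1\<^sub>m N \<and>
     (\<forall>a<N. \<forall>b<N. h $$ (b, a) = cnj (h $$ (a, b)))"

lemma herm_involution_pauli_op: "herm_involution (2 ^ n) (pauli_op n x z)"
  by (auto simp: herm_involution_def pauli_op_square intro: pauli_op_hermitian)

lemma cinner_hermitian:
  assumes h: "herm_involution N h" and \<phi>: "\<phi> \<in> carrier_vec N" and \<xi>: "\<xi> \<in> carrier_vec N"
  shows "cinner N (h *\<^sub>v \<phi>) \<xi> = cinner N \<phi> (h *\<^sub>v \<xi>)"
proof -
  have hc: "h \<in> carrier_mat N N" and hh: "\<And>a b. a < N \<Longrightarrow> b < N \<Longrightarrow> cnj (h $$ (a, b)) = h $$ (b, a)"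
    using h unfolding herm_involution_def by (blast, metis)
  have "cinner N (h *\<^sub>v \<phi>) \<xi> = (\<Sum>a<N. \<Sum>b<N. h $$ (a, b) * \<phi> $ b * cnj (\<xi> $ a))"
    by (simp add: cinner_def mult_mat_vec_nth[OF hc \<phi>] sum_distrib_right del: index_mult_mat_vec)
  also have "\<dots> = (\<Sum>b<N. \<Sum>a<N. h $$ (a, b) * \<phi> $ b * cnj (\<xi> $ a))" by (rule sum.swap)
  also have "\<dots> = (\<Sum>b<N. \<phi> $ b * cnj (\<Sum>a<N. h $$ (b, a) * \<xi> $ a))"
    using hh by (auto simp: sum_distrib_left intro!: sum.cong)
  also have "\<dots> = cinner N \<phi> (h *\<^sub>v \<xi>)"
    unfolding cinner_def by (intro sum.cong) (simp_all add: mult_mat_vec_nth[OF hc \<xi>] del: index_mult_mat_vec)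
  finally show ?thesis .
qed

text \<open>Being Hermitian with square 1, \<open>h\<close> preserves norms, and the two cross terms
  agree. The identity turns an expectation value of \<open>h\<close> into a nonnegative defect that
  vanishes only on vectors fixed by \<open>h\<close>.\<close>

lemma cinner_diff_involution:
  assumes h: "herm_involution N h" and \<phi>: "\<phi> \<in> carrier_vec N"
  shows "cinner N (h *\<^sub>v \<phi> - \<phi>) (h *\<^sub>v \<phi> - \<phi>) = 2 * cinner N \<phi> \<phi> - 2 * cinner N (h *\<^sub>v \<phi>) \<phi>"
proof -
  have hc: "h \<in> carrier_mat N N" "h * h = 1\<^sub>m N" using h unfolding herm_involution_def by blast+
  then have h\<phi>: "h *\<^sub>v \<phi> \<in> carrier_vec N" using \<phi> by simp
  have hh: "h *\<^sub>v (h *\<^sub>v \<phi>) = \<phi>"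
    using hc \<phi> by (simp add: assoc_mult_mat_vec[symmetric])
  have expand: "cinner N (\<alpha> - \<beta>) (\<alpha> - \<beta>) = cinner N \<alpha> \<alpha> + cinner N \<beta> \<beta> - cinner N \<alpha> \<beta> - cinner N \<beta> \<alpha>"
    if "\<alpha> \<in> carrier_vec N" "\<beta> \<in> carrier_vec N" for \<alpha> \<beta>
    using that by (simp add: cinner_def algebra_simps sum.distrib sum_subtractf)
  show ?thesis
    using cinner_hermitian[OF h \<phi> \<phi>] cinner_hermitian[OF h \<phi> h\<phi>] by (simp add: expand[OF h\<phi> \<phi>] hh)
qed

section \<open>Spectrum of stabilizer Hamiltonians\<close>

lemma smult_mult_mat_vec:
  assumes "A \<in> carrier_mat N N" "v \<in> carrier_vec N"
  shows "((c :: complex) \<cdot>\<^sub>m A) *\<^sub>v v = c \<cdot>\<^sub>v (A *\<^sub>v v)"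
  using assms by (intro eq_vecI) (auto simp: scalar_prod_def sum_distrib_left mult.assoc)

text \<open>A nonzero vector fixed by all of \<open>R\<close> is assumed outright: it shows that
  \<open>- card R\<close> is attained as an eigenvalue and that a ground state exists.\<close>

locale stabilizer_hamiltonian =
  fixes n :: nat and R :: "complex mat set" and \<psi>\<^sub>0 :: "complex vec"
  assumes finite_R: "finite R"
    and R_pauli: "h \<in> R \<Longrightarrow> \<exists>x z. h = pauli_op n x z"
    and code_state: "\<psi>\<^sub>0 \<in> carrier_vec (2 ^ n)" "\<psi>\<^sub>0 \<noteq> 0\<^sub>v (2 ^ n)"
    and code_state_fixed: "h \<in> R \<Longrightarrow> h *\<^sub>v \<psi>\<^sub>0 = \<psi>\<^sub>0"
begin

abbreviation "H \<equiv> hamiltonian n R"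

lemma H_carrier [simp]: "H \<in> carrier_mat (2 ^ n) (2 ^ n)"
  by (simp add: hamiltonian_def)

lemma R_carrier: "h \<in> R \<Longrightarrow> h \<in> carrier_mat (2 ^ n) (2 ^ n)"
  using R_pauli by force

lemma R_involution: "h \<in> R \<Longrightarrow> herm_involution (2 ^ n) h"
  using R_pauli herm_involution_pauli_op by metis

lemma H_mult_vec_nth:
  assumes \<phi>: "\<phi> \<in> carrier_vec (2 ^ n)" and a: "a < 2 ^ n"
  shows "(H *\<^sub>v \<phi>) $ a = - (\<Sum>h\<in>R. (h *\<^sub>v \<phi>) $ a)"
proof -
  have "(H *\<^sub>v \<phi>) $ a = (\<Sum>b<2 ^ n. (- (\<Sum>h\<in>R. h $$ (a, b))) * \<phi> $ b)"
    unfolding mult_mat_vec_nth[OF H_carrier \<phi> a] using a by (intro sum.cong) (auto simp: hamiltonian_def)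
  also have "\<dots> = - (\<Sum>b<2 ^ n. \<Sum>h\<in>R. h $$ (a, b) * \<phi> $ b)"
    by (simp add: sum_distrib_right sum_negf)
  also have "\<dots> = - (\<Sum>h\<in>R. \<Sum>b<2 ^ n. h $$ (a, b) * \<phi> $ b)"
    by (subst sum.swap) simp
  also have "\<dots> = - (\<Sum>h\<in>R. (h *\<^sub>v \<phi>) $ a)"
    by (simp only: mult_mat_vec_nth[OF R_carrier \<phi> a] cong: sum.cong)
  finally show ?thesis .
qed

text \<open>Each summand on the left is the squared norm of \<open>h \<phi> - \<phi>\<close>. Hence \<open>e \<ge> - card R\<close>, with equality only
  if \<open>\<phi>\<close> is fixed by \<open>R\<close>.\<close>

lemma sum_defects:
  assumes \<phi>: "\<phi> \<in> carrier_vec (2 ^ n)" and ev: "H *\<^sub>v \<phi> = complex_of_real e \<cdot>\<^sub>v \<phi>"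
  shows "(\<Sum>h\<in>R. cinner (2 ^ n) (h *\<^sub>v \<phi> - \<phi>) (h *\<^sub>v \<phi> - \<phi>)) =
         2 * complex_of_real (real (card R) + e) * cinner (2 ^ n) \<phi> \<phi>"
proof -
  have "(\<Sum>h\<in>R. cinner (2 ^ n) (h *\<^sub>v \<phi>) \<phi>) = (\<Sum>a<2 ^ n. \<Sum>h\<in>R. (h *\<^sub>v \<phi>) $ a * cnj (\<phi> $ a))"
    unfolding cinner_def by (rule sum.swap)
  also have "\<dots> = (\<Sum>a<2 ^ n. - (H *\<^sub>v \<phi>) $ a * cnj (\<phi> $ a))"
    by (intro sum.cong refl) (simp only: H_mult_vec_nth[OF \<phi>] lessThan_iff sum_distrib_right minus_minus)
  also have "\<dots> = - complex_of_real e * cinner (2 ^ n) \<phi> \<phi>"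
    unfolding ev cinner_def sum_distrib_left using \<phi> by (intro sum.cong refl) simp
  finally have "(\<Sum>h\<in>R. cinner (2 ^ n) (h *\<^sub>v \<phi>) \<phi>) = - complex_of_real e * cinner (2 ^ n) \<phi> \<phi>" .
  then show ?thesis
    by (simp add: cinner_diff_involution[OF R_involution \<phi>] sum_subtractf algebra_simps flip: sum_distrib_left)
qed

lemma cinner_nonneg: "Re (cinner N \<phi> \<phi>) \<ge> 0"
  by (simp add: cinner_self sum_nonneg)

lemma cinner_self_Re: "cinner N \<phi> \<phi> = complex_of_real (Re (cinner N \<phi> \<phi>))"
  unfolding cinner_self by simp

lemma cinner_pos: "\<phi> \<in> carrier_vec N \<Longrightarrow> \<phi> \<noteq> 0\<^sub>v N \<Longrightarrow> Re (cinner N \<phi> \<phi>) > 0"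
  using cinner_nonneg[of N \<phi>] cinner_self_eq_0[of \<phi> N] cinner_self_Re[of N \<phi>]
  by (metis less_eq_real_def of_real_0)

lemma sum_defects_Re:
  assumes "\<phi> \<in> carrier_vec (2 ^ n)" "H *\<^sub>v \<phi> = complex_of_real e \<cdot>\<^sub>v \<phi>"
  shows "(\<Sum>h\<in>R. Re (cinner (2 ^ n) (h *\<^sub>v \<phi> - \<phi>) (h *\<^sub>v \<phi> - \<phi>))) =
         2 * (real (card R) + e) * Re (cinner (2 ^ n) \<phi> \<phi>)"
  using arg_cong[OF sum_defects[OF assms], of Re] cinner_self_Re[of "2 ^ n" \<phi>]
  by (simp add: cinner_self)

text \<open>Used with all \<open>s h = 1\<close> for the code state, and with the commutation signs
  of \<open>E\<close> for the excited state \<open>E *\<^sub>v \<psi>\<close>.\<close>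

lemma fixed_eigen:
  assumes \<phi>: "\<phi> \<in> carrier_vec (2 ^ n)" and s: "\<And>h. h \<in> R \<Longrightarrow> h *\<^sub>v \<phi> = complex_of_real (s h) \<cdot>\<^sub>v \<phi>"
  shows "H *\<^sub>v \<phi> = complex_of_real (- (\<Sum>h\<in>R. s h)) \<cdot>\<^sub>v \<phi>"
proof (rule eq_vecI)
  fix a assume "a < dim_vec (complex_of_real (- (\<Sum>h\<in>R. s h)) \<cdot>\<^sub>v \<phi>)"
  then have a: "a < 2 ^ n" using \<phi> by simp
  show "(H *\<^sub>v \<phi>) $ a = (complex_of_real (- (\<Sum>h\<in>R. s h)) \<cdot>\<^sub>v \<phi>) $ a"
    using a \<phi> by (simp add: H_mult_vec_nth[OF \<phi> a] s sum_distrib_right del: index_mult_mat_vec cong: sum.cong)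
qed (use \<phi> in \<open>simp add: hamiltonian_def\<close>)

lemma ground_energy_eq: "ground_energy n R = - real (card R)"
  unfolding ground_energy_def
proof (rule Min_eqI)
  \<comment> \<open>\<open>Min\<close> is meaningful only for a finite set; the eigenvalues are
    roots of the characteristic polynomial.\<close>
  have "{e. eigenvalue H (complex_of_real e)} \<subseteq> Re ` {k. poly (char_poly H) k = 0}"
    using eigenvalue_root_char_poly[OF H_carrier] by force
  moreover have "finite {k. poly (char_poly H) k = 0}"
    using degree_monic_char_poly[OF H_carrier] by (intro poly_roots_finite) auto
  ultimately show "finite {e. eigenvalue H (complex_of_real e)}" by (rule finite_surj[rotated])
next
  fix e assume "e \<in> {e. eigenvalue H (complex_of_real e)}"
  then obtain \<phi> where \<phi>: "\<phi> \<in> carrier_vec (2 ^ n)" "\<phi> \<noteq> 0\<^sub>v (2 ^ n)" "H *\<^sub>v \<phi> = complex_of_real e \<cdot>\<^sub>v \<phi>"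
    by (auto simp: eigenvalue_def eigenvector_def hamiltonian_def)
  have "0 \<le> 2 * (real (card R) + e) * Re (cinner (2 ^ n) \<phi> \<phi>)"
    using sum_defects_Re[OF \<phi>(1,3)] cinner_nonneg by (metis (no_types, lifting) sum_nonneg)
  then show "- real (card R) \<le> e"
    using cinner_pos[OF \<phi>(1,2)] by (simp add: zero_le_mult_iff)
next
  have "H *\<^sub>v \<psi>\<^sub>0 = complex_of_real (- (\<Sum>h\<in>R. 1)) \<cdot>\<^sub>v \<psi>\<^sub>0"
    using code_state code_state_fixed by (intro fixed_eigen) auto
  then show "- real (card R) \<in> {e. eigenvalue H (complex_of_real e)}"
    using code_state by (auto simp: eigenvalue_def eigenvector_def hamiltonian_def)
qed

lemma ground_state_code_state: "ground_state n R \<psi>\<^sub>0"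
proof -
  have "H *\<^sub>v \<psi>\<^sub>0 = complex_of_real (- (\<Sum>h\<in>R. 1)) \<cdot>\<^sub>v \<psi>\<^sub>0"
    using code_state code_state_fixed by (intro fixed_eigen) auto
  then show ?thesis
    using code_state by (auto simp: ground_state_def ground_energy_eq eigenvector_def hamiltonian_def)
qed

text \<open>At energy \<open>- card R\<close> the nonnegative defects add up to 0, so each of them
  vanishes. Every ground state is thus a code state, and the arbitrary choice in
  \<open>pauli_energy\<close> does no harm.\<close>

lemma ground_stateD:
  assumes "ground_state n R \<psi>"
  shows "\<psi> \<in> carrier_vec (2 ^ n)" "\<psi> \<noteq> 0\<^sub>v (2 ^ n)" "h \<in> R \<Longrightarrow> h *\<^sub>v \<psi> = \<psi>"
proof -
  show \<psi>: "\<psi> \<in> carrier_vec (2 ^ n)" "\<psi> \<noteq> 0\<^sub>v (2 ^ n)"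
    using assms by (auto simp: ground_state_def eigenvector_def hamiltonian_def)
  have ev: "H *\<^sub>v \<psi> = complex_of_real (- real (card R)) \<cdot>\<^sub>v \<psi>"
    using assms unfolding ground_state_def eigenvector_def ground_energy_eq by blast
  assume h: "h \<in> R"
  have "(\<Sum>h\<in>R. Re (cinner (2 ^ n) (h *\<^sub>v \<psi> - \<psi>) (h *\<^sub>v \<psi> - \<psi>))) = 0"
    unfolding sum_defects_Re[OF \<psi>(1) ev] by simp
  then have "Re (cinner (2 ^ n) (h *\<^sub>v \<psi> - \<psi>) (h *\<^sub>v \<psi> - \<psi>)) = 0"
    using h finite_R cinner_nonneg by (simp add: sum_nonneg_eq_0_iff)
  then have "cinner (2 ^ n) (h *\<^sub>v \<psi> - \<psi>) (h *\<^sub>v \<psi> - \<psi>) = 0"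
    by (metis cinner_self_Re of_real_0)
  then have "h *\<^sub>v \<psi> - \<psi> = 0\<^sub>v (2 ^ n)"
    using \<psi>(1) R_carrier[OF h] by (intro cinner_self_eq_0) auto
  then have *: "(h *\<^sub>v \<psi> - \<psi>) $ a = 0" if "a < 2 ^ n" for a using that by simp
  show "h *\<^sub>v \<psi> = \<psi>"
  proof (rule eq_vecI)
    fix a assume "a < dim_vec \<psi>"
    then show "(h *\<^sub>v \<psi>) $ a = \<psi> $ a"
      using *[of a] \<psi>(1) R_carrier[OF h] by (simp del: index_mult_mat_vec)
  qed (use \<psi>(1) R_carrier[OF h] in simp)
qed

text \<open>\<open>E\<close> carries a code state to a joint eigenvector of \<open>R\<close>, with
  eigenvalue 1 or -1 for \<open>h\<close> according to whether \<open>h\<close> commutes or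
  anticommutes with \<open>E\<close>. Each -1 costs energy 2.\<close>

theorem pauli_energy_eq:
  assumes E: "E \<in> carrier (pauli_group n)"
  shows "pauli_energy n R E = 2 * real (card {h \<in> R. E * h \<noteq> h * E})"
proof -
  define \<psi> where "\<psi> = (SOME \<psi>. ground_state n R \<psi>)"
  have gs: "ground_state n R \<psi>"
    unfolding \<psi>_def using ground_state_code_state by (rule someI)
  note \<psi> = ground_stateD[OF gs]
  define \<phi> where "\<phi> = E *\<^sub>v \<psi>"
  have Ec: "E \<in> carrier_mat (2 ^ n) (2 ^ n)" using E by (rule pauli_group_carrier_mat)
  have \<phi>: "\<phi> \<in> carrier_vec (2 ^ n)" unfolding \<phi>_def using Ec \<psi>(1) by simp
  obtain k x z where Ek: "E = \<i> ^ k \<cdot>\<^sub>m pauli_op n x z" using E by (rule pauli_groupE)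
  \<comment> \<open>The energy is a quotient by the squared norm, so this vector must not vanish; it
    does not because \<open>E\<close> is invertible.\<close>
  have \<phi>0: "\<phi> \<noteq> 0\<^sub>v (2 ^ n)"
  proof
    assume 0: "\<phi> = 0\<^sub>v (2 ^ n)"
    interpret group "pauli_group n" by (rule group_pauli_group)
    have "inv\<^bsub>pauli_group n\<^esub> E * E = 1\<^sub>m (2 ^ n)" using l_inv[OF E] by simp
    moreover have ic: "inv\<^bsub>pauli_group n\<^esub> E \<in> carrier_mat (2 ^ n) (2 ^ n)"
      using E by (intro pauli_group_carrier_mat) simp
    ultimately have "\<psi> = inv\<^bsub>pauli_group n\<^esub> E *\<^sub>v \<phi>"
      unfolding \<phi>_def using Ec \<psi>(1) by (simp add: assoc_mult_mat_vec[symmetric])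
    then have "\<psi> = 0\<^sub>v (2 ^ n)" unfolding 0 using ic by (auto simp: scalar_prod_def)
    then show False using \<psi>(2) by simp
  qed
  define s :: "complex mat \<Rightarrow> real" where "s h = (if E * h = h * E then 1 else -1)" for h
  have "h *\<^sub>v \<phi> = complex_of_real (s h) \<cdot>\<^sub>v \<phi>" if h: "h \<in> R" for h
  proof -
    obtain x' z' where h': "h = pauli_op n x' z'" using R_pauli[OF h] by blast
    let ?b = "dot n x z' + dot n z x'"
    have comm: "E * h = psign ?b \<cdot>\<^sub>m (h * E)" unfolding Ek h' by (rule smult_pauli_op_commute)
    have sb: "complex_of_real (s h) = psign ?b"
      unfolding s_def Ek h' by (subst smult_pauli_op_commute_iff) (auto simp: psign_def)
    have hc: "h \<in> carrier_mat (2 ^ n) (2 ^ n)" using h by (rule R_carrier)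
    have "\<phi> = E *\<^sub>v (h *\<^sub>v \<psi>)" unfolding \<phi>_def using \<psi>(3)[OF h] by simp
    also have "\<dots> = psign ?b \<cdot>\<^sub>m (h * E) *\<^sub>v \<psi>"
      unfolding assoc_mult_mat_vec[OF Ec hc \<psi>(1), symmetric] comm ..
    also have "\<dots> = psign ?b \<cdot>\<^sub>v (h * E *\<^sub>v \<psi>)"
      using mult_carrier_mat[OF hc Ec] \<psi>(1) by (rule smult_mult_mat_vec)
    also have "h * E *\<^sub>v \<psi> = h *\<^sub>v \<phi>"
      unfolding \<phi>_def by (rule assoc_mult_mat_vec[OF hc Ec \<psi>(1)])
    finally have "psign ?b \<cdot>\<^sub>v \<phi> = psign ?b \<cdot>\<^sub>v (psign ?b \<cdot>\<^sub>v (h *\<^sub>v \<phi>))" by simp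
    also have "\<dots> = h *\<^sub>v \<phi>" by (simp add: smult_smult_assoc psign_def)
    finally show ?thesis unfolding sb by simp
  qed
  then have H\<phi>: "H *\<^sub>v \<phi> = complex_of_real (- (\<Sum>h\<in>R. s h)) \<cdot>\<^sub>v \<phi>" by (intro fixed_eigen \<phi>)
  have "state_energy n R \<phi> = - (\<Sum>h\<in>R. s h)"
  proof -
    have "\<phi> \<bullet>c \<phi> \<noteq> 0" using conjugate_square_eq_0_vec[OF \<phi>] \<phi>0 by simp
    then show ?thesis unfolding state_energy_def H\<phi> using \<phi> by simp
  qed
  moreover have "(\<Sum>h\<in>R. s h) = real (card R) - 2 * real (card {h \<in> R. E * h \<noteq> h * E})"
  proof -
    have "(\<Sum>h\<in>R. s h) = (\<Sum>h\<in>R. 1 - 2 * of_bool (E * h \<noteq> h * E))"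
      by (intro sum.cong) (auto simp: s_def)
    also have "\<dots> = real (card R) - 2 * (\<Sum>h\<in>R. of_bool (E * h \<noteq> h * E))"
      by (simp add: sum_subtractf flip: sum_distrib_left)
    also have "(\<Sum>h\<in>R. of_bool (E * h \<noteq> h * E) :: real) = real (card {h \<in> R. E * h \<noteq> h * E})"
      using finite_R by (simp add: sum.If_cases of_bool_def Int_def)
    finally show ?thesis .
  qed
  ultimately show ?thesis
    unfolding pauli_energy_def ground_energy_eq \<psi>_def[symmetric] \<phi>_def[symmetric] by simp
qed

end

section \<open>CSS codes\<close>

lemma mat_mult_entry:
  "A \<in> carrier_mat N N \<Longrightarrow> B \<in> carrier_mat N N \<Longrightarrow> a < N \<Longrightarrow> b < N \<Longrightarrow>
   (A * B) $$ (a, b) = (\<Sum>c<N. A $$ (a, c) * B $$ (c, b))"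
  by (auto simp: scalar_prod_def atLeast0LessThan)

lemma prod_of_bool: "(\<Prod>q<n. of_bool (P q) :: complex) = of_bool (\<forall>q<n. P q)" for n :: nat
  by (induction n) (auto simp: less_Suc_eq)

abbreviation xop :: "nat \<Rightarrow> (nat \<Rightarrow> bit) \<Rightarrow> complex mat" where
  "xop n v \<equiv> pauli_op n v (\<lambda>_. 0)"

abbreviation zop :: "nat \<Rightarrow> (nat \<Rightarrow> bit) \<Rightarrow> complex mat" where
  "zop n v \<equiv> pauli_op n (\<lambda>_. 0) v"

lemma xop_mult: "xop n v * xop n w = xop n (\<lambda>q. v q + w q)"
proof -
  have "phase1 x 0 x' 0 = 0" for x x' by (simp add: phase1_def pauli_xz.simps)
  then show ?thesis by (simp add: pauli_op_mult phase_def)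
qed

lemma zop_mult: "zop n v * zop n w = zop n (\<lambda>q. v q + w q)"
proof -
  have "phase1 0 z 0 z' = 0" for z z' by (simp add: phase1_def pauli_xz.simps)
  then show ?thesis by (simp add: pauli_op_mult phase_def)
qed

lemma xop_entry_0_0: "xop n v $$ (0, 0) = of_bool (\<forall>q<n. v q = 0)"
proof -
  have "pauli_entry (pauli_xz (v q) 0) False False = of_bool (v q = 0)" for q
    by (simp add: pauli_xz.simps)
  then show ?thesis by (simp add: pauli_op_index prod_of_bool)
qed

lemma zop_entry_0: "b < 2 ^ n \<Longrightarrow> zop n v $$ (b, 0) = of_bool (b = 0)"
proof -
  assume b: "b < 2 ^ n"
  have "pauli_entry (pauli_xz 0 (v q)) s False = of_bool (\<not> s)" for q s
    by (simp add: pauli_xz.simps)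
  moreover have "(\<forall>q<n. \<not> bit b q) \<longleftrightarrow> b = 0"
  proof
    assume h: "\<forall>q<n. \<not> bit b q"
    have "take_bit n b = 0" by (rule bit_eqI) (use h in \<open>auto simp: bit_take_bit_iff\<close>)
    then show "b = 0" using b by (simp add: take_bit_nat_eq_self)
  qed simp
  ultimately show ?thesis using b by (simp add: pauli_op_index prod_of_bool)
qed

lemma finite_vanishing_outside: "finite {v :: nat \<Rightarrow> bit. \<forall>q\<ge>n. v q = 0}"
proof -
  have fin: "finite (UNIV :: bit set)"
    by (rule finite_subset[of _ "{0, 1}"]) (auto simp: bit_not_zero_iff)
  have "{v :: nat \<Rightarrow> bit. \<forall>q\<ge>n. v q = 0} = {v. \<forall>q. (q \<in> {..<n} \<longrightarrow> v q \<in> UNIV) \<and> (q \<notin> {..<n} \<longrightarrow> v q = 0)}"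
    by auto
  then show ?thesis using finite_set_of_finite_funs[of "{..<n}" "UNIV :: bit set" 0] fin by simp
qed

lemma xop_inject:
  assumes "xop n v = xop n w" "\<forall>q\<ge>n. v q = 0" "\<forall>q\<ge>n. w q = 0"
  shows "v = w"
proof
  fix q show "v q = w q"
    using smult_pauli_op_eqD(1)[of 1 n v "\<lambda>_. 0" 1 w "\<lambda>_. 0" q] assms by (cases "q < n") auto
qed

lemma zop_inject:
  assumes "zop n v = zop n w" "\<forall>q\<ge>n. v q = 0" "\<forall>q\<ge>n. w q = 0"
  shows "v = w"
proof
  fix q show "v q = w q"
    using smult_pauli_op_eqD(2)[of 1 n "\<lambda>_. 0" v 1 "\<lambda>_. 0" w q] assms by (cases "q < n") auto
qed

text \<open>A step may change no bit at all: multiplication by a single-qubit Z leaves the X part of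
  an operator as it was.\<close>

definition flip_path :: "nat \<Rightarrow> nat \<Rightarrow> (nat \<Rightarrow> nat \<Rightarrow> bit) \<Rightarrow> bool" where
  "flip_path n T v \<longleftrightarrow> (\<forall>q<n. v 0 q = 0) \<and> (\<forall>t<T. \<exists>p. \<forall>q<n. q \<noteq> p \<longrightarrow> v (Suc t) q = v t q)"

text \<open>The two exactness assumptions make \<open>xlog\<close> and \<open>zlog\<close> the only
  logical pair: whatever commutes with the opposite generators and the opposite logical operator is
  a product of generators. Generator vectors vanish from \<open>n\<close> on so that they are
  determined by their operators.\<close>

locale css_code =
  fixes n :: nat and I :: "'i set" and X :: "'i \<Rightarrow> nat \<Rightarrow> bit"
    and J :: "'j set" and Z :: "'j \<Rightarrow> nat \<Rightarrow> bit" and xlog zlog :: "nat \<Rightarrow> bit"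
  assumes finite_I: "finite I" and finite_J: "finite J"
    and X_outside: "i \<in> I \<Longrightarrow> n \<le> q \<Longrightarrow> X i q = 0"
    and Z_outside: "j \<in> J \<Longrightarrow> n \<le> q \<Longrightarrow> Z j q = 0"
    and X_Z: "i \<in> I \<Longrightarrow> j \<in> J \<Longrightarrow> dot n (X i) (Z j) = 0"
    and X_zlog: "i \<in> I \<Longrightarrow> dot n (X i) zlog = 0"
    and xlog_Z: "j \<in> J \<Longrightarrow> dot n xlog (Z j) = 0"
    and xlog_zlog: "dot n xlog zlog = 1"
    and exact_X: "(\<forall>j\<in>J. dot n v (Z j) = 0) \<Longrightarrow> dot n v zlog = 0 \<Longrightarrow>
                  \<exists>c. \<forall>q<n. v q = (\<Sum>i\<in>I. c i * X i q)"
    and exact_Z: "(\<forall>i\<in>I. dot n v (X i) = 0) \<Longrightarrow> dot n v xlog = 0 \<Longrightarrow>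
                  \<exists>c. \<forall>q<n. v q = (\<Sum>j\<in>J. c j * Z j q)"
begin

definition gens :: "complex mat set" where
  "gens = xop n ` X ` I \<union> zop n ` Z ` J"

definition stab :: "complex mat set" where
  "stab = generate (pauli_group n) gens"

lemma finite_gens: "finite gens"
  using finite_I finite_J by (simp add: gens_def)

lemma gens_pauli: "h \<in> gens \<Longrightarrow> \<exists>x z. h = pauli_op n x z"
  by (auto simp: gens_def)

lemma gens_subset: "gens \<subseteq> carrier (pauli_group n)"
  using gens_pauli by fastforce

lemma gens_subset_stab: "gens \<subseteq> stab"
  unfolding stab_def by (auto intro: generate.incl)

lemma stab_subset: "stab \<subseteq> carrier (pauli_group n)"
  unfolding stab_def by (rule group.generate_incl[OF group_pauli_group gens_subset])

lemma one_stab: "1\<^sub>m (2 ^ n) \<in> stab"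
  using generate.one[of "pauli_group n" gens] by (simp add: stab_def)

lemma mult_stab: "s \<in> stab \<Longrightarrow> t \<in> stab \<Longrightarrow> s * t \<in> stab"
  using generate.eng[of s "pauli_group n" gens t] by (simp add: stab_def)

text \<open>The case of \<open>generate\<close> for inverses disappears because every generator is
  its own inverse.\<close>

lemma stab_induct [consumes 1, case_names one gen mult]:
  assumes "s \<in> stab" "P (1\<^sub>m (2 ^ n))" "\<And>h. h \<in> gens \<Longrightarrow> P h"
    "\<And>s t. s \<in> stab \<Longrightarrow> t \<in> stab \<Longrightarrow> P s \<Longrightarrow> P t \<Longrightarrow> P (s * t)"
  shows "P s"
  using assms(1) unfolding stab_def
proof (induction rule: generate.induct)
  case (inv h)
  then have "inv\<^bsub>pauli_group n\<^esub> h = h" using gens_pauli inv_pauli_op by metis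
  then show ?case using inv assms(3) by simp
next
  case (eng s t)
  then show ?case using assms(4) unfolding stab_def by simp
qed (use assms in auto)

lemma commute_stab:
  assumes E: "E \<in> carrier (pauli_group n)" and comm: "\<And>h. h \<in> gens \<Longrightarrow> E * h = h * E" and s: "s \<in> stab"
  shows "E * s = s * E"
  using s
proof (induction rule: stab_induct)
  case one
  then show ?case using pauli_group_carrier_mat[OF E] by simp
next
  case (mult s t)
  have [simp]: "s \<in> carrier_mat (2 ^ n) (2 ^ n)" "t \<in> carrier_mat (2 ^ n) (2 ^ n)"
    "E \<in> carrier_mat (2 ^ n) (2 ^ n)"
    using E mult(1,2) stab_subset pauli_group_carrier_mat by blast+
  have "E * (s * t) = (E * s) * t"
    by (rule assoc_mult_mat[symmetric, of _ "2 ^ n" "2 ^ n" _ "2 ^ n" _ "2 ^ n"]) simp_all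
  also have "\<dots> = s * (E * t)" unfolding mult.IH(1)
    by (rule assoc_mult_mat[of _ "2 ^ n" "2 ^ n" _ "2 ^ n" _ "2 ^ n"]) simp_all
  also have "\<dots> = (s * t) * E" unfolding mult.IH(2)
    by (rule assoc_mult_mat[symmetric, of _ "2 ^ n" "2 ^ n" _ "2 ^ n" _ "2 ^ n"]) simp_all
  finally show ?case .
qed (rule comm)

text \<open>Membership is the linear condition of commuting with the Z-type generators rather than
  lying in the span of the \<open>X i\<close>; closure under adding \<open>X i\<close> is then
  immediate from \<open>X_Z\<close>.\<close>

definition x_group :: "(nat \<Rightarrow> bit) set" where
  "x_group = {v. (\<forall>q\<ge>n. v q = 0) \<and> (\<forall>j\<in>J. dot n v (Z j) = 0)}"

text \<open>Column \<open>0\<close> of a matrix is its value at \<open>|0\<dots>0\<rangle>\<close>, so this is the sum of \<open>xop n v |0\<dots>0\<rangle>\<close>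
  over the \<open>X\<close>-type operators that commute with all \<open>Z\<close>-type generators.\<close>

definition code_vec :: "complex vec" where
  "code_vec = vec (2 ^ n) (\<lambda>a. \<Sum>v\<in>x_group. xop n v $$ (a, 0))"

lemma finite_x_group: "finite x_group"
  unfolding x_group_def using finite_subset[OF _ finite_vanishing_outside] by (metis (no_types, lifting) Collect_mono)

lemma mult_code_vec_nth:
  assumes h: "h \<in> carrier_mat (2 ^ n) (2 ^ n)" and a: "a < 2 ^ n"
  shows "(h *\<^sub>v code_vec) $ a = (\<Sum>v\<in>x_group. (h * xop n v) $$ (a, 0))"
proof -
  have c: "code_vec \<in> carrier_vec (2 ^ n)" by (simp add: code_vec_def)
  have "(h *\<^sub>v code_vec) $ a = (\<Sum>b<2 ^ n. \<Sum>v\<in>x_group. h $$ (a, b) * xop n v $$ (b, 0))"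
    unfolding mult_mat_vec_nth[OF h c a] by (intro sum.cong) (auto simp: code_vec_def sum_distrib_left)
  also have "\<dots> = (\<Sum>v\<in>x_group. \<Sum>b<2 ^ n. h $$ (a, b) * xop n v $$ (b, 0))" by (rule sum.swap)
  also have "\<dots> = (\<Sum>v\<in>x_group. (h * xop n v) $$ (a, 0))"
    using mat_mult_entry[OF h pauli_op_carrier a] by (intro sum.cong) auto
  finally show ?thesis .
qed

text \<open>An X-type generator permutes the summands of the state. A Z-type generator commutes past
  each of them and fixes the basis state with index 0.\<close>

lemma gens_fix_code_vec:
  assumes "h \<in> gens"
  shows "h *\<^sub>v code_vec = code_vec"
proof (rule eq_vecI)
  fix a assume "a < dim_vec code_vec"
  then have a: "a < 2 ^ n" by (simp add: code_vec_def)
  consider i where "i \<in> I" "h = xop n (X i)" | j where "j \<in> J" "h = zop n (Z j)"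
    using assms by (auto simp: gens_def)
  then have "(\<Sum>v\<in>x_group. (h * xop n v) $$ (a, 0)) = (\<Sum>v\<in>x_group. xop n v $$ (a, 0))"
  proof cases
    case 1
    have maps: "(\<lambda>q. X i q + v q) \<in> x_group" if "v \<in> x_group" for v
      using that X_outside[OF 1(1)] X_Z[OF 1(1)] by (simp add: x_group_def dot_add)
    have inv: "(\<lambda>q. X i q + (X i q + v q)) = v" for v by simp
    have "(\<Sum>v\<in>x_group. xop n (\<lambda>q. X i q + v q) $$ (a, 0)) = (\<Sum>v\<in>x_group. xop n v $$ (a, 0))"
      by (rule sum.reindex_bij_witness[of _ "\<lambda>v q. X i q + v q" "\<lambda>v q. X i q + v q"])
         (use maps inv in auto)
    then show ?thesis by (simp add: 1(2) xop_mult)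
  next
    case 2
    have "(h * xop n v) $$ (a, 0) = xop n v $$ (a, 0)" if v: "v \<in> x_group" for v
    proof -
      have "h * xop n v = xop n v * h"
        unfolding 2(2) pauli_op_commute_iff using v 2(1) by (simp add: x_group_def dot_commute)
      then have "(h * xop n v) $$ (a, 0) = (\<Sum>b<2 ^ n. xop n v $$ (a, b) * h $$ (b, 0))"
        using a by (simp add: 2(2) mat_mult_entry[OF pauli_op_carrier pauli_op_carrier] del: index_mult_mat)
      also have "\<dots> = (\<Sum>b<(2::nat) ^ n. if b = 0 then xop n v $$ (a, 0) else 0)"
        by (intro sum.cong) (auto simp: 2(2) zop_entry_0)
      finally show ?thesis by simp
    qed
    then show ?thesis by simp
  qed
  moreover have "h \<in> carrier_mat (2 ^ n) (2 ^ n)"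
    using assms gens_subset pauli_group_carrier_mat by blast
  ultimately show "(h *\<^sub>v code_vec) $ a = code_vec $ a"
    using mult_code_vec_nth[OF _ a] a by (simp add: code_vec_def)
next
  have "h \<in> carrier_mat (2 ^ n) (2 ^ n)"
    using assms gens_subset pauli_group_carrier_mat by blast
  then show "dim_vec (h *\<^sub>v code_vec) = dim_vec code_vec" by (simp add: code_vec_def)
qed

text \<open>Only the zero vector contributes to entry 0. So the state is nonzero, and the negative
  of the identity does not fix it.\<close>

lemma code_vec_0: "code_vec $ 0 = 1"
proof -
  have "code_vec $ 0 = (\<Sum>v\<in>x_group. xop n v $$ (0, 0))" by (simp add: code_vec_def)
  also have "\<dots> = (\<Sum>v\<in>x_group. if v = (\<lambda>_. 0) then 1 else 0)"
  proof (intro sum.cong refl)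
    fix v assume "v \<in> x_group"
    then have "(\<forall>q<n. v q = 0) \<longleftrightarrow> v = (\<lambda>_. 0)"
      unfolding x_group_def fun_eq_iff using not_le_imp_less by blast
    then show "xop n v $$ (0, 0) = (if v = (\<lambda>_. 0) then 1 else 0)" by (simp add: xop_entry_0_0)
  qed
  also have "\<dots> = 1"
  proof -
    have "(\<lambda>_. 0) \<in> x_group" by (simp add: x_group_def)
    then show ?thesis using finite_x_group by simp
  qed
  finally show ?thesis .
qed

sublocale stabilizer_hamiltonian n gens code_vec
proof
  show "code_vec \<noteq> 0\<^sub>v (2 ^ n)" using code_vec_0 by auto
qed (use finite_gens gens_pauli gens_fix_code_vec in \<open>auto simp: code_vec_def\<close>)

lemma stab_fix_code_vec: "s \<in> stab \<Longrightarrow> s *\<^sub>v code_vec = code_vec"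
proof (induction rule: stab_induct)
  case (mult s t)
  then show ?case
    using assoc_mult_mat_vec[of s "2 ^ n" "2 ^ n" t "2 ^ n" code_vec] stab_subset pauli_group_carrier_mat
      code_state(1) by (metis subset_iff)
qed (use code_state(1) gens_fix_code_vec in auto)

lemma stabilizer_group_stab: "stabilizer_group n stab"
  unfolding stabilizer_group_def
proof
  show "subgroup stab (pauli_group n)"
    unfolding stab_def by (rule group.generate_is_subgroup[OF group_pauli_group gens_subset])
  show "- 1\<^sub>m (2 ^ n) \<notin> stab"
  proof
    assume "- 1\<^sub>m (2 ^ n) \<in> stab"
    then have "(- 1\<^sub>m (2 ^ n)) *\<^sub>v code_vec = code_vec" by (rule stab_fix_code_vec)
    moreover have "- 1\<^sub>m (2 ^ n) = (-1 :: complex) \<cdot>\<^sub>m 1\<^sub>m (2 ^ n)" by (rule eq_matI) auto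
    ultimately have "(-1) \<cdot>\<^sub>v code_vec = code_vec"
      using smult_mult_mat_vec[of "1\<^sub>m (2 ^ n)" "2 ^ n" code_vec "-1"] code_state(1) by simp
    then have "((-1) \<cdot>\<^sub>v code_vec) $ 0 = code_vec $ 0" by simp
    then show False using code_vec_0 code_state(1) by simp
  qed
qed

lemma generating_set_gens: "generating_set n stab gens"
  using gens_subset_stab by (simp add: generating_set_def stab_def)

section \<open>Logical operators and energies of the CSS code\<close>

lemma xop_combination: "finite A \<Longrightarrow> A \<subseteq> I \<Longrightarrow> xop n (\<lambda>q. \<Sum>i\<in>A. c i * X i q) \<in> stab"
proof (induction rule: finite_induct)
  case empty
  then show ?case using one_stab by (simp add: pauli_op_zero)
next
  case (insert i A)
  have "xop n (X i) \<in> stab" using insert gens_subset_stab by (auto simp: gens_def)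
  then show ?case
    using insert mult_stab[of "xop n (X i)" "xop n (\<lambda>q. \<Sum>i\<in>A. c i * X i q)"]
    by (cases "c i") (simp_all add: xop_mult)
qed

lemma zop_combination: "finite A \<Longrightarrow> A \<subseteq> J \<Longrightarrow> zop n (\<lambda>q. \<Sum>j\<in>A. c j * Z j q) \<in> stab"
proof (induction rule: finite_induct)
  case empty
  then show ?case using one_stab by (simp add: pauli_op_zero)
next
  case (insert j A)
  have "zop n (Z j) \<in> stab" using insert gens_subset_stab by (auto simp: gens_def)
  then show ?case
    using insert mult_stab[of "zop n (Z j)" "zop n (\<lambda>q. \<Sum>j\<in>A. c j * Z j q)"]
    by (cases "c j") (simp_all add: zop_mult)
qed

lemma commute_X_iff: "k \<in> I \<Longrightarrow> (\<i> ^ l \<cdot>\<^sub>m pauli_op n x z) * xop n (X k) = xop n (X k) * (\<i> ^ l \<cdot>\<^sub>m pauli_op n x z) \<longleftrightarrow> dot n z (X k) = 0"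
  by (subst smult_pauli_op_commute_iff) auto

lemma commute_Z_iff: "k \<in> J \<Longrightarrow> (\<i> ^ l \<cdot>\<^sub>m pauli_op n x z) * zop n (Z k) = zop n (Z k) * (\<i> ^ l \<cdot>\<^sub>m pauli_op n x z) \<longleftrightarrow> dot n x (Z k) = 0"
  by (subst smult_pauli_op_commute_iff) auto

text \<open>If both pairings vanished, exactness would write \<open>x\<close> and \<open>z\<close>
  as sums of generator vectors, and the operator would agree with a stabilizer up to a power of
  \<i>.\<close>

lemma nontrivial_logicalD:
  assumes nl: "nontrivial_logical n stab (\<i> ^ k \<cdot>\<^sub>m pauli_op n x z)"
  shows "\<forall>j\<in>J. dot n x (Z j) = 0" "\<forall>i\<in>I. dot n z (X i) = 0" "dot n x zlog = 1 \<or> dot n z xlog = 1"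
proof -
  have comm: "(\<i> ^ k \<cdot>\<^sub>m pauli_op n x z) * h = h * (\<i> ^ k \<cdot>\<^sub>m pauli_op n x z)" if "h \<in> gens" for h
    using nl that gens_subset_stab unfolding nontrivial_logical_def by blast
  show x: "\<forall>j\<in>J. dot n x (Z j) = 0"
  proof
    fix j assume j: "j \<in> J"
    then have "zop n (Z j) \<in> gens" by (auto simp: gens_def)
    from comm[OF this] show "dot n x (Z j) = 0" unfolding commute_Z_iff[OF j] .
  qed
  show z: "\<forall>i\<in>I. dot n z (X i) = 0"
  proof
    fix i assume i: "i \<in> I"
    then have "xop n (X i) \<in> gens" by (auto simp: gens_def)
    from comm[OF this] show "dot n z (X i) = 0" unfolding commute_X_iff[OF i] .
  qed
  show "dot n x zlog = 1 \<or> dot n z xlog = 1"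
  proof (rule ccontr)
    assume "\<not> ?thesis"
    then have "dot n x zlog = 0" "dot n z xlog = 0" by auto
    then obtain c d where c: "\<forall>q<n. x q = (\<Sum>i\<in>I. c i * X i q)" and d: "\<forall>q<n. z q = (\<Sum>j\<in>J. d j * Z j q)"
      using exact_X[OF x] exact_Z[OF z] by blast
    have "xop n x = xop n (\<lambda>q. \<Sum>i\<in>I. c i * X i q)" using c by (intro pauli_op_cong) auto
    then have "xop n x \<in> stab" using xop_combination[OF finite_I] by simp
    moreover have "zop n z = zop n (\<lambda>q. \<Sum>j\<in>J. d j * Z j q)" using d by (intro pauli_op_cong) auto
    then have "zop n z \<in> stab" using zop_combination[OF finite_J] by simp
    ultimately have "xop n x * zop n z \<in> stab" by (rule mult_stab)
    moreover obtain p where "xop n x * zop n z = \<i> ^ p \<cdot>\<^sub>m pauli_op n x z"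
      using pauli_op_mult[of n x "\<lambda>_. 0" "\<lambda>_. 0" z] by simp
    ultimately have "(\<i> ^ p / \<i> ^ k) \<cdot>\<^sub>m (\<i> ^ k \<cdot>\<^sub>m pauli_op n x z) \<in> stab"
      by (simp add: smult_smult_mat)
    moreover have "norm (\<i> ^ p / \<i> ^ k) = 1" by (simp add: norm_divide norm_power)
    ultimately show False using nl unfolding nontrivial_logical_def by blast
  qed
qed

text \<open>\<open>zop n zlog\<close> commutes with all stabilizers but anticommutes with
  \<open>xop n xlog\<close>, so no phase multiple of the latter is a stabilizer.\<close>

lemma nontrivial_logical_xop:
  assumes "\<forall>q<n. v q = xlog q"
  shows "nontrivial_logical n stab (xop n v)"
proof -
  have v: "xop n v = xop n xlog" using assms by (intro pauli_op_cong) auto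
  have Zcomm: "zop n zlog * s = s * zop n zlog" if "s \<in> stab" for s
    using that
  proof (rule commute_stab[rotated 2])
    fix h assume "h \<in> gens"
    then show "zop n zlog * h = h * zop n zlog"
      by (auto simp: gens_def pauli_op_commute_iff dot_commute[of _ zlog] X_zlog)
  qed simp
  have "xop n xlog * s = s * xop n xlog" if "s \<in> stab" for s
    using that
  proof (rule commute_stab[rotated 2])
    fix h assume "h \<in> gens"
    then show "xop n xlog * h = h * xop n xlog"
      by (auto simp: gens_def pauli_op_commute_iff xlog_Z)
  qed simp
  moreover have "c \<cdot>\<^sub>m xop n xlog \<notin> stab" if "norm c = 1" for c
  proof
    assume "c \<cdot>\<^sub>m xop n xlog \<in> stab"
    from Zcomm[OF this] have "(c \<cdot>\<^sub>m xop n xlog) * zop n zlog = zop n zlog * (c \<cdot>\<^sub>m xop n xlog)" by simp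
    then show False using that xlog_zlog by (subst (asm) smult_pauli_op_commute_iff) auto
  qed
  ultimately show ?thesis unfolding v nontrivial_logical_def by auto
qed

text \<open>The X part of \<open>E\<close> is detected by the Z-type generators and vice versa.
  Cardinalities are taken of images because indices with equal vectors give one and the same element
  of \<open>gens\<close>.\<close>

lemma pauli_energy_lower:
  assumes "E = \<i> ^ k \<cdot>\<^sub>m pauli_op n x z"
  shows "2 * real (card (Z ` {j \<in> J. dot n x (Z j) = 1})) \<le> pauli_energy n gens E"
    and "2 * real (card (X ` {i \<in> I. dot n z (X i) = 1})) \<le> pauli_energy n gens E"
proof -
  have E: "E \<in> carrier (pauli_group n)" unfolding assms by (rule pauli_groupI)
  let ?B = "{h \<in> gens. E * h \<noteq> h * E}"
  have fin: "finite ?B" using finite_gens by simp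
  have sub: "zop n ` Z ` {j \<in> J. dot n x (Z j) = 1} \<subseteq> ?B"
    using commute_Z_iff[of _ k x z] unfolding assms gens_def by auto
  have inj: "inj_on (zop n) (Z ` {j \<in> J. dot n x (Z j) = 1})"
    by (intro inj_onI zop_inject[of n]) (auto simp: Z_outside)
  have "card (Z ` {j \<in> J. dot n x (Z j) = 1}) \<le> card ?B"
    using card_mono[OF fin sub] unfolding card_image[OF inj] .
  then show "2 * real (card (Z ` {j \<in> J. dot n x (Z j) = 1})) \<le> pauli_energy n gens E"
    unfolding pauli_energy_eq[OF E] by simp
  have sub: "xop n ` X ` {i \<in> I. dot n z (X i) = 1} \<subseteq> ?B"
    using commute_X_iff[of _ k x z] unfolding assms gens_def by auto
  have inj: "inj_on (xop n) (X ` {i \<in> I. dot n z (X i) = 1})"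
    by (intro inj_onI xop_inject[of n]) (auto simp: X_outside)
  have "card (X ` {i \<in> I. dot n z (X i) = 1}) \<le> card ?B"
    using card_mono[OF fin sub] unfolding card_image[OF inj] .
  then show "2 * real (card (X ` {i \<in> I. dot n z (X i) = 1})) \<le> pauli_energy n gens E"
    unfolding pauli_energy_eq[OF E] by simp
qed

lemma pauli_energy_xop_upper: "pauli_energy n gens (xop n v) \<le> 2 * real (card {j \<in> J. dot n v (Z j) = 1})"
proof -
  have "{h \<in> gens. xop n v * h \<noteq> h * xop n v} \<subseteq> (\<lambda>j. zop n (Z j)) ` {j \<in> J. dot n v (Z j) = 1}"
    by (auto simp: gens_def pauli_op_commute_iff)
  then have "card {h \<in> gens. xop n v * h \<noteq> h * xop n v} \<le> card {j \<in> J. dot n v (Z j) = 1}"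
    using finite_J by (intro surj_card_le) auto
  then show ?thesis by (simp add: pauli_energy_eq)
qed

text \<open>The X and Z parts of a logical path are flip paths, and one of them ends with a
  nontrivial pairing, so one of the two barrier assumptions applies. The path \<open>w\<close> gives
  the upper bound and also the nonemptiness of the set whose \<open>Min\<close> is taken, which the
  lower bound relies on.\<close>

lemma energy_barrier_bounds:
  assumes Z_barrier: "\<And>T v. flip_path n T v \<Longrightarrow> (\<forall>j\<in>J. dot n (v T) (Z j) = 0) \<Longrightarrow> dot n (v T) zlog = 1 \<Longrightarrow>
      \<exists>t\<le>T. b \<le> card (Z ` {j \<in> J. dot n (v t) (Z j) = 1})"
    and X_barrier: "\<And>T v. flip_path n T v \<Longrightarrow> (\<forall>i\<in>I. dot n (v T) (X i) = 0) \<Longrightarrow> dot n (v T) xlog = 1 \<Longrightarrow>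
      \<exists>t\<le>T. b \<le> card (X ` {i \<in> I. dot n (v t) (X i) = 1})"
    and path: "\<forall>q<n. w 0 q = 0" "\<forall>t<T\<^sub>0. \<exists>p<n. \<forall>q<n. w (Suc t) q = w t q + of_bool (q = p)"
      "\<forall>q<n. w T\<^sub>0 q = xlog q" "\<forall>t\<le>T\<^sub>0. card {j \<in> J. dot n (w t) (Z j) = 1} \<le> b'"
  shows "2 * real b \<le> energy_barrier n stab gens" "energy_barrier n stab gens \<le> 2 * real b'"
proof -
  let ?M = "\<lambda>T E. Max ((\<lambda>t. pauli_energy n gens (E t)) ` {..T})"
  let ?B = "{?M T E | T E. logical_path n stab T E}"
  have energy_in: "pauli_energy n gens E \<in> (\<lambda>k. 2 * real k) ` {..card gens}"
    if "E \<in> carrier (pauli_group n)" for E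
    using pauli_energy_eq[OF that] card_mono[OF finite_gens, of "{h \<in> gens. E * h \<noteq> h * E}"] by auto
  \<comment> \<open>Infinitely many paths compete, but energies are even integers between 0 and
    twice the number of generators.\<close>
  have fin: "finite ?B"
  proof (rule finite_subset)
    show "?B \<subseteq> (\<lambda>k. 2 * real k) ` {..card gens}"
    proof
      fix e assume "e \<in> ?B"
      then obtain T E where e: "e = ?M T E" and path: "logical_path n stab T E" by blast
      have "e \<in> (\<lambda>t. pauli_energy n gens (E t)) ` {..T}" unfolding e by (rule Max_in) auto
      then show "e \<in> (\<lambda>k. 2 * real k) ` {..card gens}"
        using path energy_in unfolding logical_path_def by blast
    qed
  qed simp
  have wpath: "logical_path n stab T\<^sub>0 (\<lambda>t. xop n (w t))"
    unfolding logical_path_def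
  proof (intro conjI allI impI)
    show "xop n (w 0) = 1\<^sub>m (2 ^ n)"
      unfolding pauli_op_zero[symmetric] using path(1) by (intro pauli_op_cong) auto
    show "nontrivial_logical n stab (xop n (w T\<^sub>0))" using path(3) by (rule nontrivial_logical_xop)
    fix t assume "t < T\<^sub>0"
    then obtain p where p: "p < n" "\<forall>q<n. w (Suc t) q = w t q + of_bool (q = p)" using path(2) by blast
    have "pauli_support n (xop n (\<lambda>q. of_bool (q = p))) = {p}"
      using p(1) by (auto simp: pauli_support_pauli_op)
    moreover have "xop n (w (Suc t)) = xop n (\<lambda>q. of_bool (q = p)) * xop n (w t)"
      unfolding xop_mult using p(2) by (intro pauli_op_cong) (auto simp: add.commute)
    ultimately show "\<exists>P\<in>carrier (pauli_group n). (\<exists>q. pauli_support n P = {q}) \<and> xop n (w (Suc t)) = P * xop n (w t)"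
      by (intro bexI[of _ "xop n (\<lambda>q. of_bool (q = p))"]) auto
  qed simp
  then have ne: "?M T\<^sub>0 (\<lambda>t. xop n (w t)) \<in> ?B"
    by (intro CollectI exI[of _ T\<^sub>0] exI[of _ "\<lambda>t. xop n (w t)"] conjI refl)
  have "energy_barrier n stab gens \<le> ?M T\<^sub>0 (\<lambda>t. xop n (w t))"
    unfolding energy_barrier_def using fin ne by (rule Min_le)
  also have "\<dots> \<le> 2 * real b'"
  proof (subst Max_le_iff)
    show "\<forall>a\<in>(\<lambda>t. pauli_energy n gens (xop n (w t))) ` {..T\<^sub>0}. a \<le> 2 * real b'"
    proof
      fix a assume "a \<in> (\<lambda>t. pauli_energy n gens (xop n (w t))) ` {..T\<^sub>0}"
      then obtain t where "t \<le> T\<^sub>0" "a = pauli_energy n gens (xop n (w t))" by auto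
      moreover have "real (card {j \<in> J. dot n (w t) (Z j) = 1}) \<le> real b'"
        using path(4) \<open>t \<le> T\<^sub>0\<close> by simp
      ultimately show "a \<le> 2 * real b'" using pauli_energy_xop_upper[of "w t"] by linarith
    qed
  qed auto
  finally show "energy_barrier n stab gens \<le> 2 * real b'" .
  show "2 * real b \<le> energy_barrier n stab gens"
    unfolding energy_barrier_def
  proof (subst Min_ge_iff)
    show "\<forall>e\<in>?B. 2 * real b \<le> e"
    proof
      fix e assume "e \<in> ?B"
      then obtain T E where e: "e = ?M T E" and lp: "logical_path n stab T E" by blast
      have "\<exists>k x z. E t = \<i> ^ k \<cdot>\<^sub>m pauli_op n x z" if "t \<le> T" for t
        using lp that pauli_groupE unfolding logical_path_def by metis
      then obtain k x z where E: "\<And>t. t \<le> T \<Longrightarrow> E t = \<i> ^ k t \<cdot>\<^sub>m pauli_op n (x t) (z t)" by metis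
      have E0: "\<i> ^ k 0 \<cdot>\<^sub>m pauli_op n (x 0) (z 0) = 1 \<cdot>\<^sub>m pauli_op n (\<lambda>_. 0) (\<lambda>_. 0)"
        using lp E[of 0] unfolding logical_path_def pauli_op_zero by simp
      have start: "x 0 q = 0" "z 0 q = 0" if "q < n" for q
        using smult_pauli_op_eqD[OF E0 _ _ that] by auto
      have step: "\<exists>p. \<forall>q<n. q \<noteq> p \<longrightarrow> x (Suc t) q = x t q \<and> z (Suc t) q = z t q" if t: "t < T" for t
      proof -
        obtain P p where P: "P \<in> carrier (pauli_group n)" "pauli_support n P = {p}" "E (Suc t) = P * E t"
          using lp t unfolding logical_path_def by blast
        obtain l x' z' where P': "P = \<i> ^ l \<cdot>\<^sub>m pauli_op n x' z'" using P(1) by (rule pauli_groupE)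
        have P0: "x' q = 0 \<and> z' q = 0" if "q < n" "q \<noteq> p" for q
          using P(2) that unfolding P' pauli_support_smult by blast
        have "\<i> ^ k (Suc t) \<cdot>\<^sub>m pauli_op n (x (Suc t)) (z (Suc t)) =
            (\<i> ^ l * \<i> ^ k t * \<i> ^ phase n x' z' (x t) (z t)) \<cdot>\<^sub>m pauli_op n (\<lambda>q. x' q + x t q) (\<lambda>q. z' q + z t q)"
          using P(3) E[of t] E[of "Suc t"] t unfolding P' by (simp add: smult_pauli_op_mult)
        from smult_pauli_op_eqD[OF this] show ?thesis
          using P0 by (intro exI[of _ p]) auto
      qed
      have "flip_path n T x" "flip_path n T z"
        unfolding flip_path_def using start step by meson+
      moreover have "nontrivial_logical n stab (\<i> ^ k T \<cdot>\<^sub>m pauli_op n (x T) (z T))"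
        using lp E[of T] unfolding logical_path_def by simp
      note nl = nontrivial_logicalD[OF this]
      ultimately obtain t where t: "t \<le> T"
        "b \<le> card (Z ` {j \<in> J. dot n (x t) (Z j) = 1}) \<or> b \<le> card (X ` {i \<in> I. dot n (z t) (X i) = 1})"
        using Z_barrier[of T x] X_barrier[of T z] by blast
      have "2 * real b \<le> pauli_energy n gens (E t)"
        using t(2)
      proof
        assume "b \<le> card (Z ` {j \<in> J. dot n (x t) (Z j) = 1})"
        then have "real b \<le> real (card (Z ` {j \<in> J. dot n (x t) (Z j) = 1}))" by simp
        then show ?thesis using pauli_energy_lower(1)[OF E[OF t(1)]] by linarith
      next
        assume "b \<le> card (X ` {i \<in> I. dot n (z t) (X i) = 1})"
        then have "real b \<le> real (card (X ` {i \<in> I. dot n (z t) (X i) = 1}))" by simp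
        then show ?thesis using pauli_energy_lower(2)[OF E[OF t(1)]] by linarith
      qed
      also have "\<dots> \<le> e" unfolding e using t(1) by (intro Max_ge) auto
      finally show "2 * real b \<le> e" .
    qed
  qed (use fin ne in blast)+
qed

end

section \<open>Products of graphs\<close>

text \<open>Adding the indicators gives the incidence matrix over the two-element field, in which a
  loop has boundary 0.\<close>

definition inc :: "'a \<Rightarrow> 'a \<times> 'a \<Rightarrow> bit" where
  "inc u e = of_bool (fst e = u) + of_bool (snd e = u)"

lemma sum_of_bool_mult:
  fixes h :: "'a \<Rightarrow> bit"
  assumes "finite A" "a \<in> A"
  shows "(\<Sum>x\<in>A. of_bool (x = a) * h x) = h a" "(\<Sum>x\<in>A. h x * of_bool (x = a)) = h a"
    "(\<Sum>x\<in>A. of_bool (a = x) * h x) = h a" "(\<Sum>x\<in>A. h x * of_bool (a = x)) = h a"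
proof -
  have "(\<Sum>x\<in>A. if x = a then h x else 0) = h a" using assms by simp
  moreover have "of_bool (x = a) * h x = (if x = a then h x else 0)"
    "h x * of_bool (x = a) = (if x = a then h x else 0)"
    "of_bool (a = x) * h x = (if x = a then h x else 0)"
    "h x * of_bool (a = x) = (if x = a then h x else 0)" for x by auto
  ultimately show "(\<Sum>x\<in>A. of_bool (x = a) * h x) = h a" "(\<Sum>x\<in>A. h x * of_bool (x = a)) = h a"
    "(\<Sum>x\<in>A. of_bool (a = x) * h x) = h a" "(\<Sum>x\<in>A. h x * of_bool (a = x)) = h a"
    by simp_all
qed

lemma sum_inc:
  assumes "finite V" "e \<in> V \<times> V"
  shows "(\<Sum>u\<in>V. a u * inc u e) = a (fst e) + a (snd e)"
  using assms by (auto simp: inc_def distrib_left sum.distrib sum_of_bool_mult)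

lemma bit_add_eq_0_iff: "(a :: bit) + b = 0 \<longleftrightarrow> a = b"
  by (cases a; cases b) auto

lemma bit_add_eq_1_iff: "(a :: bit) + b = 1 \<longleftrightarrow> a \<noteq> b"
  by (cases a; cases b) auto

text \<open>Asymmetry rules out loops and pairs of opposite edges, so that distinct edges have
  distinct incidence vectors.\<close>

locale rooted_graph =
  fixes V :: "'a set" and E :: "('a \<times> 'a) set" and r :: 'a
  assumes finite_V: "finite V" and E_subset: "E \<subseteq> V \<times> V" and root: "r \<in> V"
    and connected: "u \<in> V \<Longrightarrow> (r, u) \<in> (E \<union> E\<inverse>)\<^sup>*"
    and asymmetric: "(u, v) \<in> E \<Longrightarrow> (v, u) \<notin> E"
begin

lemma finite_E: "finite E"
  using finite_subset[OF E_subset] finite_V by blast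

lemma constant_on_V:
  assumes "\<And>e. e \<in> E \<Longrightarrow> s (fst e) = s (snd e)" "u \<in> V"
  shows "s u = s r"
  using connected[OF assms(2)] by (induction rule: rtrancl_induct) (use assms(1) in force)+

text \<open>A path from the root to \<open>v\<close> has boundary \<open>r + v\<close>. Superposing
  such paths with weights \<open>a v\<close> yields \<open>a\<close> plus the total of
  \<open>a\<close> placed at the root, and that total is 0.\<close>

lemma boundary_surj:
  fixes a :: "'a \<Rightarrow> bit"
  assumes "(\<Sum>u\<in>V. a u) = 0"
  shows "\<exists>c. \<forall>u\<in>V. (\<Sum>e\<in>E. c e * inc u e) = a u"
proof -
  have "\<exists>c. \<forall>u\<in>V. (\<Sum>e\<in>E. c e * inc u e) = of_bool (u = r) + of_bool (u = v)" if "v \<in> V" for v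
    using connected[OF that]
  proof (induction rule: rtrancl_induct)
    case base
    then show ?case by (intro exI[of _ "\<lambda>_. 0"]) simp
  next
    case (step v w)
    then obtain c where c: "\<And>u. u \<in> V \<Longrightarrow> (\<Sum>e\<in>E. c e * inc u e) = of_bool (u = r) + of_bool (u = v)"
      by blast
    obtain e0 where e0: "e0 \<in> E" "e0 = (v, w) \<or> e0 = (w, v)" using step(2) by blast
    have "inc u e0 = of_bool (u = v) + of_bool (u = w)" for u
      using e0(2) by (auto simp: inc_def)
    moreover have "(\<Sum>e\<in>E. (c e + of_bool (e = e0)) * inc u e) = (\<Sum>e\<in>E. c e * inc u e) + inc u e0"
      for u using sum_of_bool_mult(1)[OF finite_E e0(1)] by (simp only: distrib_right sum.distrib)
    ultimately have "(\<Sum>e\<in>E. (c e + of_bool (e = e0)) * inc u e) = of_bool (u = r) + of_bool (u = w)"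
      if "u \<in> V" for u
      using c[OF that] by (simp add: add.assoc)
    then show ?case by (intro exI[of _ "\<lambda>e. c e + of_bool (e = e0)"]) simp
  qed
  then obtain C where C: "\<And>v u. v \<in> V \<Longrightarrow> u \<in> V \<Longrightarrow>
      (\<Sum>e\<in>E. C v e * inc u e) = of_bool (u = r) + of_bool (u = v)" by metis
  have "(\<Sum>e\<in>E. (\<Sum>v\<in>V. a v * C v e) * inc u e) = a u" if u: "u \<in> V" for u
  proof -
    have "(\<Sum>e\<in>E. (\<Sum>v\<in>V. a v * C v e) * inc u e) = (\<Sum>v\<in>V. \<Sum>e\<in>E. a v * C v e * inc u e)"
      unfolding sum_distrib_right by (rule sum.swap)
    also have "\<dots> = (\<Sum>v\<in>V. a v * (of_bool (u = r) + of_bool (u = v)))"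
      by (intro sum.cong refl) (simp add: mult.assoc C[OF _ u] flip: sum_distrib_left)
    also have "\<dots> = (\<Sum>v\<in>V. a v) * of_bool (u = r) + a u"
      using u finite_V by (simp add: distrib_left sum.distrib sum_of_bool_mult sum_distrib_right)
    finally show ?thesis using assms by simp
  qed
  then show ?thesis by (intro exI[of _ "\<lambda>e. \<Sum>v\<in>V. a v * C v e"]) simp
qed

lemma inc_eqD:
  assumes "e \<in> E" "e' \<in> E" "\<And>u. u \<in> V \<Longrightarrow> inc u e = inc u e'"
  shows "e = e'"
proof -
  obtain a b a' b' where e: "e = (a, b)" "e' = (a', b')" by (metis surj_pair)
  have V: "a \<in> V" "b \<in> V" "a \<noteq> b" "a' \<noteq> b'" using assms(1,2) E_subset asymmetric e by blast+
  have "inc a e' = 1" "inc b e' = 1" using assms(3)[of a] assms(3)[of b] V by (auto simp: inc_def e)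
  then have "a = a' \<or> a = b'" "b = a' \<or> b = b'" using V by (auto simp: inc_def e split: if_splits)
  then have "e = e' \<or> (a = b' \<and> b = a')" using V e by auto
  then show ?thesis using asymmetric assms(1,2) e by blast
qed

end

definition walls :: "('a \<times> 'a) set \<Rightarrow> ('a \<Rightarrow> bit) \<Rightarrow> ('a \<times> 'a) set" where
  "walls E s = {e \<in> E. s (fst e) \<noteq> s (snd e)}"

definition ising_barrier :: "'a set \<Rightarrow> ('a \<times> 'a) set \<Rightarrow> nat \<Rightarrow> bool" where
  "ising_barrier V E b \<longleftrightarrow>
     (\<forall>T s. (\<forall>u\<in>V. s 0 u = 0) \<and> (\<forall>u\<in>V. s T u = 1) \<and>
        (\<forall>t<T. \<exists>p. \<forall>u\<in>V. u \<noteq> p \<longrightarrow> s (Suc t) u = s t u) \<longrightarrow> (\<exists>t\<le>T. b \<le> card (walls E (s t))))"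

lemma ising_barrierD:
  assumes "ising_barrier V E b" "\<And>u. u \<in> V \<Longrightarrow> s 0 u = 0" "\<And>u. u \<in> V \<Longrightarrow> s T u = 1"
    "\<And>t. t < T \<Longrightarrow> \<exists>p. \<forall>u\<in>V. u \<noteq> p \<longrightarrow> s (Suc t) u = s t u"
  shows "\<exists>t\<le>T. b \<le> card (walls E (s t))"
  using assms unfolding ising_barrier_def by blast

type_synonym ('x, 'v) qubit = "('x \<times> 'v) + (('x \<times> 'x) \<times> ('v \<times> 'v))"

text \<open>Qubits are \<open>V\<^sub>1 \<times> V\<^sub>2\<close> and \<open>E\<^sub>1 \<times> E\<^sub>2\<close>, the \<open>X\<close>-type
  generators are indexed by \<open>V\<^sub>1 \<times> E\<^sub>2\<close> (function \<open>star\<close>) and the \<open>Z\<close>-type ones by \<open>E\<^sub>1 \<times> V\<^sub>2\<close> and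
  \<open>faces \<times> E\<^sub>2\<close> (function \<open>check\<close>).\<close>

fun star :: "'x \<times> ('v \<times> 'v) \<Rightarrow> ('x, 'v) qubit \<Rightarrow> bit" where
  "star (x, e) (Inl (x', u)) = of_bool (x' = x) * inc u e"
| "star (x, e) (Inr (f, e')) = inc x f * of_bool (e' = e)"

fun check :: "(('x \<times> 'x) \<times> 'v) + (('x \<times> 'x) set \<times> ('v \<times> 'v)) \<Rightarrow> ('x, 'v) qubit \<Rightarrow> bit" where
  "check (Inl (f, u)) (Inl (x, u')) = inc x f * of_bool (u' = u)"
| "check (Inl (f, u)) (Inr (f', e)) = of_bool (f' = f) * inc u e"
| "check (Inr (g, e)) (Inl _) = 0"
| "check (Inr (g, e)) (Inr (f, e')) = of_bool (f \<in> g) * of_bool (e' = e)"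

text \<open>\<open>cycle_exact\<close> and \<open>cocycle_exact\<close> are dual forms of the
  vanishing of the first homology of \<open>F\<close>; the former serves the Z-type operators, the
  latter the X-type ones. The enumeration \<open>en\<close> links labels to the numbered qubits of
  the Pauli formalism.\<close>

locale product_code =
  F: rooted_graph V1 E1 r1 + G: rooted_graph V2 E2 r2
  for V1 :: "'x set" and E1 r1 and V2 :: "'v set" and E2 r2 +
  fixes faces :: "('x \<times> 'x) set set"
    and en :: "nat \<Rightarrow> ('x, 'v) qubit" and n :: nat
  assumes finite_faces: "finite faces"
    and faces_subset: "g \<in> faces \<Longrightarrow> g \<subseteq> E1"
    and faces_cycle: "g \<in> faces \<Longrightarrow> x \<in> V1 \<Longrightarrow> (\<Sum>f\<in>g. inc x f) = 0"
    and cycle_exact: "(\<And>x. x \<in> V1 \<Longrightarrow> (\<Sum>f\<in>E1. b f * inc x f) = 0) \<Longrightarrow>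
        \<exists>\<phi>. \<forall>f\<in>E1. b f = (\<Sum>g\<in>faces. \<phi> g * of_bool (f \<in> g))"
    and cocycle_exact: "(\<And>g. g \<in> faces \<Longrightarrow> (\<Sum>f\<in>g. b f) = 0) \<Longrightarrow>
        \<exists>\<beta>. \<forall>f\<in>E1. b f = \<beta> (fst f) + \<beta> (snd f)"
    and en: "bij_betw en {..<n} ((V1 \<times> V2) <+> (E1 \<times> E2))"
begin

abbreviation "Q \<equiv> (V1 \<times> V2) <+> (E1 \<times> E2)"
abbreviation "stars \<equiv> V1 \<times> E2"
abbreviation "checks \<equiv> (E1 \<times> V2) <+> (faces \<times> E2)"

lemma sum_Plus_Times:
  fixes h :: "('a \<times> 'b) + ('c \<times> 'd) \<Rightarrow> bit"
  assumes "finite A" "finite B" "finite C" "finite D"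
  shows "(\<Sum>q\<in>(A \<times> B) <+> (C \<times> D). h q) = (\<Sum>a\<in>A. \<Sum>b\<in>B. h (Inl (a, b))) + (\<Sum>c\<in>C. \<Sum>d\<in>D. h (Inr (c, d)))"
  using assms by (simp add: sum.Plus sum.cartesian_product)

definition pair :: "(('x, 'v) qubit \<Rightarrow> bit) \<Rightarrow> (('x, 'v) qubit \<Rightarrow> bit) \<Rightarrow> bit" where
  "pair v w = (\<Sum>q\<in>Q. v q * w q)"

lemma pair_split:
  "pair v w = (\<Sum>x\<in>V1. \<Sum>u\<in>V2. v (Inl (x, u)) * w (Inl (x, u))) +
     (\<Sum>f\<in>E1. \<Sum>e\<in>E2. v (Inr (f, e)) * w (Inr (f, e)))"
  unfolding pair_def by (rule sum_Plus_Times) (simp_all add: F.finite_V F.finite_E G.finite_V G.finite_E)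

lemma pair_star:
  assumes "x \<in> V1" "e \<in> E2"
  shows "pair v (star (x, e)) = v (Inl (x, fst e)) + v (Inl (x, snd e)) + (\<Sum>f\<in>E1. v (Inr (f, e)) * inc x f)"
proof -
  have e: "e \<in> V2 \<times> V2" using assms G.E_subset by blast
  have "(\<Sum>x'\<in>V1. \<Sum>u\<in>V2. v (Inl (x', u)) * star (x, e) (Inl (x', u)))
      = (\<Sum>x'\<in>V1. of_bool (x' = x) * (\<Sum>u\<in>V2. v (Inl (x', u)) * inc u e))"
    by (simp add: sum_distrib_left ac_simps)
  also have "\<dots> = v (Inl (x, fst e)) + v (Inl (x, snd e))"
    using assms e F.finite_V G.finite_V by (simp add: sum_of_bool_mult sum_inc)
  finally show ?thesis
    using assms G.finite_E by (simp add: pair_split sum_of_bool_mult flip: mult.assoc)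
qed

lemma pair_plaquette:
  assumes "f \<in> E1" "u \<in> V2"
  shows "pair v (check (Inl (f, u))) = v (Inl (fst f, u)) + v (Inl (snd f, u)) + (\<Sum>e\<in>E2. v (Inr (f, e)) * inc u e)"
proof -
  have f: "f \<in> V1 \<times> V1" using assms F.E_subset by blast
  have "(\<Sum>f'\<in>E1. \<Sum>e\<in>E2. v (Inr (f', e)) * check (Inl (f, u)) (Inr (f', e)))
      = (\<Sum>f'\<in>E1. of_bool (f' = f) * (\<Sum>e\<in>E2. v (Inr (f', e)) * inc u e))"
    by (simp add: sum_distrib_left ac_simps)
  also have "\<dots> = (\<Sum>e\<in>E2. v (Inr (f, e)) * inc u e)"
    using assms F.finite_E by (simp add: sum_of_bool_mult)
  moreover have "(\<Sum>x\<in>V1. \<Sum>u'\<in>V2. v (Inl (x, u')) * check (Inl (f, u)) (Inl (x, u')))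
      = v (Inl (fst f, u)) + v (Inl (snd f, u))"
    using assms f F.finite_V G.finite_V by (simp add: sum_of_bool_mult sum_inc flip: mult.assoc)
  ultimately show ?thesis by (simp add: pair_split)
qed

lemma sum_of_bool_member:
  fixes h :: "'c \<Rightarrow> bit"
  assumes "finite A" "B \<subseteq> A"
  shows "(\<Sum>f\<in>A. h f * of_bool (f \<in> B)) = (\<Sum>f\<in>B. h f)"
proof -
  have "(\<Sum>f\<in>A. h f * of_bool (f \<in> B)) = (\<Sum>f\<in>B. h f * of_bool (f \<in> B))"
    by (rule sum.mono_neutral_right) (use assms in auto)
  then show ?thesis by simp
qed

lemma pair_face:
  assumes "g \<in> faces" "e \<in> E2"
  shows "pair v (check (Inr (g, e))) = (\<Sum>f\<in>g. v (Inr (f, e)))"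
proof -
  have "pair v (check (Inr (g, e))) = (\<Sum>f\<in>E1. (\<Sum>e'\<in>E2. v (Inr (f, e')) * of_bool (e' = e)) * of_bool (f \<in> g))"
    by (simp add: pair_split sum_distrib_left ac_simps)
  then show ?thesis
    using assms(2) G.finite_E by (simp add: sum_of_bool_mult sum_of_bool_member[OF F.finite_E faces_subset[OF assms(1)]])
qed

text \<open>The two logical operators lie on transversal slices of \<open>V1 \<times> V2\<close>, so
  they meet in exactly one qubit and anticommute.\<close>

fun xlogq :: "('x, 'v) qubit \<Rightarrow> bit" where
  "xlogq (Inl (x, u)) = of_bool (u = r2)" | "xlogq (Inr _) = 0"

fun zlogq :: "('x, 'v) qubit \<Rightarrow> bit" where
  "zlogq (Inl (x, u)) = of_bool (x = r1)" | "zlogq (Inr _) = 0"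

lemma pair_xlogq: "pair v xlogq = (\<Sum>x\<in>V1. v (Inl (x, r2)))"
  using G.finite_V G.root by (simp add: pair_split sum_of_bool_mult)

lemma pair_zlogq: "pair v zlogq = (\<Sum>u\<in>V2. v (Inl (r1, u)))"
proof -
  have "pair v zlogq = (\<Sum>x\<in>V1. (\<Sum>u\<in>V2. v (Inl (x, u))) * of_bool (x = r1))"
    by (simp add: pair_split sum_distrib_right)
  then show ?thesis using F.finite_V F.root by (simp add: sum_of_bool_mult)
qed

lemma sum_inc_edge: "e \<in> E2 \<Longrightarrow> (\<Sum>u\<in>V2. inc u e) = 0" "f \<in> E1 \<Longrightarrow> (\<Sum>x\<in>V1. inc x f) = 0"
  using sum_inc[OF G.finite_V, of e "\<lambda>_. 1"] sum_inc[OF F.finite_V, of f "\<lambda>_. 1"] G.E_subset F.E_subset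
  by auto

text \<open>The vertex pairs and the edge pairs contribute the same coefficient
  \<open>inc x f * inc u e\<close> to the overlap of a star with a plaquette. A star meets a face in
  the edges at \<open>x\<close>, which are even in number because the face is a cycle.\<close>

lemma pair_star_check:
  assumes "i \<in> stars" "j \<in> checks"
  shows "pair (star i) (check j) = 0"
proof -
  obtain x e where i: "i = (x, e)" "x \<in> V1" "e \<in> E2" using assms(1) by blast
  from assms(2) show ?thesis
  proof (elim PlusE)
    fix fu assume "j = Inl fu" "fu \<in> E1 \<times> V2"
    then obtain f u where j: "j = Inl (f, u)" "f \<in> E1" "u \<in> V2" by blast
    have "(\<Sum>e'\<in>E2. inc x f * of_bool (e' = e) * inc u e') = inc x f * inc u e"
      using i G.finite_E by (simp add: sum_of_bool_mult mult.assoc flip: sum_distrib_left)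
    then show ?thesis unfolding i j using j
      by (simp add: pair_plaquette inc_def[of x] distrib_right)
  next
    fix ge assume "j = Inr ge" "ge \<in> faces \<times> E2"
    then obtain g e' where j: "j = Inr (g, e')" "g \<in> faces" "e' \<in> E2" by blast
    then show ?thesis unfolding i j using faces_cycle[OF j(2) i(2)]
      by (simp add: pair_face flip: sum_distrib_right)
  qed
qed

lemma pair_star_zlogq: "i \<in> stars \<Longrightarrow> pair (star i) zlogq = 0"
  by (auto simp: pair_zlogq sum_inc_edge simp flip: sum_distrib_left)

lemma pair_xlogq_check: "j \<in> checks \<Longrightarrow> pair xlogq (check j) = 0"
  by (auto simp: pair_plaquette pair_face)

lemma pair_xlogq_zlogq: "pair xlogq zlogq = 1"
  using G.finite_V G.root sum_of_bool_mult(1)[of V2 r2 "\<lambda>_. 1"] by (simp add: pair_zlogq)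

text \<open>First the vertex part of \<open>v\<close> is cleaned by plaquettes \<open>(f, u)\<close>, using that \<open>V\<^sub>1\<close> is connected; what remains
  on each \<open>E\<^sub>1 \<times> {e}\<close> is a cycle and hence a sum of faces.\<close>

lemma exact_check:
  assumes "\<And>i. i \<in> stars \<Longrightarrow> pair v (star i) = 0" "pair v xlogq = 0"
  shows "\<exists>c. \<forall>q\<in>Q. v q = (\<Sum>j\<in>checks. c j * check j q)"
proof -
  define a where "a u = (\<Sum>x\<in>V1. v (Inl (x, u)))" for u
  have star0: "v (Inl (x, fst e)) + v (Inl (x, snd e)) = (\<Sum>f\<in>E1. v (Inr (f, e)) * inc x f)"
    if "x \<in> V1" "e \<in> E2" for x e
    using assms(1)[of "(x, e)"] that pair_star[OF that] by (simp add: bit_add_eq_0_iff)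
  \<comment> \<open>Summed over \<open>V1\<close>, the star conditions at \<open>e\<close> lose
    their edge part, since each edge of \<open>E1\<close> has two ends. So \<open>a\<close> is
    constant on the connected second graph, and its value at the root is the pairing with
    \<open>xlogq\<close>.\<close>
  have "a (fst e) = a (snd e)" if e: "e \<in> E2" for e
  proof -
    have "a (fst e) + a (snd e) = (\<Sum>x\<in>V1. \<Sum>f\<in>E1. v (Inr (f, e)) * inc x f)"
      by (simp add: a_def star0[OF _ e] flip: sum.distrib)
    also have "\<dots> = (\<Sum>f\<in>E1. \<Sum>x\<in>V1. v (Inr (f, e)) * inc x f)" by (rule sum.swap)
    also have "\<dots> = 0" by (simp add: sum_inc_edge flip: sum_distrib_left)
    finally show ?thesis by (simp add: bit_add_eq_0_iff)
  qed
  moreover have "a r2 = 0" using assms(2) by (simp add: pair_xlogq a_def)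
  ultimately have a0: "a u = 0" if "u \<in> V2" for u using G.constant_on_V[of a u] that by simp
  have "\<exists>c. \<forall>x\<in>V1. (\<Sum>f\<in>E1. c f * inc x f) = v (Inl (x, u))" if "u \<in> V2" for u
    using a0[OF that] by (intro F.boundary_surj) (simp add: a_def)
  then obtain c where c: "\<And>u x. u \<in> V2 \<Longrightarrow> x \<in> V1 \<Longrightarrow> (\<Sum>f\<in>E1. c u f * inc x f) = v (Inl (x, u))"
    by metis
  have "\<exists>\<phi>. \<forall>f\<in>E1. v (Inr (f, e)) + c (fst e) f + c (snd e) f = (\<Sum>g\<in>faces. \<phi> g * of_bool (f \<in> g))"
    if e: "e \<in> E2" for e
  proof (rule cycle_exact)
    fix x assume x: "x \<in> V1"
    have "fst e \<in> V2" "snd e \<in> V2" using e G.E_subset by auto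
    then show "(\<Sum>f\<in>E1. (v (Inr (f, e)) + c (fst e) f + c (snd e) f) * inc x f) = 0"
      by (simp only: distrib_right sum.distrib c x flip: star0[OF x e]) (simp add: ac_simps)
  qed
  then obtain \<phi> where \<phi>: "\<And>e f. e \<in> E2 \<Longrightarrow> f \<in> E1 \<Longrightarrow>
      v (Inr (f, e)) + c (fst e) f + c (snd e) f = (\<Sum>g\<in>faces. \<phi> e g * of_bool (f \<in> g))" by metis
  define C where "C j = (case j of Inl (f, u) \<Rightarrow> c u f | Inr (g, e) \<Rightarrow> \<phi> e g)" for j
  have sumC: "(\<Sum>j\<in>checks. C j * check j q) = (\<Sum>f\<in>E1. \<Sum>u\<in>V2. c u f * check (Inl (f, u)) q) +
      (\<Sum>g\<in>faces. \<Sum>e\<in>E2. \<phi> e g * check (Inr (g, e)) q)" for q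
    using F.finite_E G.finite_V finite_faces G.finite_E by (simp add: sum_Plus_Times C_def)
  have "v q = (\<Sum>j\<in>checks. C j * check j q)" if "q \<in> Q" for q
    using that
  proof (elim PlusE)
    fix xu assume "q = Inl xu" "xu \<in> V1 \<times> V2"
    then obtain x u where q: "q = Inl (x, u)" "x \<in> V1" "u \<in> V2" by blast
    show ?thesis unfolding sumC q using q c[of u x] G.finite_V
      by (simp add: sum_of_bool_mult flip: mult.assoc)
  next
    fix fe assume "q = Inr fe" "fe \<in> E1 \<times> E2"
    then obtain f e where q: "q = Inr (f, e)" "f \<in> E1" "e \<in> E2" by blast
    have e: "e \<in> V2 \<times> V2" using q G.E_subset by blast
    have "(\<Sum>f'\<in>E1. \<Sum>u\<in>V2. c u f' * check (Inl (f', u)) q)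
        = (\<Sum>f'\<in>E1. of_bool (f = f') * (\<Sum>u\<in>V2. c u f' * inc u e))"
      by (simp add: q sum_distrib_left ac_simps)
    also have "\<dots> = c (fst e) f + c (snd e) f"
      using q e F.finite_E G.finite_V by (simp add: sum_of_bool_mult sum_inc)
    moreover have "(\<Sum>g\<in>faces. \<Sum>e'\<in>E2. \<phi> e' g * check (Inr (g, e')) q)
        = (\<Sum>g\<in>faces. \<phi> e g * of_bool (f \<in> g))"
    proof (intro sum.cong refl)
      fix g
      have "(\<Sum>e'\<in>E2. \<phi> e' g * check (Inr (g, e')) q) = (\<Sum>e'\<in>E2. of_bool (e = e') * (\<phi> e' g * of_bool (f \<in> g)))"
        by (intro sum.cong refl) (simp only: q check.simps ac_simps)
      also have "\<dots> = \<phi> e g * of_bool (f \<in> g)"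
        by (rule sum_of_bool_mult(3)[OF G.finite_E q(3)])
      finally show "(\<Sum>e'\<in>E2. \<phi> e' g * check (Inr (g, e')) q) = \<phi> e g * of_bool (f \<in> g)" .
    qed
    ultimately show ?thesis
      unfolding sumC using \<phi>[OF q(3,2)] by (simp add: q ac_simps flip: \<phi>[OF q(3,2)])
  qed
  then show ?thesis by blast
qed

text \<open>After the vertex part is cleaned, the rest is for every \<open>e\<close> the coboundary of some \<open>\<beta> e\<close>. Normalised to vanish at
  the root, \<open>\<beta>\<close> is for every \<open>x\<close> a cycle in \<open>E\<^sub>2\<close>, so it does not affect the vertex part.\<close>

lemma exact_star:
  assumes "\<And>j. j \<in> checks \<Longrightarrow> pair v (check j) = 0" "pair v zlogq = 0"
  shows "\<exists>c. \<forall>q\<in>Q. v q = (\<Sum>i\<in>stars. c i * star i q)"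
proof -
  define a where "a x = (\<Sum>u\<in>V2. v (Inl (x, u)))" for x
  have plaq0: "v (Inl (fst f, u)) + v (Inl (snd f, u)) = (\<Sum>e\<in>E2. v (Inr (f, e)) * inc u e)"
    if "f \<in> E1" "u \<in> V2" for f u
    using assms(1)[OF InlI[OF SigmaI[OF that]]] pair_plaquette[OF that] by (simp add: bit_add_eq_0_iff)
  have face0: "(\<Sum>f\<in>g. v (Inr (f, e))) = 0" if "g \<in> faces" "e \<in> E2" for g e
    using assms(1)[OF InrI[OF SigmaI[OF that]]] pair_face[OF that] by simp
  have "a (fst f) = a (snd f)" if f: "f \<in> E1" for f
  proof -
    have "a (fst f) + a (snd f) = (\<Sum>u\<in>V2. \<Sum>e\<in>E2. v (Inr (f, e)) * inc u e)"
      by (simp add: a_def plaq0[OF f] flip: sum.distrib)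
    also have "\<dots> = (\<Sum>e\<in>E2. \<Sum>u\<in>V2. v (Inr (f, e)) * inc u e)" by (rule sum.swap)
    also have "\<dots> = 0" by (simp add: sum_inc_edge flip: sum_distrib_left)
    finally show ?thesis by (simp add: bit_add_eq_0_iff)
  qed
  moreover have "a r1 = 0" using assms(2) by (simp add: pair_zlogq a_def)
  ultimately have a0: "a x = 0" if "x \<in> V1" for x using F.constant_on_V[of a x] that by simp
  have "\<exists>c. \<forall>u\<in>V2. (\<Sum>e\<in>E2. c e * inc u e) = v (Inl (x, u))" if "x \<in> V1" for x
    using a0[OF that] by (intro G.boundary_surj) (simp add: a_def)
  then obtain c where c: "\<And>x u. x \<in> V1 \<Longrightarrow> u \<in> V2 \<Longrightarrow> (\<Sum>e\<in>E2. c x e * inc u e) = v (Inl (x, u))"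
    by metis
  have "\<exists>\<beta>. \<forall>f\<in>E1. v (Inr (f, e)) + (c (fst f) e + c (snd f) e) = \<beta> (fst f) + \<beta> (snd f)"
    if e: "e \<in> E2" for e
  proof (rule cocycle_exact)
    fix g assume g: "g \<in> faces"
    have "(\<Sum>f\<in>g. c (fst f) e + c (snd f) e) = (\<Sum>f\<in>g. \<Sum>x\<in>V1. c x e * inc x f)"
      using faces_subset[OF g] F.E_subset by (intro sum.cong refl sum_inc[symmetric, OF F.finite_V]) blast
    also have "\<dots> = (\<Sum>x\<in>V1. \<Sum>f\<in>g. c x e * inc x f)" by (rule sum.swap)
    also have "\<dots> = 0" using faces_cycle[OF g] by (simp flip: sum_distrib_left)
    finally show "(\<Sum>f\<in>g. v (Inr (f, e)) + (c (fst f) e + c (snd f) e)) = 0"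
      using face0[OF g e] by (subst sum.distrib) simp
  qed
  then obtain \<beta> where \<beta>: "\<And>e f. e \<in> E2 \<Longrightarrow> f \<in> E1 \<Longrightarrow>
      v (Inr (f, e)) + (c (fst f) e + c (snd f) e) = \<beta> e (fst f) + \<beta> e (snd f)" by metis
  define \<gamma> where "\<gamma> x e = \<beta> e x + \<beta> e r1" for x e
  have \<gamma>: "\<gamma> (fst f) e + \<gamma> (snd f) e = v (Inr (f, e)) + (c (fst f) e + c (snd f) e)" if "e \<in> E2" "f \<in> E1" for e f
    unfolding \<beta>[OF that] by (simp add: \<gamma>_def ac_simps)
  \<comment> \<open>By the plaquette conditions the boundary of \<open>\<gamma> x\<close> does not
    change along edges of the first graph, and at the root it is 0.\<close>
  have \<gamma>_cycle: "(\<Sum>e\<in>E2. \<gamma> x e * inc u e) = 0" if x: "x \<in> V1" and u: "u \<in> V2" for x u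
  proof -
    let ?s = "\<lambda>x. \<Sum>e\<in>E2. \<gamma> x e * inc u e"
    have "?s (fst f) = ?s (snd f)" if f: "f \<in> E1" for f
    proof -
      have f': "fst f \<in> V1" "snd f \<in> V1" using f F.E_subset by auto
      have "?s (fst f) + ?s (snd f) = (\<Sum>e\<in>E2. (v (Inr (f, e)) + (c (fst f) e + c (snd f) e)) * inc u e)"
        using \<gamma>[OF _ f] by (simp add: sum.distrib[symmetric] distrib_right[symmetric])
      also have "\<dots> = 0"
        by (simp only: distrib_right sum.distrib c[OF f'(1) u] c[OF f'(2) u] flip: plaq0[OF f u])
          (simp add: ac_simps)
      finally show ?thesis by (simp add: bit_add_eq_0_iff)
    qed
    then have "?s x = ?s r1" using x by (rule F.constant_on_V)
    then show ?thesis by (simp add: \<gamma>_def)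
  qed
  define C where "C i = (case i of (x, e) \<Rightarrow> c x e + \<gamma> x e)" for i
  have sumC: "(\<Sum>i\<in>stars. C i * star i q) = (\<Sum>x\<in>V1. \<Sum>e\<in>E2. (c x e + \<gamma> x e) * star (x, e) q)" for q
    by (simp add: sum.cartesian_product C_def split_def)
  have "v q = (\<Sum>i\<in>stars. C i * star i q)" if "q \<in> Q" for q
    using that
  proof (elim PlusE)
    fix xu assume "q = Inl xu" "xu \<in> V1 \<times> V2"
    then obtain x u where q: "q = Inl (x, u)" "x \<in> V1" "u \<in> V2" by blast
    have "(\<Sum>i\<in>stars. C i * star i q) = (\<Sum>x'\<in>V1. of_bool (x = x') * (\<Sum>e\<in>E2. (c x' e + \<gamma> x' e) * inc u e))"
      unfolding sumC by (simp add: q sum_distrib_left ac_simps)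
    also have "\<dots> = (\<Sum>e\<in>E2. (c x e + \<gamma> x e) * inc u e)"
      using q F.finite_V by (simp add: sum_of_bool_mult)
    also have "\<dots> = v q"
      using c[OF q(2,3)] \<gamma>_cycle[OF q(2,3)] by (simp add: distrib_right sum.distrib q)
    finally show ?thesis ..
  next
    fix fe assume "q = Inr fe" "fe \<in> E1 \<times> E2"
    then obtain f e where q: "q = Inr (f, e)" "f \<in> E1" "e \<in> E2" by blast
    have f: "f \<in> V1 \<times> V1" using q F.E_subset by blast
    have "(\<Sum>i\<in>stars. C i * star i q) = (\<Sum>x\<in>V1. (c x e + \<gamma> x e) * inc x f)"
      unfolding sumC using q G.finite_E by (simp add: sum_of_bool_mult flip: mult.assoc)
    also have "\<dots> = (c (fst f) e + c (snd f) e) + (\<gamma> (fst f) e + \<gamma> (snd f) e)"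
      unfolding sum_inc[OF F.finite_V f] by (simp add: ac_simps)
    also have "\<dots> = v q" unfolding \<gamma>[OF q(3,2)] by (simp add: q ac_simps)
    finally show ?thesis ..
  qed
  then show ?thesis by blast
qed

text \<open>On \<open>{x} \<times> V2\<close> the star is the incidence vector of \<open>e\<close>,
  nonzero since \<open>e\<close> is no loop; this reveals \<open>x\<close> and then
  \<open>e\<close>. Distinct walls will thus yield distinct generators.\<close>

lemma star_inject:
  assumes "x \<in> V1" "e \<in> E2" "x' \<in> V1" "e' \<in> E2" "\<forall>q\<in>Q. star (x, e) q = star (x', e') q"
  shows "x = x' \<and> e = e'"
proof -
  have e: "fst e \<in> V2" "fst e \<noteq> snd e" using assms(2) G.E_subset G.asymmetric[of "fst e" "snd e"] by auto
  have *: "star (x, e) (Inl (x, u)) = star (x', e') (Inl (x, u))" if "u \<in> V2" for u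
    using assms(1,5) that by blast
  have "inc (fst e) e = 1" using e by (simp add: inc_def)
  then have x: "x = x'" using *[OF e(1)] by (cases "x = x'") auto
  then show ?thesis using G.inc_eqD[OF assms(2,4)] * by simp
qed

lemma plaquette_inject:
  assumes "f \<in> E1" "u \<in> V2" "f' \<in> E1" "u' \<in> V2" "\<forall>q\<in>Q. check (Inl (f, u)) q = check (Inl (f', u')) q"
  shows "f = f' \<and> u = u'"
proof -
  have f: "fst f \<in> V1" "fst f \<noteq> snd f" using assms(1) F.E_subset F.asymmetric[of "fst f" "snd f"] by auto
  have *: "check (Inl (f, u)) (Inl (x, u)) = check (Inl (f', u')) (Inl (x, u))" if "x \<in> V1" for x
    using assms(2,5) that by blast
  have "inc (fst f) f = 1" using f by (simp add: inc_def)
  then have u: "u = u'" using *[OF f(1)] by (cases "u = u'") auto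
  then show ?thesis using F.inc_eqD[OF assms(1,3)] * by simp
qed

section \<open>Transfer from labelled to numbered qubits\<close>

definition ix :: "('x, 'v) qubit \<Rightarrow> nat" where
  "ix = the_inv_into {..<n} en"

definition lift :: "(('x, 'v) qubit \<Rightarrow> bit) \<Rightarrow> nat \<Rightarrow> bit" where
  "lift w k = (if k < n then w (en k) else 0)"

lemma ix_en: "k < n \<Longrightarrow> ix (en k) = k"
  using en unfolding ix_def bij_betw_def by (simp add: the_inv_into_f_f)

lemma ix_less: "q \<in> Q \<Longrightarrow> ix q < n" and en_ix: "q \<in> Q \<Longrightarrow> en (ix q) = q"
  using en the_inv_into_into[of en "{..<n}" q "{..<n}"] f_the_inv_into_f[of en "{..<n}" q]
  unfolding ix_def bij_betw_def by auto

lemma en_in_Q: "k < n \<Longrightarrow> en k \<in> Q"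
  using en by (auto simp: bij_betw_def)

lemma lift_ix: "q \<in> Q \<Longrightarrow> lift w (ix q) = w q"
  by (simp add: lift_def ix_less en_ix)

lemma pair_cong: "(\<And>q. q \<in> Q \<Longrightarrow> v q = v' q) \<Longrightarrow> pair v w = pair v' w"
  unfolding pair_def by (intro sum.cong) auto

lemma dot_lift: "dot n v (lift w) = pair (\<lambda>q. v (ix q)) w"
proof -
  have "dot n v (lift w) = (\<Sum>k<n. (\<lambda>q. v (ix q) * w q) (en k))"
    unfolding dot_def by (intro sum.cong) (auto simp: lift_def ix_en)
  then show ?thesis
    using sum.reindex_bij_betw[OF en, of "\<lambda>q. v (ix q) * w q"] by (simp add: pair_def)
qed

lemma dot_lift_lift: "dot n (lift v) (lift w) = pair v w"
  unfolding dot_lift by (intro pair_cong lift_ix)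

sublocale css: css_code n stars "\<lambda>i. lift (star i)" checks "\<lambda>j. lift (check j)" "lift xlogq" "lift zlogq"
proof
  show "finite stars" "finite checks"
    using F.finite_V G.finite_E F.finite_E G.finite_V finite_faces by auto
next
  fix v assume v: "\<forall>j\<in>checks. dot n v (lift (check j)) = 0" "dot n v (lift zlogq) = 0"
  then obtain c where c: "\<forall>q\<in>Q. v (ix q) = (\<Sum>i\<in>stars. c i * star i q)"
    using exact_star[of "\<lambda>q. v (ix q)"] unfolding dot_lift by blast
  have "v k = (\<Sum>i\<in>stars. c i * lift (star i) k)" if "k < n" for k
    using bspec[OF c en_in_Q[OF that]] that by (simp add: ix_en lift_def)
  then show "\<exists>c. \<forall>k<n. v k = (\<Sum>i\<in>stars. c i * lift (star i) k)" by blast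
next
  fix v assume v: "\<forall>i\<in>stars. dot n v (lift (star i)) = 0" "dot n v (lift xlogq) = 0"
  then obtain c where c: "\<forall>q\<in>Q. v (ix q) = (\<Sum>j\<in>checks. c j * check j q)"
    using exact_check[of "\<lambda>q. v (ix q)"] unfolding dot_lift by blast
  have "v k = (\<Sum>j\<in>checks. c j * lift (check j) k)" if "k < n" for k
    using bspec[OF c en_in_Q[OF that]] that by (simp add: ix_en lift_def)
  then show "\<exists>c. \<forall>k<n. v k = (\<Sum>j\<in>checks. c j * lift (check j) k)" by blast
qed (simp_all add: dot_lift_lift pair_star_check pair_star_zlogq pair_xlogq_check pair_xlogq_zlogq lift_def)

lemma flip_path_step:
  assumes "flip_path n T v" "t < T"
  shows "\<exists>p. \<forall>q\<in>Q. q \<noteq> p \<longrightarrow> v (Suc t) (ix q) = v t (ix q)"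
proof -
  obtain k where "\<forall>q<n. q \<noteq> k \<longrightarrow> v (Suc t) q = v t q" using assms unfolding flip_path_def by blast
  moreover have "ix q \<noteq> k" if "q \<in> Q" "q \<noteq> en k" for q using that en_ix by metis
  ultimately show ?thesis by (intro exI[of _ "en k"]) (simp add: ix_less)
qed

lemma lift_inject: "lift v = lift w \<Longrightarrow> q \<in> Q \<Longrightarrow> v q = w q"
  using lift_ix by metis

text \<open>One violated star is chosen for every wall. Stars over different edges are different
  operators, so there are at least as many violations as walls.\<close>

lemma X_barrier:
  assumes ising: "ising_barrier V2 E2 b" and path: "flip_path n T v"
    and comm: "\<forall>i\<in>stars. dot n (v T) (lift (star i)) = 0" and log: "dot n (v T) (lift xlogq) = 1"
  shows "\<exists>t\<le>T. b \<le> card ((\<lambda>i. lift (star i)) ` {i \<in> stars. dot n (v t) (lift (star i)) = 1})"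
proof -
  let ?w = "\<lambda>t q. v t (ix q)"
  define s where "s t u = (\<Sum>x\<in>V1. ?w t (Inl (x, u)))" for t u
  have wall: "s t (fst e) + s t (snd e) = (\<Sum>x\<in>V1. pair (?w t) (star (x, e)))" if e: "e \<in> E2" for t e
  proof -
    have "(\<Sum>x\<in>V1. \<Sum>f\<in>E1. ?w t (Inr (f, e)) * inc x f) = (\<Sum>f\<in>E1. \<Sum>x\<in>V1. ?w t (Inr (f, e)) * inc x f)"
      by (rule sum.swap)
    also have "\<dots> = 0" by (simp add: sum_inc_edge flip: sum_distrib_left)
    finally show ?thesis using e by (simp add: pair_star s_def sum.distrib)
  qed
  have "\<exists>t\<le>T. b \<le> card (walls E2 (s t))"
  proof (rule ising_barrierD[OF ising])
    fix u assume u: "u \<in> V2"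
    have "?w 0 (Inl (x, u)) = 0" if "x \<in> V1" for x
      using path ix_less[of "Inl (x, u)"] that u by (auto simp: flip_path_def)
    then show "s 0 u = 0" by (simp add: s_def)
    \<comment> \<open>With no star violated at time \<open>T\<close> there is no wall, so all spins
      equal the one at the root, which is the pairing with \<open>xlogq\<close>.\<close>
    have "s T (fst e) = s T (snd e)" if e: "e \<in> E2" for e
      using wall[OF e, of T] comm e by (simp add: dot_lift bit_add_eq_0_iff)
    then have "s T u = s T r2" using u by (rule G.constant_on_V)
    then show "s T u = 1" using log by (simp add: dot_lift pair_xlogq s_def)
  next
    fix t assume "t < T"
    then obtain p where p: "\<forall>q\<in>Q. q \<noteq> p \<longrightarrow> ?w (Suc t) q = ?w t q" using flip_path_step[OF path] by blast
    \<comment> \<open>Flipping an edge-edge qubit changes no spin; in that case \<open>y\<close> is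
      arbitrary.\<close>
    obtain y where y: "\<And>x u. p = Inl (x, u) \<Longrightarrow> u = y"
      by (cases p) auto
    have "s (Suc t) u = s t u" if u: "u \<in> V2" "u \<noteq> y" for u
      unfolding s_def
    proof (intro sum.cong refl)
      fix x assume "x \<in> V1"
      then have "Inl (x, u) \<in> Q" "Inl (x, u) \<noteq> p" using u y by blast+
      then show "?w (Suc t) (Inl (x, u)) = ?w t (Inl (x, u))" using p by blast
    qed
    then show "\<exists>p. \<forall>u\<in>V2. u \<noteq> p \<longrightarrow> s (Suc t) u = s t u" by blast
  qed
  then obtain t where t: "t \<le> T" "b \<le> card (walls E2 (s t))" by blast
  have "\<exists>x\<in>V1. pair (?w t) (star (x, e)) = 1" if "e \<in> walls E2 (s t)" for e
  proof (rule ccontr)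
    assume "\<not> ?thesis"
    then have "(\<Sum>x\<in>V1. pair (?w t) (star (x, e))) = 0" by (intro sum.neutral) auto
    then show False using that wall[of e t] by (simp add: walls_def bit_add_eq_0_iff)
  qed
  then obtain x where x: "\<And>e. e \<in> walls E2 (s t) \<Longrightarrow> x e \<in> V1 \<and> pair (?w t) (star (x e, e)) = 1" by metis
  let ?A = "(\<lambda>i. lift (star i)) ` {i \<in> stars. dot n (v t) (lift (star i)) = 1}"
  have "card (walls E2 (s t)) \<le> card ?A"
  proof (rule card_inj_on_le[where f = "\<lambda>e. lift (star (x e, e))"])
    show "finite ?A" using css.finite_I by simp
    show "(\<lambda>e. lift (star (x e, e))) ` walls E2 (s t) \<subseteq> ?A"
    proof
      fix h assume "h \<in> (\<lambda>e. lift (star (x e, e))) ` walls E2 (s t)"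
      then obtain e where e: "e \<in> walls E2 (s t)" "h = lift (star (x e, e))" by blast
      then have "(x e, e) \<in> {i \<in> stars. dot n (v t) (lift (star i)) = 1}"
        using x[OF e(1)] by (simp add: dot_lift walls_def)
      then show "h \<in> ?A" unfolding e(2) by (rule imageI)
    qed
    show "inj_on (\<lambda>e. lift (star (x e, e))) (walls E2 (s t))"
    proof (rule inj_onI)
      fix e e' assume e: "e \<in> walls E2 (s t)" "e' \<in> walls E2 (s t)" "lift (star (x e, e)) = lift (star (x e', e'))"
      then have "\<forall>q\<in>Q. star (x e, e) q = star (x e', e') q" using lift_inject by blast
      then show "e = e'" using star_inject[of "x e" e "x e'" e'] x e by (simp add: walls_def)
    qed
  qed
  then show ?thesis using t by (meson order_trans)
qed

text \<open>The argument for \<open>X_barrier\<close> with the factors exchanged, plaquettes taking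
  the place of stars.\<close>

lemma Z_barrier:
  assumes ising: "ising_barrier V1 E1 b" and path: "flip_path n T v"
    and comm: "\<forall>j\<in>checks. dot n (v T) (lift (check j)) = 0" and log: "dot n (v T) (lift zlogq) = 1"
  shows "\<exists>t\<le>T. b \<le> card ((\<lambda>j. lift (check j)) ` {j \<in> checks. dot n (v t) (lift (check j)) = 1})"
proof -
  let ?w = "\<lambda>t q. v t (ix q)"
  define s where "s t x = (\<Sum>u\<in>V2. ?w t (Inl (x, u)))" for t x
  have wall: "s t (fst f) + s t (snd f) = (\<Sum>u\<in>V2. pair (?w t) (check (Inl (f, u))))" if f: "f \<in> E1" for t f
  proof -
    have "(\<Sum>u\<in>V2. \<Sum>e\<in>E2. ?w t (Inr (f, e)) * inc u e) = (\<Sum>e\<in>E2. \<Sum>u\<in>V2. ?w t (Inr (f, e)) * inc u e)"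
      by (rule sum.swap)
    also have "\<dots> = 0" by (simp add: sum_inc_edge flip: sum_distrib_left)
    finally show ?thesis using f by (simp add: pair_plaquette s_def sum.distrib)
  qed
  have "\<exists>t\<le>T. b \<le> card (walls E1 (s t))"
  proof (rule ising_barrierD[OF ising])
    fix x assume x: "x \<in> V1"
    have "?w 0 (Inl (x, u)) = 0" if "u \<in> V2" for u
      using path ix_less[of "Inl (x, u)"] that x by (auto simp: flip_path_def)
    then show "s 0 x = 0" by (simp add: s_def)
    have "s T (fst f) = s T (snd f)" if f: "f \<in> E1" for f
    proof -
      have "pair (?w T) (check (Inl (f, u))) = 0" if "u \<in> V2" for u
        using bspec[OF comm InlI[OF SigmaI[OF f that]]] by (simp add: dot_lift)
      then show ?thesis using wall[OF f, of T] by (simp add: bit_add_eq_0_iff)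
    qed
    then have "s T x = s T r1" using x by (rule F.constant_on_V)
    then show "s T x = 1" using log by (simp add: dot_lift pair_zlogq s_def)
  next
    fix t assume "t < T"
    then obtain p where p: "\<forall>q\<in>Q. q \<noteq> p \<longrightarrow> ?w (Suc t) q = ?w t q" using flip_path_step[OF path] by blast
    obtain y where y: "\<And>x u. p = Inl (x, u) \<Longrightarrow> x = y"
      by (cases p) auto
    have "s (Suc t) x = s t x" if x: "x \<in> V1" "x \<noteq> y" for x
      unfolding s_def
    proof (intro sum.cong refl)
      fix u assume "u \<in> V2"
      then have "Inl (x, u) \<in> Q" "Inl (x, u) \<noteq> p" using x y by blast+
      then show "?w (Suc t) (Inl (x, u)) = ?w t (Inl (x, u))" using p by blast
    qed
    then show "\<exists>p. \<forall>x\<in>V1. x \<noteq> p \<longrightarrow> s (Suc t) x = s t x" by blast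
  qed
  then obtain t where t: "t \<le> T" "b \<le> card (walls E1 (s t))" by blast
  have "\<exists>u\<in>V2. pair (?w t) (check (Inl (f, u))) = 1" if "f \<in> walls E1 (s t)" for f
  proof (rule ccontr)
    assume "\<not> ?thesis"
    then have "(\<Sum>u\<in>V2. pair (?w t) (check (Inl (f, u)))) = 0" by (intro sum.neutral) auto
    then show False using that wall[of f t] by (simp add: walls_def bit_add_eq_0_iff)
  qed
  then obtain u where u: "\<And>f. f \<in> walls E1 (s t) \<Longrightarrow> u f \<in> V2 \<and> pair (?w t) (check (Inl (f, u f))) = 1" by metis
  let ?A = "(\<lambda>j. lift (check j)) ` {j \<in> checks. dot n (v t) (lift (check j)) = 1}"
  have "card (walls E1 (s t)) \<le> card ?A"
  proof (rule card_inj_on_le[where f = "\<lambda>f. lift (check (Inl (f, u f)))"])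
    show "finite ?A" using css.finite_J by simp
    show "(\<lambda>f. lift (check (Inl (f, u f)))) ` walls E1 (s t) \<subseteq> ?A"
    proof
      fix h assume "h \<in> (\<lambda>f. lift (check (Inl (f, u f)))) ` walls E1 (s t)"
      then obtain f where f: "f \<in> walls E1 (s t)" "h = lift (check (Inl (f, u f)))" by blast
      then have "Inl (f, u f) \<in> {j \<in> checks. dot n (v t) (lift (check j)) = 1}"
        using u[OF f(1)] by (simp add: dot_lift walls_def InlI)
      then show "h \<in> ?A" unfolding f(2) by (rule imageI)
    qed
    show "inj_on (\<lambda>f. lift (check (Inl (f, u f)))) (walls E1 (s t))"
    proof (rule inj_onI)
      fix f f' assume f: "f \<in> walls E1 (s t)" "f' \<in> walls E1 (s t)"
        "lift (check (Inl (f, u f))) = lift (check (Inl (f', u f')))"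
      then have "\<forall>q\<in>Q. check (Inl (f, u f)) q = check (Inl (f', u f')) q" using lift_inject by blast
      then show "f = f'" using plaquette_inject[of f "u f" f' "u f'"] u f by (simp add: walls_def)
    qed
  qed
  then show ?thesis using t by (meson order_trans)
qed

text \<open>The spins \<open>s t\<close> are written on the copy of \<open>V1\<close> over
  \<open>r2\<close>. Faces act only on edge-edge qubits, and a plaquette \<open>(f, r2)\<close> sees
  just the two ends of \<open>f\<close>, so every violated check comes from a wall. Each step flips
  exactly one spin because logical paths use operators with one-element support.\<close>

theorem product_barrier:
  assumes ising: "ising_barrier V1 E1 b" "ising_barrier V2 E2 b"
    and s0: "\<And>x. x \<in> V1 \<Longrightarrow> s 0 x = 0" and sT: "\<And>x. x \<in> V1 \<Longrightarrow> s T x = 1"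
    and step: "\<And>t. t < T \<Longrightarrow> \<exists>p\<in>V1. \<forall>x\<in>V1. s (Suc t) x = s t x + of_bool (x = p)"
    and walls: "\<And>t. t \<le> T \<Longrightarrow> card (walls E1 (s t)) \<le> b'"
  shows "2 * real b \<le> energy_barrier n css.stab css.gens" "energy_barrier n css.stab css.gens \<le> 2 * real b'"
    and "\<exists>E. nontrivial_logical n css.stab E"
proof -
  define sheet where "sheet t q = (case q of Inl (x, u) \<Rightarrow> s t x * of_bool (u = r2) | Inr _ \<Rightarrow> 0)"
    for t and q :: "('x, 'v) qubit"
  have path: "\<forall>k<n. lift (sheet 0) k = 0"
    "\<forall>t<T. \<exists>p<n. \<forall>k<n. lift (sheet (Suc t)) k = lift (sheet t) k + of_bool (k = p)"
    "\<forall>k<n. lift (sheet T) k = lift xlogq k"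
    "\<forall>t\<le>T. card {j \<in> checks. dot n (lift (sheet t)) (lift (check j)) = 1} \<le> b'"
  proof -
    have "sheet 0 q = 0" "sheet T q = xlogq q" if "q \<in> Q" for q
      using that s0 sT by (auto simp: sheet_def)
    then show "\<forall>k<n. lift (sheet 0) k = 0" "\<forall>k<n. lift (sheet T) k = lift xlogq k"
      using en_in_Q by (simp_all add: lift_def)
    show "\<forall>t<T. \<exists>p<n. \<forall>k<n. lift (sheet (Suc t)) k = lift (sheet t) k + of_bool (k = p)"
    proof (intro allI impI)
      fix t assume "t < T"
      then obtain p where p: "p \<in> V1" "\<And>x. x \<in> V1 \<Longrightarrow> s (Suc t) x = s t x + of_bool (x = p)"
        using step by blast
      have pQ: "Inl (p, r2) \<in> Q" using p(1) G.root by blast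
      have "sheet (Suc t) q = sheet t q + of_bool (q = Inl (p, r2))" if "q \<in> Q" for q
        using that p(2) by (auto simp: sheet_def)
      moreover have "en k = Inl (p, r2) \<longleftrightarrow> k = ix (Inl (p, r2))" if "k < n" for k
        using that ix_en en_ix[OF pQ] by metis
      ultimately have "lift (sheet (Suc t)) k = lift (sheet t) k + of_bool (k = ix (Inl (p, r2)))" if "k < n" for k
        using that en_in_Q by (simp add: lift_def)
      then show "\<exists>p<n. \<forall>k<n. lift (sheet (Suc t)) k = lift (sheet t) k + of_bool (k = p)"
        using ix_less[OF pQ] by blast
    qed
    show "\<forall>t\<le>T. card {j \<in> checks. dot n (lift (sheet t)) (lift (check j)) = 1} \<le> b'"
    proof (intro allI impI)
      fix t assume t: "t \<le> T"
      have "{j \<in> checks. dot n (lift (sheet t)) (lift (check j)) = 1} \<subseteq> (\<lambda>f. Inl (f, r2)) ` walls E1 (s t)"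
      proof
        fix j assume j: "j \<in> {j \<in> checks. dot n (lift (sheet t)) (lift (check j)) = 1}"
        then have pj: "pair (sheet t) (check j) = 1" by (simp add: dot_lift_lift)
        from j have "j \<in> checks" by blast
        then show "j \<in> (\<lambda>f. Inl (f, r2)) ` walls E1 (s t)"
        proof (elim PlusE)
          fix fu assume "j = Inl fu" "fu \<in> E1 \<times> V2"
          then obtain f u where j: "j = Inl (f, u)" "f \<in> E1" "u \<in> V2" by blast
          have "(s t (fst f) + s t (snd f)) * of_bool (u = r2) = 1"
            using pj j by (simp add: pair_plaquette sheet_def distrib_right)
          then have "u = r2" "s t (fst f) \<noteq> s t (snd f)"
            by (cases "u = r2"; auto simp: bit_add_eq_1_iff)+
          then show ?thesis using j by (auto simp: walls_def)
        next
          fix ge assume "j = Inr ge" "ge \<in> faces \<times> E2"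
          then show ?thesis using pj by (auto simp: pair_face sheet_def)
        qed
      qed
      moreover have "finite (walls E1 (s t))" using F.finite_E by (simp add: walls_def)
      ultimately have "card {j \<in> checks. dot n (lift (sheet t)) (lift (check j)) = 1} \<le> card (walls E1 (s t))"
        by (rule surj_card_le[rotated])
      then show "card {j \<in> checks. dot n (lift (sheet t)) (lift (check j)) = 1} \<le> b'"
        using walls[OF t] by linarith
    qed
  qed
  show "2 * real b \<le> energy_barrier n css.stab css.gens"
    by (rule css.energy_barrier_bounds(1)[OF Z_barrier[OF ising(1)] X_barrier[OF ising(2)] path])
  show "energy_barrier n css.stab css.gens \<le> 2 * real b'"
    by (rule css.energy_barrier_bounds(2)[OF Z_barrier[OF ising(1)] X_barrier[OF ising(2)] path])
  show "\<exists>E. nontrivial_logical n css.stab E"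
    using css.nontrivial_logical_xop[of "lift xlogq"] by blast
qed

lemma gens_support:
  assumes "h \<in> css.gens"
  shows "(\<exists>i\<in>stars. en ` pauli_support n h \<subseteq> {q. star i q \<noteq> 0}) \<or>
         (\<exists>j\<in>checks. en ` pauli_support n h \<subseteq> {q. check j q \<noteq> 0})"
proof -
  have supp: "en ` pauli_support n h \<subseteq> {q. w q \<noteq> 0}"
    if "h = xop n (lift w) \<or> h = zop n (lift w)" for w
  proof -
    have "pauli_support n h \<subseteq> {k. k < n \<and> lift w k \<noteq> 0}"
      using that by (auto simp: pauli_support_pauli_op)
    then show ?thesis by (auto simp: lift_def)
  qed
  from assms consider i where "i \<in> stars" "h = xop n (lift (star i))"
    | j where "j \<in> checks" "h = zop n (lift (check j))"
    unfolding css.gens_def by blast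
  then show ?thesis
  proof cases
    case 1
    then show ?thesis using supp[of "star i"] by blast
  next
    case 2
    then show ?thesis using supp[of "check j"] by blast
  qed
qed

end

section \<open>Ising barriers and isoperimetry\<close>

text \<open>Spins are flipped one at a time, so at some moment exactly half of \<open>W\<close> is flipped.\<close>

lemma ising_barrierI:
  assumes V: "finite V" and W: "W \<subseteq> V"
    and half: "\<And>s :: 'a \<Rightarrow> bit. card {u \<in> W. s u = 1} = card W div 2 \<Longrightarrow> b \<le> card (walls E s)"
  shows "ising_barrier V E b"
  unfolding ising_barrier_def
proof (intro allI impI, elim conjE)
  fix T and s :: "nat \<Rightarrow> 'a \<Rightarrow> bit"
  assume s0: "\<forall>u\<in>V. s 0 u = 0" and sT: "\<forall>u\<in>V. s T u = 1"
    and step: "\<forall>t<T. \<exists>p. \<forall>u\<in>V. u \<noteq> p \<longrightarrow> s (Suc t) u = s t u"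
  let ?A = "\<lambda>t. {u \<in> W. s t u = 1}"
  have fin: "finite (?A t)" for t by (rule finite_subset[OF _ finite_subset[OF W V]]) auto
  have "\<bar>int (card (?A (t + 1))) - int (card (?A t))\<bar> \<le> 1" if "t < T" for t
  proof -
    obtain p where p: "\<forall>u\<in>V. u \<noteq> p \<longrightarrow> s (Suc t) u = s t u" using step \<open>t < T\<close> by blast
    have "?A (Suc t) \<subseteq> insert p (?A t)" "?A t \<subseteq> insert p (?A (Suc t))" using p W by force+
    then have "card (?A (Suc t)) \<le> card (insert p (?A t))" "card (?A t) \<le> card (insert p (?A (Suc t)))"
      using fin by (meson card_mono finite_insert)+
    moreover have "card (insert p (?A t)) \<le> Suc (card (?A t))" "card (insert p (?A (Suc t))) \<le> Suc (card (?A (Suc t)))"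
      using fin by (simp_all add: card_insert_if)
    ultimately show ?thesis by simp
  qed
  moreover have "card (?A 0) = 0"
  proof -
    have "?A 0 = {}" using s0 W by auto
    then show ?thesis by (simp only: card.empty)
  qed
  moreover have "card (?A T) = card W"
  proof -
    have "?A T = W" using sT W by auto
    then show ?thesis by (simp only:)
  qed
  ultimately obtain t where "t \<le> T" "int (card (?A t)) = int (card W div 2)"
    using nat0_intermed_int_val[of T "\<lambda>t. int (card (?A t))" "int (card W div 2)"] by auto
  then show "\<exists>t\<le>T. b \<le> card (walls E (s t))" using half by auto
qed

text \<open>Four times the product is at least \<open>M * M - 1\<close>; the factor 8 in place of 4
  absorbs the rounding and is the origin of the division by 8 in the Ising barriers.\<close>

lemma mult_halves_ge:
  fixes M :: nat
  assumes "2 \<le> M"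
  shows "M * M \<le> 8 * ((M div 2) * (M - M div 2))"
proof (cases "even M")
  case True
  then obtain m where "M = 2 * m" by blast
  then show ?thesis by simp
next
  case False
  then obtain m where m: "M = 2 * m + 1" by (rule oddE)
  then have "1 \<le> m" using assms by simp
  then show ?thesis unfolding m by (simp add: algebra_simps)
qed

lemma exists_adjacent_change:
  fixes s :: "nat \<Rightarrow> 'b"
  assumes "s x \<noteq> s y" "x < N" "y < N"
  shows "\<exists>i. Suc i < N \<and> s i \<noteq> s (Suc i)"
proof (rule ccontr)
  assume "\<not> ?thesis"
  then have step: "\<And>i. Suc i < N \<Longrightarrow> s (Suc i) = s i" by metis
  have "i < N \<Longrightarrow> s i = s 0" for i by (induction i) (use step in auto)
  then show False using assms by metis
qed

section \<open>The square grid\<close>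

abbreviation hedge :: "nat \<Rightarrow> nat \<Rightarrow> (nat \<times> nat) \<times> (nat \<times> nat)" where
  "hedge i j \<equiv> ((i, j), (Suc i, j))"

abbreviation vedge :: "nat \<Rightarrow> nat \<Rightarrow> (nat \<times> nat) \<times> (nat \<times> nat)" where
  "vedge i j \<equiv> ((i, j), (i, Suc j))"

definition sqV :: "nat \<Rightarrow> (nat \<times> nat) set" where
  "sqV d = {..<d} \<times> {..<d}"

definition sqE :: "nat \<Rightarrow> ((nat \<times> nat) \<times> (nat \<times> nat)) set" where
  "sqE d = (\<lambda>(i, j). hedge i j) ` ({..<d - 1} \<times> {..<d}) \<union> (\<lambda>(i, j). vedge i j) ` ({..<d} \<times> {..<d - 1})"

definition sq_face :: "nat \<times> nat \<Rightarrow> ((nat \<times> nat) \<times> (nat \<times> nat)) set" where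
  "sq_face = (\<lambda>(i, j). {hedge i j, hedge i (Suc j), vedge i j, vedge (Suc i) j})"

definition sq_faces :: "nat \<Rightarrow> ((nat \<times> nat) \<times> (nat \<times> nat)) set set" where
  "sq_faces d = sq_face ` ({..<d - 1} \<times> {..<d - 1})"

lemma hedge_in_sqE [simp]: "hedge i j \<in> sqE d \<longleftrightarrow> Suc i < d \<and> j < d"
  by (auto simp: sqE_def)

lemma vedge_in_sqE [simp]: "vedge i j \<in> sqE d \<longleftrightarrow> i < d \<and> Suc j < d"
  by (auto simp: sqE_def)

lemma sqE_cases:
  assumes "e \<in> sqE d"
  obtains i j where "e = hedge i j" "Suc i < d" "j < d" | i j where "e = vedge i j" "i < d" "Suc j < d"
  using assms by (auto simp: sqE_def)

lemma sq_rooted_graph: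
  assumes "0 < d"
  shows "rooted_graph (sqV d) (sqE d) (0, 0)"
proof
  show "finite (sqV d)" "(0, 0) \<in> sqV d" using assms by (auto simp: sqV_def)
  show "sqE d \<subseteq> sqV d \<times> sqV d" by (auto simp: sqV_def elim!: sqE_cases)
  show "(v, u) \<notin> sqE d" if "(u, v) \<in> sqE d" for u v using that by (auto simp: sqE_def)
  fix u assume "u \<in> sqV d"
  then obtain i j where u: "u = (i, j)" "i < d" "j < d" by (auto simp: sqV_def)
  let ?R = "(sqE d \<union> (sqE d)\<inverse>)\<^sup>*"
  have "i < d \<Longrightarrow> ((0, 0), (i, 0)) \<in> ?R"
  proof (induction i)
    case (Suc i)
    then have "((i, 0), (Suc i, 0)) \<in> sqE d" using assms by simp
    then show ?case using Suc by (meson Suc_lessD UnI1 rtrancl.rtrancl_into_rtrancl)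
  qed simp
  moreover have "j < d \<Longrightarrow> ((i, 0), (i, j)) \<in> ?R"
  proof (induction j)
    case (Suc j)
    then have "((i, j), (i, Suc j)) \<in> sqE d" using u by simp
    then show ?case using Suc by (meson Suc_lessD UnI1 rtrancl.rtrancl_into_rtrancl)
  qed simp
  ultimately show "((0, 0), u) \<in> ?R" using u by (meson rtrancl_trans)
qed

lemma inj_sq_face: "inj_on sq_face P"
proof (rule inj_onI)
  fix p q :: "nat \<times> nat" assume eq: "sq_face p = sq_face q"
  obtain i j i' j' where p: "p = (i, j)" "q = (i', j')" by (metis surj_pair)
  have "hedge i j \<in> sq_face p" "hedge i (Suc j) \<in> sq_face p" by (simp_all add: p sq_face_def)
  then have "hedge i j \<in> sq_face q" "hedge i (Suc j) \<in> sq_face q" unfolding eq .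
  then show "p = q" unfolding p by (auto simp: sq_face_def)
qed

lemma sum_sq_face:
  "(\<Sum>f\<in>sq_face (i, j). h f) = h (hedge i j) + (h (hedge i (Suc j)) + (h (vedge i j) + h (vedge (Suc i) j)))"
  by (simp add: sq_face_def)

lemma sum_delta_bit:
  fixes h :: "'a \<Rightarrow> bit"
  assumes "finite A"
  shows "(\<Sum>x\<in>A. h x * of_bool (x = a)) = (if a \<in> A then h a else 0)"
  using assms by (cases "a \<in> A") (auto simp: sum_of_bool_mult intro: sum.neutral)

text \<open>Extending the edge values by 0 outside the grid gives every vertex the same four-term
  formula, apart from the missing predecessor at coordinate 0.\<close>

lemma sq_boundary:
  fixes b :: "(nat \<times> nat) \<times> (nat \<times> nat) \<Rightarrow> bit" and d :: nat
  defines "h \<equiv> \<lambda>i j. if Suc i < d \<and> j < d then b (hedge i j) else 0"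
    and "v \<equiv> \<lambda>i j. if i < d \<and> Suc j < d then b (vedge i j) else 0"
  shows "(\<Sum>f\<in>sqE d. b f * inc (i, j) f) =
    (h i j + (case i of 0 \<Rightarrow> 0 | Suc i' \<Rightarrow> h i' j)) + (v i j + (case j of 0 \<Rightarrow> 0 | Suc j' \<Rightarrow> v i j'))"
proof -
  let ?H = "{..<d - 1} \<times> {..<d}" and ?W = "{..<d} \<times> {..<d - 1}"
  have "(\<Sum>f\<in>sqE d. b f * inc (i, j) f) =
      (\<Sum>f\<in>(\<lambda>(i, j). hedge i j) ` ?H. b f * inc (i, j) f) + (\<Sum>f\<in>(\<lambda>(i, j). vedge i j) ` ?W. b f * inc (i, j) f)"
    unfolding sqE_def by (rule sum.union_disjoint) auto
  also have "(\<Sum>f\<in>(\<lambda>(i, j). hedge i j) ` ?H. b f * inc (i, j) f)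
      = (\<Sum>p\<in>?H. b (hedge (fst p) (snd p)) * inc (i, j) (hedge (fst p) (snd p)))"
    by (subst sum.reindex) (auto simp: inj_on_def split_def intro!: sum.cong)
  also have "\<dots> = h i j + (case i of 0 \<Rightarrow> 0 | Suc i' \<Rightarrow> h i' j)"
  proof -
    have "inc (i, j) (hedge (fst p) (snd p)) =
        of_bool (p = (i, j)) + (case i of 0 \<Rightarrow> 0 | Suc i' \<Rightarrow> of_bool (p = (i', j)))" for p
      by (cases p) (auto simp: inc_def split: nat.split)
    then show ?thesis
      by (cases i) (auto simp del: sum_mult_of_bool_eq simp: distrib_left sum.distrib sum_delta_bit h_def)
  qed
  also have "(\<Sum>f\<in>(\<lambda>(i, j). vedge i j) ` ?W. b f * inc (i, j) f)
      = (\<Sum>p\<in>?W. b (vedge (fst p) (snd p)) * inc (i, j) (vedge (fst p) (snd p)))"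
    by (subst sum.reindex) (auto simp: inj_on_def split_def intro!: sum.cong)
  also have "\<dots> = v i j + (case j of 0 \<Rightarrow> 0 | Suc j' \<Rightarrow> v i j')"
  proof -
    have "inc (i, j) (vedge (fst p) (snd p)) =
        of_bool (p = (i, j)) + (case j of 0 \<Rightarrow> 0 | Suc j' \<Rightarrow> of_bool (p = (i, j')))" for p
      by (cases p) (auto simp: inc_def split: nat.split)
    then show ?thesis
      by (cases j) (auto simp del: sum_mult_of_bool_eq simp: distrib_left sum.distrib sum_delta_bit v_def)
  qed
  finally show ?thesis .
qed

text \<open>The coefficient \<open>\<Phi> i m\<close> of the face \<open>(i, m)\<close> is the
  parity of the crossings of \<open>b\<close> with the ray from that face towards decreasing second
  coordinate. Horizontal edges come out right by telescoping; for vertical ones the cycle condition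
  is summed along the ray.\<close>

lemma sq_cycle_exact:
  fixes b :: "(nat \<times> nat) \<times> (nat \<times> nat) \<Rightarrow> bit"
  assumes cyc: "\<And>x. x \<in> sqV d \<Longrightarrow> (\<Sum>f\<in>sqE d. b f * inc x f) = 0"
  shows "\<exists>\<phi>. \<forall>f\<in>sqE d. b f = (\<Sum>g\<in>sq_faces d. \<phi> g * of_bool (f \<in> g))"
proof -
  define h where "h i j = (if Suc i < d \<and> j < d then b (hedge i j) else 0)" for i j
  define v where "v i j = (if i < d \<and> Suc j < d then b (vedge i j) else 0)" for i j
  define \<Phi> where "\<Phi> i m = (\<Sum>j\<le>m. h i j)" for i m
  define \<Phi>' where "\<Phi>' i m = (case i of 0 \<Rightarrow> 0 | Suc i' \<Rightarrow> \<Phi> i' m)" for i m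
  have bd: "(h i j + (case i of 0 \<Rightarrow> 0 | Suc i' \<Rightarrow> h i' j)) + (v i j + (case j of 0 \<Rightarrow> 0 | Suc j' \<Rightarrow> v i j')) = 0"
    if "i < d" "j < d" for i j
    using cyc[of "(i, j)"] that unfolding sq_boundary h_def v_def by (simp add: sqV_def)
  have vert: "v i m = \<Phi> i m + \<Phi>' i m" if i: "i < d" and m: "m < d" for i m
    using m
  proof (induction m)
    case 0
    then show ?case using bd[OF i, of 0] by (cases i) (simp_all add: \<Phi>_def \<Phi>'_def bit_add_eq_0_iff)
  next
    case (Suc m)
    have "h i (Suc m) + (case i of 0 \<Rightarrow> 0 | Suc i' \<Rightarrow> h i' (Suc m)) = v i (Suc m) + v i m"
      using bd[OF i Suc.prems] by (simp add: bit_add_eq_0_iff)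
    then have "v i (Suc m) = (h i (Suc m) + (case i of 0 \<Rightarrow> 0 | Suc i' \<Rightarrow> h i' (Suc m))) + v i m"
      by (simp add: add.assoc)
    then show ?case using Suc by (cases i) (simp_all add: \<Phi>_def \<Phi>'_def ac_simps)
  qed
  have top: "\<Phi> i (d - 1) = 0" if "i < d" for i
    using that
  proof (induction i)
    case 0
    then show ?case using vert[of 0 "d - 1"] by (simp add: \<Phi>'_def v_def)
  next
    case (Suc i)
    then show ?case using vert[of "Suc i" "d - 1"] by (simp add: \<Phi>'_def v_def)
  qed
  let ?P = "{..<d - 1} \<times> {..<d - 1}"
  define \<phi> where "\<phi> g = (case inv_into ?P sq_face g of (i, j) \<Rightarrow> \<Phi> i j)" for g
  have sumP: "(\<Sum>g\<in>sq_faces d. \<phi> g * of_bool (f \<in> g)) = (\<Sum>p\<in>?P. \<Phi> (fst p) (snd p) * of_bool (f \<in> sq_face p))" for f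
    unfolding sq_faces_def
    by (subst sum.reindex[OF inj_sq_face]) (auto simp: \<phi>_def inv_into_f_f[OF inj_sq_face] split_def intro!: sum.cong)
  have "b f = (\<Sum>g\<in>sq_faces d. \<phi> g * of_bool (f \<in> g))" if "f \<in> sqE d" for f
    using that
  proof (cases rule: sqE_cases)
    case (1 i j)
    have "of_bool (f \<in> sq_face p) = (of_bool (p = (i, j)) + (case j of 0 \<Rightarrow> 0 | Suc j' \<Rightarrow> of_bool (p = (i, j'))) :: bit)" for p
      unfolding 1 by (cases p) (auto simp: sq_face_def split: nat.split)
    then have "(\<Sum>g\<in>sq_faces d. \<phi> g * of_bool (f \<in> g)) =
        (if Suc j < d then \<Phi> i j else 0) + (case j of 0 \<Rightarrow> 0 | Suc j' \<Rightarrow> \<Phi> i j')"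
      unfolding sumP using 1 by (cases j) (auto simp del: sum_mult_of_bool_eq simp: distrib_left sum.distrib sum_delta_bit)
    also have "(if Suc j < d then \<Phi> i j else 0) = \<Phi> i j"
    proof (cases "Suc j < d")
      case False
      then have "j = d - 1" using 1 by simp
      then show ?thesis using top[of i] 1 by simp
    qed simp
    also have "\<Phi> i j + (case j of 0 \<Rightarrow> 0 | Suc j' \<Rightarrow> \<Phi> i j') = h i j"
      by (cases j) (simp_all add: \<Phi>_def ac_simps)
    finally show ?thesis using 1 by (simp add: h_def)
  next
    case (2 i j)
    have "of_bool (f \<in> sq_face p) = (of_bool (p = (i, j)) + (case i of 0 \<Rightarrow> 0 | Suc i' \<Rightarrow> of_bool (p = (i', j))) :: bit)" for p
      unfolding 2 by (cases p) (auto simp: sq_face_def split: nat.split)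
    then have "(\<Sum>g\<in>sq_faces d. \<phi> g * of_bool (f \<in> g)) =
        (if Suc i < d then \<Phi> i j else 0) + \<Phi>' i j"
      unfolding sumP using 2 by (cases i) (auto simp del: sum_mult_of_bool_eq simp: distrib_left sum.distrib sum_delta_bit \<Phi>'_def)
    also have "(if Suc i < d then \<Phi> i j else 0) = \<Phi> i j"
      by (auto simp: \<Phi>_def h_def)
    also have "\<Phi> i j + \<Phi>' i j = b f" using vert[of i j] 2 by (simp add: v_def)
    finally show ?thesis ..
  qed
  then show ?thesis by blast
qed

text \<open>\<open>\<beta>\<close> sums \<open>b\<close> along the path that first follows the line
  \<open>j = 0\<close> and then runs straight to \<open>(i, j)\<close>. The second leg settles the
  vertical edges, and the face conditions carry the horizontal case from each \<open>j\<close> to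
  the next.\<close>

lemma sq_cocycle_exact:
  fixes b :: "(nat \<times> nat) \<times> (nat \<times> nat) \<Rightarrow> bit"
  assumes coc: "\<And>g. g \<in> sq_faces d \<Longrightarrow> (\<Sum>f\<in>g. b f) = 0"
  shows "\<exists>\<beta>. \<forall>f\<in>sqE d. b f = \<beta> (fst f) + \<beta> (snd f)"
proof -
  define \<beta> where "\<beta> = (\<lambda>(i, j). (\<Sum>i'<i. b (hedge i' 0)) + (\<Sum>j'<j. b (vedge i j')))"
  have face: "b (hedge i (Suc j)) = b (hedge i j) + (b (vedge i j) + b (vedge (Suc i) j))"
    if "Suc i < d" "Suc j < d" for i j
  proof -
    have "sq_face (i, j) \<in> sq_faces d" using that by (auto simp: sq_faces_def)
    from coc[OF this] have "b (hedge i (Suc j)) + (b (hedge i j) + (b (vedge i j) + b (vedge (Suc i) j))) = 0"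
      by (simp add: sum_sq_face ac_simps)
    then show ?thesis by (simp only: bit_add_eq_0_iff)
  qed
  have horiz: "b (hedge i j) = \<beta> (i, j) + \<beta> (Suc i, j)" if i: "Suc i < d" and j: "j < d" for i j
    using j
  proof (induction j)
    case 0
    then show ?case by (simp add: \<beta>_def add.assoc[symmetric])
  next
    case (Suc j)
    then show ?case using face[OF i Suc.prems] by (simp add: \<beta>_def ac_simps)
  qed
  have "b (vedge i j) = \<beta> (i, j) + \<beta> (i, Suc j)" for i j
    by (simp add: \<beta>_def ac_simps)
  then have "\<forall>f\<in>sqE d. b f = \<beta> (fst f) + \<beta> (snd f)" using horiz by (auto elim!: sqE_cases)
  then show ?thesis by blast
qed

lemma sq_faces_cycle:
  assumes "g \<in> sq_faces d"
  shows "(\<Sum>f\<in>g. inc x f) = 0"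
proof -
  obtain i j where "g = sq_face (i, j)" using assms by (auto simp: sq_faces_def)
  then show ?thesis by (simp add: sum_sq_face inc_def ac_simps)
qed

lemma sq_faces_subset: "g \<in> sq_faces d \<Longrightarrow> g \<subseteq> sqE d"
  by (auto simp: sq_faces_def sq_face_def)

text \<open>Canonical paths: if \<open>s\<close> differs at \<open>(x, y)\<close> and \<open>(x', y')\<close> then it is not constant on row \<open>y\<close> or on column \<open>x'\<close>,
  and each such line serves at most \<open>d\<^sup>3\<close> pairs.\<close>

lemma sq_isoperimetry:
  fixes s :: "nat \<times> nat \<Rightarrow> bit"
  shows "card {p \<in> sqV d. s p = 1} * card {p \<in> sqV d. s p \<noteq> 1} \<le> card (walls (sqE d) s) * d ^ 3"
proof -
  let ?I = "{..<d}"
  define R1 where "R1 = {y \<in> ?I. \<exists>x\<in>?I. \<exists>x'\<in>?I. s (x, y) \<noteq> s (x', y)}"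
  define R2 where "R2 = {x \<in> ?I. \<exists>y\<in>?I. \<exists>y'\<in>?I. s (x, y) \<noteq> s (x, y')}"
  have finR: "finite R1" "finite R2" by (simp_all add: R1_def R2_def)
  let ?A = "{p \<in> sqV d. s p = 1}" and ?B = "{p \<in> sqV d. s p \<noteq> 1}"
  let ?f1 = "\<lambda>(y, x, x', y'). ((x, y), (x', y'))" and ?f2 = "\<lambda>(x', x, y, y'). ((x, y), (x', y'))"
  have "?A \<times> ?B \<subseteq> ?f1 ` (R1 \<times> ?I \<times> ?I \<times> ?I) \<union> ?f2 ` (R2 \<times> ?I \<times> ?I \<times> ?I)"
  proof
    fix pq assume pq: "pq \<in> ?A \<times> ?B"
    obtain x y x' y' where e: "pq = ((x, y), (x', y'))" by (metis surj_pair)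
    have m: "x < d" "y < d" "x' < d" "y' < d" "s (x, y) \<noteq> s (x', y')" using pq by (auto simp: e sqV_def)
    show "pq \<in> ?f1 ` (R1 \<times> ?I \<times> ?I \<times> ?I) \<union> ?f2 ` (R2 \<times> ?I \<times> ?I \<times> ?I)"
    proof (cases "s (x, y) = s (x', y)")
      case True
      then have "s (x', y) \<noteq> s (x', y')" using m by simp
      then have "x' \<in> R2" using m by (auto simp: R2_def)
      then show ?thesis using m by (force simp: e)
    next
      case False
      then have "y \<in> R1" using m by (auto simp: R1_def)
      then show ?thesis using m by (force simp: e)
    qed
  qed
  then have "card (?A \<times> ?B) \<le> card (?f1 ` (R1 \<times> ?I \<times> ?I \<times> ?I) \<union> ?f2 ` (R2 \<times> ?I \<times> ?I \<times> ?I))"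
    using finR by (intro card_mono) auto
  also have "\<dots> \<le> card (?f1 ` (R1 \<times> ?I \<times> ?I \<times> ?I)) + card (?f2 ` (R2 \<times> ?I \<times> ?I \<times> ?I))"
    by (rule card_Un_le)
  also have "\<dots> \<le> card (R1 \<times> ?I \<times> ?I \<times> ?I) + card (R2 \<times> ?I \<times> ?I \<times> ?I)"
    using finR by (intro add_mono card_image_le) auto
  also have "\<dots> = (card R1 + card R2) * d ^ 3"
    by (simp add: card_cartesian_product power3_eq_cube distrib_right)
  finally have count: "card (?A \<times> ?B) \<le> (card R1 + card R2) * d ^ 3" .
  \<comment> \<open>Each non-constant line contains a wall pointing along it, and walls on different
    lines or in different directions are different.\<close>
  let ?W1 = "walls (sqE d) s \<inter> {(u, w). snd u = snd w}" and ?W2 = "walls (sqE d) s \<inter> {(u, w). fst u = fst w}"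
  have finW: "finite (walls (sqE d) s)" by (simp add: walls_def sqE_def)
  have "R1 \<subseteq> (\<lambda>e. snd (fst e)) ` ?W1"
  proof
    fix y assume "y \<in> R1"
    then obtain x x' where "x < d" "x' < d" "y < d" "s (x, y) \<noteq> s (x', y)" by (auto simp: R1_def)
    then obtain i where "Suc i < d" "s (i, y) \<noteq> s (Suc i, y)"
      using exists_adjacent_change[of "\<lambda>x. s (x, y)" x x' d] by blast
    then have "hedge i y \<in> ?W1" using \<open>y < d\<close> by (simp add: walls_def)
    then show "y \<in> (\<lambda>e. snd (fst e)) ` ?W1" by force
  qed
  then have 1: "card R1 \<le> card ?W1" using finW by (intro surj_card_le) auto
  have "R2 \<subseteq> (\<lambda>e. fst (fst e)) ` ?W2"
  proof
    fix x assume "x \<in> R2"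
    then obtain y y' where "y < d" "y' < d" "x < d" "s (x, y) \<noteq> s (x, y')" by (auto simp: R2_def)
    then obtain i where "Suc i < d" "s (x, i) \<noteq> s (x, Suc i)"
      using exists_adjacent_change[of "\<lambda>y. s (x, y)" y y' d] by blast
    then have "vedge x i \<in> ?W2" using \<open>x < d\<close> by (simp add: walls_def)
    then show "x \<in> (\<lambda>e. fst (fst e)) ` ?W2" by force
  qed
  then have 2: "card R2 \<le> card ?W2" using finW by (intro surj_card_le) auto
  have "?W1 \<inter> ?W2 = {}" by (auto simp: walls_def elim!: sqE_cases)
  then have "card ?W1 + card ?W2 = card (?W1 \<union> ?W2)" using finW by (intro card_Un_disjoint[symmetric]) auto
  also have "\<dots> \<le> card (walls (sqE d) s)" using finW by (intro card_mono) auto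
  finally have "card R1 + card R2 \<le> card (walls (sqE d) s)" using 1 2 by linarith
  then have "(card R1 + card R2) * d ^ 3 \<le> card (walls (sqE d) s) * d ^ 3" by simp
  then show ?thesis using count by (simp only: card_cartesian_product)
qed

text \<open>With half the spins flipped, the product of the two counts is at least
  \<open>d ^ 4 / 8\<close>, whence at least \<open>d / 8\<close> walls.\<close>

lemma sq_ising_barrier:
  assumes "2 \<le> d"
  shows "ising_barrier (sqV d) (sqE d) (d div 8)"
proof (rule ising_barrierI)
  show "finite (sqV d)" "sqV d \<subseteq> sqV d" by (simp_all add: sqV_def)
  fix s :: "nat \<times> nat \<Rightarrow> bit"
  assume half: "card {u \<in> sqV d. s u = 1} = card (sqV d) div 2"
  have cV: "card (sqV d) = d * d" by (simp add: sqV_def)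
  let ?A = "{p \<in> sqV d. s p = 1}" and ?B = "{p \<in> sqV d. s p \<noteq> 1}"
  have "card ?A + card ?B = card (?A \<union> ?B)" by (intro card_Un_disjoint[symmetric]) (auto simp: sqV_def)
  also have "?A \<union> ?B = sqV d" by auto
  finally have B: "card ?B = d * d - d * d div 2" using half cV by simp
  have "2 * 2 \<le> d * d" using assms by (intro mult_mono) auto
  then have "d * d * (d * d) \<le> 8 * ((d * d div 2) * (d * d - d * d div 2))" by (intro mult_halves_ge) auto
  also have "\<dots> \<le> 8 * (card (walls (sqE d) s) * d ^ 3)"
    using sq_isoperimetry[of d s] half B cV by simp
  finally have "d * d ^ 3 \<le> 8 * card (walls (sqE d) s) * d ^ 3" by (simp add: power3_eq_cube ac_simps)
  then have "d \<le> 8 * card (walls (sqE d) s)" using assms by simp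
  then show "d div 8 \<le> card (walls (sqE d) s)" by linarith
qed

section \<open>Filling the square grid in lexicographic order\<close>

definition lex_fill :: "nat \<Rightarrow> nat \<Rightarrow> nat \<times> nat \<Rightarrow> bit" where
  "lex_fill d t = (\<lambda>(i, j). of_bool (i * d + j < t))"

lemma lex_fill_start: "lex_fill d 0 p = 0"
  by (simp add: lex_fill_def split_def)

lemma lex_index_less: "i < d \<Longrightarrow> j < d \<Longrightarrow> i * d + j < d * (d :: nat)"
proof -
  assume "i < d" "j < d"
  then have "i * d + j < (i + 1) * d" by simp
  also have "\<dots> \<le> d * d" using \<open>i < d\<close> by (intro mult_right_mono) auto
  finally show ?thesis .
qed

lemma lex_fill_end: "p \<in> sqV d \<Longrightarrow> lex_fill d (d * d) p = 1"
  using lex_index_less by (auto simp: lex_fill_def sqV_def)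

lemma lex_fill_step:
  assumes "t < d * d"
  shows "\<exists>p\<in>sqV d. \<forall>x\<in>sqV d. lex_fill d (Suc t) x = lex_fill d t x + of_bool (x = p)"
proof
  have "0 < d" using assms by (cases d) auto
  then show "(t div d, t mod d) \<in> sqV d" using assms by (simp add: sqV_def less_mult_imp_div_less)
  show "\<forall>x\<in>sqV d. lex_fill d (Suc t) x = lex_fill d t x + of_bool (x = (t div d, t mod d))"
  proof
    fix x assume "x \<in> sqV d"
    then obtain i j where x: "x = (i, j)" "j < d" by (auto simp: sqV_def)
    have "i * d + j = t \<longleftrightarrow> (i, j) = (t div d, t mod d)"
    proof
      assume "i * d + j = t"
      then show "(i, j) = (t div d, t mod d)" using x(2) by auto
    qed auto
    then show "lex_fill d (Suc t) x = lex_fill d t x + of_bool (x = (t div d, t mod d))"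
      unfolding x lex_fill_def by (cases "i * d + j = t") (auto simp: less_Suc_eq)
  qed
qed

text \<open>The ends of a horizontal edge are \<open>d\<close> apart in the order, so a wall there
  starts at one of the last \<open>d\<close> filled sites. The ends of a vertical edge are
  consecutive, so only the edge at the front can be a wall.\<close>

lemma lex_fill_walls: "card (walls (sqE d) (lex_fill d t)) \<le> d + 1"
proof -
  let ?key = "\<lambda>e :: (nat \<times> nat) \<times> nat \<times> nat. fst (fst e) * d + snd (fst e)"
  let ?W = "walls (sqE d) (lex_fill d t)"
  let ?H = "{e \<in> ?W. snd (fst e) = snd (snd e)}" and ?V = "{e \<in> ?W. fst (fst e) = fst (snd e)}"
  have fin: "finite ?W" by (simp add: walls_def sqE_def)
  have inj: "inj_on ?key ?H"
  proof (rule inj_onI)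
    fix e e' assume e: "e \<in> ?H" "e' \<in> ?H" and eq: "?key e = ?key e'"
    from e obtain i j i' j' where "e = hedge i j" "e' = hedge i' j'" "j < d" "j' < d"
      by (auto simp: walls_def elim!: sqE_cases)
    moreover from this eq have "(i * d + j) div d = (i' * d + j') div d" "(i * d + j) mod d = (i' * d + j') mod d"
      by simp_all
    ultimately show "e = e'" by simp
  qed
  have "?key ` ?H \<subseteq> {t - d..<t}"
    by (auto simp: walls_def lex_fill_def of_bool_eq_iff elim!: sqE_cases)
  then have "card ?H \<le> card {t - d..<t}" using inj by (meson card_inj_on_le finite_atLeastLessThan)
  then have H: "card ?H \<le> d" by simp
  have "?V \<subseteq> {vedge ((t - 1) div d) ((t - 1) mod d)}"
  proof
    fix e assume "e \<in> ?V"
    then obtain i j where e: "e = vedge i j" "Suc j < d" "lex_fill d t (i, j) \<noteq> lex_fill d t (i, Suc j)"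
      by (auto simp: walls_def elim!: sqE_cases)
    then have "t - 1 = i * d + j" by (auto simp: lex_fill_def of_bool_eq_iff)
    then show "e \<in> {vedge ((t - 1) div d) ((t - 1) mod d)}" using e by simp
  qed
  then have V: "card ?V \<le> 1" using card_mono[of "{vedge ((t - 1) div d) ((t - 1) mod d)}" ?V] by simp
  have "?W \<subseteq> ?H \<union> ?V" by (auto simp: walls_def elim!: sqE_cases)
  then have "card ?W \<le> card (?H \<union> ?V)" using fin by (intro card_mono) auto
  also have "\<dots> \<le> card ?H + card ?V" by (rule card_Un_le)
  finally show ?thesis using H V by linarith
qed

lemma card_sqE: "card (sqE d) \<le> 2 * (d * d)"
proof -
  have "card (sqE d) \<le> card ((\<lambda>(i, j). hedge i j) ` ({..<d - 1} \<times> {..<d})) + card ((\<lambda>(i, j). vedge i j) ` ({..<d} \<times> {..<d - 1}))"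
    unfolding sqE_def by (rule card_Un_le)
  also have "\<dots> \<le> card ({..<d - 1} \<times> {..<d}) + card ({..<d} \<times> {..<d - 1})"
    by (intro add_mono card_image_le) auto
  also have "\<dots> = (d - 1) * d + d * (d - 1)" by simp
  also have "\<dots> \<le> d * d + d * d" by (intro add_mono mult_mono) auto
  finally show ?thesis by simp
qed

section \<open>The subdivided cubic lattice\<close>

text \<open>As coordinates run up to \<open>d * k - 1\<close>, each line extends
  \<open>d - 1\<close> steps past its last lattice vertex; these dangling ends give every line
  \<open>d * k\<close> points.\<close>

definition frV :: "nat \<Rightarrow> nat \<Rightarrow> (nat \<times> nat \<times> nat) set" where
  "frV d k = {(a, b, c). a < d * k \<and> b < d * k \<and> c < d * k \<and>
     (d dvd b \<and> d dvd c \<or> d dvd a \<and> d dvd c \<or> d dvd a \<and> d dvd b)}"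

definition frE :: "nat \<Rightarrow> nat \<Rightarrow> ((nat \<times> nat \<times> nat) \<times> (nat \<times> nat \<times> nat)) set" where
  "frE d k = {((a, b, c), w) | a b c w. (a, b, c) \<in> frV d k \<and> w \<in> frV d k \<and>
     w \<in> {(Suc a, b, c), (a, Suc b, c), (a, b, Suc c)}}"

lemma finite_frV: "finite (frV d k)"
  by (rule finite_subset[of _ "{..<d * k} \<times> {..<d * k} \<times> {..<d * k}"]) (auto simp: frV_def)

lemma frE_subset: "frE d k \<subseteq> frV d k \<times> frV d k"
  by (auto simp: frE_def)

lemma finite_frE: "finite (frE d k)"
  using finite_subset[OF frE_subset] finite_frV by blast

text \<open>From the origin, two coordinates that are multiples of \<open>d\<close> are adjusted
  first and the remaining one last, so that the walk never leaves the lines.\<close>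

lemma fr_rooted_graph:
  assumes "0 < d" "0 < k"
  shows "rooted_graph (frV d k) (frE d k) (0, 0, 0)"
proof
  show "finite (frV d k)" by (rule finite_frV)
  show "(0, 0, 0) \<in> frV d k" using assms by (simp add: frV_def)
  show "frE d k \<subseteq> frV d k \<times> frV d k" by (rule frE_subset)
  show "(v, u) \<notin> frE d k" if "(u, v) \<in> frE d k" for u v using that by (auto simp: frE_def)
  fix u assume u: "u \<in> frV d k"
  let ?R = "(frE d k \<union> (frE d k)\<inverse>)\<^sup>*"
  have pos: "0 < d * k" using assms by simp
  have ax1: "a < d * k \<Longrightarrow> ((0, b, c), (a, b, c)) \<in> ?R"
    if "b < d * k" "c < d * k" "d dvd b" "d dvd c" for a b c
  proof (induction a)
    case (Suc a)
    have "((a, b, c), (Suc a, b, c)) \<in> frE d k" using Suc.prems that by (simp add: frE_def frV_def)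
    then show ?case using Suc by (meson Suc_lessD UnI1 rtrancl.rtrancl_into_rtrancl)
  qed simp
  have ax2: "b < d * k \<Longrightarrow> ((a, 0, c), (a, b, c)) \<in> ?R"
    if "a < d * k" "c < d * k" "d dvd a" "d dvd c" for a b c
  proof (induction b)
    case (Suc b)
    have "((a, b, c), (a, Suc b, c)) \<in> frE d k" using Suc.prems that by (simp add: frE_def frV_def)
    then show ?case using Suc by (meson Suc_lessD UnI1 rtrancl.rtrancl_into_rtrancl)
  qed simp
  have ax3: "c < d * k \<Longrightarrow> ((a, b, 0), (a, b, c)) \<in> ?R"
    if "a < d * k" "b < d * k" "d dvd a" "d dvd b" for a b c
  proof (induction c)
    case (Suc c)
    have "((a, b, c), (a, b, Suc c)) \<in> frE d k" using Suc.prems that by (simp add: frE_def frV_def)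
    then show ?case using Suc by (meson Suc_lessD UnI1 rtrancl.rtrancl_into_rtrancl)
  qed simp
  obtain a b c where abc: "u = (a, b, c)" by (metis surj_pair)
  have bounds: "a < d * k" "b < d * k" "c < d * k" using u by (auto simp: frV_def abc)
  consider "d dvd b" "d dvd c" | "d dvd a" "d dvd c" | "d dvd a" "d dvd b"
    using u by (auto simp: frV_def abc)
  then show "((0, 0, 0), u) \<in> ?R"
  proof cases
    case 1
    then have "((0, 0, 0), (0, 0, c)) \<in> ?R" "((0, 0, c), (0, b, c)) \<in> ?R" "((0, b, c), (a, b, c)) \<in> ?R"
      using ax3[of 0 0 c] ax2[of 0 c b] ax1[of b c a] bounds pos by simp_all
    then show ?thesis unfolding abc by (meson rtrancl_trans)
  next
    case 2
    then have "((0, 0, 0), (a, 0, 0)) \<in> ?R" "((a, 0, 0), (a, 0, c)) \<in> ?R" "((a, 0, c), (a, b, c)) \<in> ?R"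
      using ax1[of 0 0 a] ax3[of a 0 c] ax2[of a c b] bounds pos by simp_all
    then show ?thesis unfolding abc by (meson rtrancl_trans)
  next
    case 3
    then have "((0, 0, 0), (a, 0, 0)) \<in> ?R" "((a, 0, 0), (a, b, 0)) \<in> ?R" "((a, b, 0), (a, b, c)) \<in> ?R"
      using ax1[of 0 0 a] ax2[of a 0 b] ax3[of a b c] bounds pos by simp_all
    then show ?thesis unfolding abc by (meson rtrancl_trans)
  qed
qed

definition corner :: "nat \<Rightarrow> nat \<times> nat \<times> nat \<Rightarrow> nat \<times> nat \<times> nat" where
  "corner d = (\<lambda>(a, b, c). (d * a, d * b, d * c))"

abbreviation box :: "nat \<Rightarrow> (nat \<times> nat \<times> nat) set" where
  "box k \<equiv> {..<k} \<times> {..<k} \<times> {..<k}"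

text \<open>Canonical paths between lattice vertices change the first, the second and then the third
  coordinate. A line is given by two coordinates and serves at most \<open>k ^ 4\<close> pairs. If
  two lattice vertices on it differ, it has a wall somewhere, whatever the spins on its inner points
  are.\<close>

lemma fr_isoperimetry:
  fixes s :: "nat \<times> nat \<times> nat \<Rightarrow> bit"
  assumes d: "0 < d"
  shows "card {p \<in> box k. s (corner d p) = 1} * card {p \<in> box k. s (corner d p) \<noteq> 1}
      \<le> card (walls (frE d k) s) * k ^ 4"
proof -
  let ?I = "{..<k}"
  define \<sigma> where "\<sigma> a b c = s (corner d (a, b, c))" for a b c
  define R1 where "R1 = {(b, c) \<in> ?I \<times> ?I. \<exists>a\<in>?I. \<exists>a'\<in>?I. \<sigma> a b c \<noteq> \<sigma> a' b c}"
  define R2 where "R2 = {(a, c) \<in> ?I \<times> ?I. \<exists>b\<in>?I. \<exists>b'\<in>?I. \<sigma> a b c \<noteq> \<sigma> a b' c}"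
  define R3 where "R3 = {(a, b) \<in> ?I \<times> ?I. \<exists>c\<in>?I. \<exists>c'\<in>?I. \<sigma> a b c \<noteq> \<sigma> a b c'}"
  have finR: "finite R1" "finite R2" "finite R3"
    by (rule finite_subset[of _ "?I \<times> ?I"], auto simp: R1_def R2_def R3_def)+
  let ?A = "{p \<in> box k. s (corner d p) = 1}" and ?B = "{p \<in> box k. s (corner d p) \<noteq> 1}"
  let ?J = "?I \<times> ?I \<times> ?I \<times> ?I"
  let ?f1 = "\<lambda>((b, c), (a, a', b', c')). ((a, b, c), (a', b', c'))"
    and ?f2 = "\<lambda>((a', c), (a, b, b', c')). ((a, b, c), (a', b', c'))"
    and ?f3 = "\<lambda>((a', b'), (a, b, c, c')). ((a, b, c), (a', b', c'))"
  have "?A \<times> ?B \<subseteq> ?f1 ` (R1 \<times> ?J) \<union> ?f2 ` (R2 \<times> ?J) \<union> ?f3 ` (R3 \<times> ?J)"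
  proof
    fix pq assume pq: "pq \<in> ?A \<times> ?B"
    obtain a b c a' b' c' where e: "pq = ((a, b, c), (a', b', c'))" by (metis surj_pair)
    have m: "a < k" "b < k" "c < k" "a' < k" "b' < k" "c' < k" "\<sigma> a b c \<noteq> \<sigma> a' b' c'"
      using pq by (auto simp: e \<sigma>_def)
    consider "\<sigma> a b c \<noteq> \<sigma> a' b c" | "\<sigma> a' b c \<noteq> \<sigma> a' b' c" | "\<sigma> a' b' c \<noteq> \<sigma> a' b' c'"
      using m(7) by metis
    then show "pq \<in> ?f1 ` (R1 \<times> ?J) \<union> ?f2 ` (R2 \<times> ?J) \<union> ?f3 ` (R3 \<times> ?J)"
    proof cases
      case 1
      then have "((b, c), (a, a', b', c')) \<in> R1 \<times> ?J" using m by (auto simp: R1_def)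
      then have "?f1 ((b, c), (a, a', b', c')) \<in> ?f1 ` (R1 \<times> ?J)" by (rule imageI)
      then show ?thesis by (simp add: e)
    next
      case 2
      then have "((a', c), (a, b, b', c')) \<in> R2 \<times> ?J" using m by (auto simp: R2_def)
      then have "?f2 ((a', c), (a, b, b', c')) \<in> ?f2 ` (R2 \<times> ?J)" by (rule imageI)
      then show ?thesis by (simp add: e)
    next
      case 3
      then have "((a', b'), (a, b, c, c')) \<in> R3 \<times> ?J" using m by (auto simp: R3_def)
      then have "?f3 ((a', b'), (a, b, c, c')) \<in> ?f3 ` (R3 \<times> ?J)" by (rule imageI)
      then show ?thesis by (simp add: e)
    qed
  qed
  then have "card (?A \<times> ?B) \<le> card (?f1 ` (R1 \<times> ?J) \<union> ?f2 ` (R2 \<times> ?J) \<union> ?f3 ` (R3 \<times> ?J))"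
    using finR by (intro card_mono) auto
  also have "\<dots> \<le> card (?f1 ` (R1 \<times> ?J) \<union> ?f2 ` (R2 \<times> ?J)) + card (?f3 ` (R3 \<times> ?J))"
    by (rule card_Un_le)
  also have "\<dots> \<le> (card (?f1 ` (R1 \<times> ?J)) + card (?f2 ` (R2 \<times> ?J))) + card (?f3 ` (R3 \<times> ?J))"
    by (intro add_right_mono card_Un_le)
  also have "\<dots> \<le> (card (R1 \<times> ?J) + card (R2 \<times> ?J)) + card (R3 \<times> ?J)"
    using finR by (intro add_mono card_image_le) auto
  also have "\<dots> = (card R1 + card R2 + card R3) * k ^ 4"
    by (simp add: card_cartesian_product power4_eq_xxxx distrib_right mult.assoc)
  finally have count: "card (?A \<times> ?B) \<le> (card R1 + card R2 + card R3) * k ^ 4" .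
  let ?W = "walls (frE d k) s"
  let ?W1 = "?W \<inter> {((a, b, c), w). w = (Suc a, b, c)}" and ?W2 = "?W \<inter> {((a, b, c), w). w = (a, Suc b, c)}"
    and ?W3 = "?W \<inter> {((a, b, c), w). w = (a, b, Suc c)}"
  have finW: "finite ?W" using finite_frE by (simp add: walls_def)
  \<comment> \<open>Division by \<open>d\<close> recovers the lattice coordinates of the line that
    contains a wall.\<close>
  have "R1 \<subseteq> (\<lambda>((a, b, c), w). (b div d, c div d)) ` ?W1"
  proof
    fix p assume "p \<in> R1"
    then obtain a a' b c where p: "p = (b, c)" and m: "a < k" "a' < k" "b < k" "c < k"
      and ne: "s (d * a, d * b, d * c) \<noteq> s (d * a', d * b, d * c)"
      by (auto simp: R1_def \<sigma>_def corner_def)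
    then obtain i where i: "Suc i < d * k" "s (i, d * b, d * c) \<noteq> s (Suc i, d * b, d * c)"
      using exists_adjacent_change[of "\<lambda>a. s (a, d * b, d * c)" "d * a" "d * a'" "d * k"] d by auto
    then have "((i, d * b, d * c), (Suc i, d * b, d * c)) \<in> ?W1"
      using m d by (auto simp: walls_def frE_def frV_def)
    then show "p \<in> (\<lambda>((a, b, c), w). (b div d, c div d)) ` ?W1" using d by (force simp: p)
  qed
  then have 1: "card R1 \<le> card ?W1" using finW by (intro surj_card_le) auto
  have "R2 \<subseteq> (\<lambda>((a, b, c), w). (a div d, c div d)) ` ?W2"
  proof
    fix p assume "p \<in> R2"
    then obtain a b b' c where p: "p = (a, c)" and m: "b < k" "b' < k" "a < k" "c < k"
      and ne: "s (d * a, d * b, d * c) \<noteq> s (d * a, d * b', d * c)"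
      by (auto simp: R2_def \<sigma>_def corner_def)
    then obtain i where i: "Suc i < d * k" "s (d * a, i, d * c) \<noteq> s (d * a, Suc i, d * c)"
      using exists_adjacent_change[of "\<lambda>b. s (d * a, b, d * c)" "d * b" "d * b'" "d * k"] d by auto
    then have "((d * a, i, d * c), (d * a, Suc i, d * c)) \<in> ?W2"
      using m d by (auto simp: walls_def frE_def frV_def)
    then show "p \<in> (\<lambda>((a, b, c), w). (a div d, c div d)) ` ?W2" using d by (force simp: p)
  qed
  then have 2: "card R2 \<le> card ?W2" using finW by (intro surj_card_le) auto
  have "R3 \<subseteq> (\<lambda>((a, b, c), w). (a div d, b div d)) ` ?W3"
  proof
    fix p assume "p \<in> R3"
    then obtain a b c c' where p: "p = (a, b)" and m: "c < k" "c' < k" "a < k" "b < k"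
      and ne: "s (d * a, d * b, d * c) \<noteq> s (d * a, d * b, d * c')"
      by (auto simp: R3_def \<sigma>_def corner_def)
    then obtain i where i: "Suc i < d * k" "s (d * a, d * b, i) \<noteq> s (d * a, d * b, Suc i)"
      using exists_adjacent_change[of "\<lambda>c. s (d * a, d * b, c)" "d * c" "d * c'" "d * k"] d by auto
    then have "((d * a, d * b, i), (d * a, d * b, Suc i)) \<in> ?W3"
      using m d by (auto simp: walls_def frE_def frV_def)
    then show "p \<in> (\<lambda>((a, b, c), w). (a div d, b div d)) ` ?W3" using d by (force simp: p)
  qed
  then have 3: "card R3 \<le> card ?W3" using finW by (intro surj_card_le) auto
  have "card ?W1 + card ?W2 = card (?W1 \<union> ?W2)"
    using finW by (intro card_Un_disjoint[symmetric]) auto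
  then have "card ?W1 + card ?W2 + card ?W3 = card (?W1 \<union> ?W2 \<union> ?W3)"
    using finW by (subst card_Un_disjoint) auto
  also have "\<dots> \<le> card ?W" using finW by (intro card_mono) auto
  finally have "card R1 + card R2 + card R3 \<le> card ?W" using 1 2 3 by linarith
  then have "(card R1 + card R2 + card R3) * k ^ 4 \<le> card ?W * k ^ 4" by simp
  then show ?thesis using count by (simp only: card_cartesian_product)
qed

lemma inj_corner: "0 < d \<Longrightarrow> inj_on (corner d) P"
  by (auto simp: inj_on_def corner_def)

text \<open>Half-filling is measured on the lattice vertices alone, so the bound is independent of
  the subdivision: \<open>k ^ 6\<close> is at most \<open>8 * k ^ 4\<close> times the number of
  walls.\<close>

lemma fr_ising_barrier:
  assumes d: "0 < d" and k: "2 \<le> k"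
  shows "ising_barrier (frV d k) (frE d k) (k\<^sup>2 div 8)"
proof (rule ising_barrierI[where W = "corner d ` box k"])
  show "finite (frV d k)" by (rule finite_frV)
  show "corner d ` box k \<subseteq> frV d k" using d by (auto simp: corner_def frV_def)
  fix s :: "nat \<times> nat \<times> nat \<Rightarrow> bit"
  assume half: "card {u \<in> corner d ` box k. s u = 1} = card (corner d ` box k) div 2"
  let ?A = "{p \<in> box k. s (corner d p) = 1}" and ?B = "{p \<in> box k. s (corner d p) \<noteq> 1}"
  let ?M = "k * (k * k)"
  have cV: "card (corner d ` box k) = ?M" by (simp add: card_image[OF inj_corner[OF d]])
  have "{u \<in> corner d ` box k. s u = 1} = corner d ` ?A" by auto
  then have A: "card ?A = ?M div 2" using half cV card_image[OF inj_corner[OF d], of ?A] by simp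
  have "card ?A + card ?B = card (?A \<union> ?B)" by (intro card_Un_disjoint[symmetric]) auto
  also have "?A \<union> ?B = box k" by auto
  finally have B: "card ?B = ?M - ?M div 2" using A by simp
  have "2 * (1 * 1) \<le> k * (k * k)" using k by (intro mult_mono) auto
  then have "?M * ?M \<le> 8 * ((?M div 2) * (?M - ?M div 2))" by (intro mult_halves_ge) simp
  also have "\<dots> \<le> 8 * (card (walls (frE d k) s) * k ^ 4)"
    using fr_isoperimetry[OF d, of k s] unfolding A B by simp
  finally have "k\<^sup>2 * k ^ 4 \<le> 8 * card (walls (frE d k) s) * k ^ 4"
    by (simp add: power4_eq_xxxx power2_eq_square ac_simps)
  then have "k\<^sup>2 \<le> 8 * card (walls (frE d k) s)" using k by (simp only: mult_le_cancel2) simp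
  then show "k\<^sup>2 div 8 \<le> card (walls (frE d k) s)" by linarith
qed

text \<open>In each of the three directions there are \<open>k ^ 2\<close> lines with
  \<open>d * k\<close> points.\<close>

lemma card_frV: "card (frV d k) \<le> 3 * (d * k ^ 3)"
proof (cases "d = 0")
  case True
  then have "frV d k = {}" by (auto simp: frV_def)
  then show ?thesis by simp
next
  case False
  let ?N = "{..<d * k}" and ?I = "{..<k}"
  let ?f1 = "\<lambda>(a, b, c). (a, d * b, d * c)" and ?f2 = "\<lambda>(b, a, c). (d * a, b, d * c)"
    and ?f3 = "\<lambda>(c, a, b). (d * a, d * b, c)"
  have "frV d k \<subseteq> ?f1 ` (?N \<times> ?I \<times> ?I) \<union> ?f2 ` (?N \<times> ?I \<times> ?I) \<union> ?f3 ` (?N \<times> ?I \<times> ?I)"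
    using False by (force simp: frV_def dvd_def image_iff)
  then have "card (frV d k) \<le> card (?f1 ` (?N \<times> ?I \<times> ?I) \<union> ?f2 ` (?N \<times> ?I \<times> ?I) \<union> ?f3 ` (?N \<times> ?I \<times> ?I))"
    by (intro card_mono) auto
  also have "\<dots> \<le> card (?f1 ` (?N \<times> ?I \<times> ?I)) + card (?f2 ` (?N \<times> ?I \<times> ?I)) + card (?f3 ` (?N \<times> ?I \<times> ?I))"
    by (intro order_trans[OF card_Un_le] add_right_mono card_Un_le)
  also have "\<dots> \<le> card (?N \<times> ?I \<times> ?I) + card (?N \<times> ?I \<times> ?I) + card (?N \<times> ?I \<times> ?I)"
    by (intro add_mono card_image_le) auto
  also have "\<dots> = 3 * (d * k ^ 3)" by (simp add: power3_eq_cube)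
  finally show ?thesis .
qed

lemma card_frE: "card (frE d k) \<le> 3 * card (frV d k)"
proof -
  let ?g1 = "\<lambda>(a, b, c). ((a, b, c), (Suc a, b, c))" and ?g2 = "\<lambda>(a, b, c). ((a, b, c), (a, Suc b, c))"
    and ?g3 = "\<lambda>(a, b, c). ((a, b, c), (a, b, Suc c))"
  have "frE d k \<subseteq> ?g1 ` frV d k \<union> ?g2 ` frV d k \<union> ?g3 ` frV d k"
    by (force simp: frE_def)
  then have "card (frE d k) \<le> card (?g1 ` frV d k \<union> ?g2 ` frV d k \<union> ?g3 ` frV d k)"
    using finite_frV by (intro card_mono) auto
  also have "\<dots> \<le> card (?g1 ` frV d k) + card (?g2 ` frV d k) + card (?g3 ` frV d k)"
    by (intro order_trans[OF card_Un_le] add_right_mono card_Un_le)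
  also have "\<dots> \<le> card (frV d k) + card (frV d k) + card (frV d k)"
    using finite_frV by (intro add_mono card_image_le) auto
  finally show ?thesis by simp
qed

section \<open>Embedding into space\<close>

fun sheet_pos :: "(nat \<times> nat) \<times> (nat \<times> nat \<times> nat) \<Rightarrow> nat \<times> nat \<times> nat" where
  "sheet_pos ((i, j), (a, b, c)) = (a + i, b + j, c + i + j)"

fun qubit_pos :: "(nat \<times> nat, nat \<times> nat \<times> nat) qubit \<Rightarrow> nat \<times> nat \<times> nat" where
  "qubit_pos (Inl (x, u)) = sheet_pos (x, u)"
| "qubit_pos (Inr (f, e)) = sheet_pos (fst f, fst e)"

definition point :: "nat \<times> nat \<times> nat \<Rightarrow> real ^ 3" where
  "point = (\<lambda>(a, b, c). vector [real a, real b, real c])"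

section \<open>Positions and locality of the generators\<close>

lemma One_nth: "(\<Sum>b\<in>Basis. vec_nth (b :: real ^ 3) i) = 1"
proof -
  have "(\<Sum>b\<in>Basis. vec_nth (b :: real ^ 3) i) = (\<Sum>b\<in>Basis. inner (b :: real ^ 3) (axis i 1))"
    by (simp add: inner_axis)
  also have "\<dots> = inner (\<Sum>b\<in>Basis. 1 *\<^sub>R (b :: real ^ 3)) (axis i 1)"
    by (simp only: scaleR_one inner_sum_left)
  also have "\<dots> = 1" by (rule inner_sum_left_Basis) (auto simp: Basis_vec_def)
  finally show ?thesis .
qed

lemma point_in_cube:
  "point (x, y, z) \<in> cube v s \<longleftrightarrow>
     (vec_nth v 1 \<le> real x \<and> real x \<le> vec_nth v 1 + s) \<and>
     (vec_nth v 2 \<le> real y \<and> real y \<le> vec_nth v 2 + s) \<and>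
     (vec_nth v 3 \<le> real z \<and> real z \<le> vec_nth v 3 + s)"
  by (simp add: cube_def point_def mem_box_cart forall_3 vector_3 One_nth)

fun near :: "nat \<times> nat \<times> nat \<Rightarrow> nat \<times> nat \<times> nat \<Rightarrow> bool" where
  "near (x, y, z) (x', y', z') \<longleftrightarrow> x \<le> x' + 2 \<and> x' \<le> x + 2 \<and> y \<le> y' + 2 \<and> y' \<le> y + 2 \<and> z \<le> z' + 2 \<and> z' \<le> z + 2"

lemma near_in_cube: "near p q \<Longrightarrow> point q \<in> cube (point p - 2 *\<^sub>R One) 4"
  by (cases p; cases q) (auto simp: point_in_cube, auto simp: point_def vector_3 One_nth)

lemma inc_nonzero: "inc u e \<noteq> 0 \<Longrightarrow> u = fst e \<or> u = snd e"
  by (auto simp: inc_def)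

lemma near_sheet:
  assumes "x = x' \<and> (u = u' \<or> (u, u') \<in> frE d k \<or> (u', u) \<in> frE d k) \<or>
    u = u' \<and> ((x, x') \<in> sqE d \<or> (x', x) \<in> sqE d)"
  shows "near (sheet_pos (x, u)) (sheet_pos (x', u'))"
  using assms by (cases x; cases x'; cases u; cases u') (auto simp: frE_def elim!: sqE_cases)

lemma star_local:
  assumes "e \<in> frE d k" "q \<in> (sqV d \<times> frV d k) <+> (sqE d \<times> frE d k)" "star (x, e) q \<noteq> 0"
  shows "near (sheet_pos (x, fst e)) (qubit_pos q)"
  using assms(2)
proof (elim PlusE)
  fix xu assume "q = Inl xu" "xu \<in> sqV d \<times> frV d k"
  then obtain x' u where q: "q = Inl (x', u)" by (metis surj_pair)
  have "x' = x" "inc u e \<noteq> 0" using assms(3) by (auto simp: q)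
  then have "x' = x" "u = fst e \<or> (fst e, u) \<in> frE d k" using inc_nonzero[of u e] assms(1) by auto
  then show ?thesis unfolding q qubit_pos.simps by (intro near_sheet[where d = d and k = k]) auto
next
  fix fe assume fe: "q = Inr fe" "fe \<in> sqE d \<times> frE d k"
  then obtain f e' where q: "q = Inr (f, e')" "f \<in> sqE d" by blast
  have "e' = e" "inc x f \<noteq> 0" using assms(3) by (auto simp: q)
  then have "e' = e" "x = fst f \<or> (fst f, x) \<in> sqE d" using inc_nonzero[of x f] q(2) by auto
  then show ?thesis unfolding q qubit_pos.simps by (intro near_sheet[where d = d and k = k]) auto
qed

lemma check_local:
  assumes "j \<in> (sqE d \<times> frV d k) <+> (sq_faces d \<times> frE d k)"
  shows "\<exists>p. \<forall>q\<in>(sqV d \<times> frV d k) <+> (sqE d \<times> frE d k). check j q \<noteq> 0 \<longrightarrow> near p (qubit_pos q)"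
  using assms
proof (elim PlusE)
  fix fu assume "j = Inl fu" "fu \<in> sqE d \<times> frV d k"
  then obtain f u where j: "j = Inl (f, u)" "f \<in> sqE d" by blast
  show ?thesis
  proof (intro exI ballI impI)
    fix q assume q: "q \<in> (sqV d \<times> frV d k) <+> (sqE d \<times> frE d k)" "check j q \<noteq> 0"
    from q(1) show "near (sheet_pos (fst f, u)) (qubit_pos q)"
    proof (elim PlusE)
      fix xu assume "q = Inl xu" "xu \<in> sqV d \<times> frV d k"
      then obtain x u' where q': "q = Inl (x, u')" by (metis surj_pair)
      have "u' = u" "inc x f \<noteq> 0" using q(2) by (auto simp: q' j)
      then have "u' = u" "x = fst f \<or> (fst f, x) \<in> sqE d" using inc_nonzero[of x f] j(2) by auto
      then show ?thesis unfolding q' qubit_pos.simps by (intro near_sheet[where d = d and k = k]) auto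
    next
      fix fe assume "q = Inr fe" "fe \<in> sqE d \<times> frE d k"
      then obtain f' e where q': "q = Inr (f', e)" "e \<in> frE d k" by blast
      have "f' = f" "inc u e \<noteq> 0" using q(2) by (auto simp: q' j)
      then have "f' = f" "u = fst e \<or> (fst e, u) \<in> frE d k" using inc_nonzero[of u e] q'(2) by auto
      then show ?thesis unfolding q' qubit_pos.simps by (intro near_sheet[where d = d and k = k]) auto
    qed
  qed
next
  fix ge assume "j = Inr ge" "ge \<in> sq_faces d \<times> frE d k"
  then obtain l m e where j: "j = Inr (sq_face (l, m), e)" by (auto simp: sq_faces_def)
  show ?thesis
  proof (intro exI ballI impI)
    fix q assume q: "q \<in> (sqV d \<times> frV d k) <+> (sqE d \<times> frE d k)" "check j q \<noteq> 0"
    from q(1) show "near (sheet_pos ((l, m), fst e)) (qubit_pos q)"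
    proof (elim PlusE)
      fix xu assume "q = Inl xu" "xu \<in> sqV d \<times> frV d k"
      then show ?thesis using q(2) by (simp add: j)
    next
      fix fe assume "q = Inr fe" "fe \<in> sqE d \<times> frE d k"
      then obtain f e' where q': "q = Inr (f, e')" by (metis surj_pair)
      have "e' = e" "f \<in> sq_face (l, m)" using q(2) by (auto simp: q' j)
      then show ?thesis by (cases "fst e") (auto simp: q' sq_face_def)
    qed
  qed
qed

text \<open>For points of \<open>frV\<close> the value is the direction of a line through the point.
  Lattice vertices lie on three lines and are assigned to direction 0, so that the three classes are
  disjoint.\<close>

definition axis_of :: "nat \<Rightarrow> nat \<times> nat \<times> nat \<Rightarrow> nat" where
  "axis_of d = (\<lambda>(a, b, c). if d dvd b \<and> d dvd c then 0 else if d dvd a \<and> d dvd c then 1 else 2)"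

lemma multiple_plus_remainder:
  fixes d :: nat
  assumes "d dvd b" "d dvd b'" "j < d" "j' < d" "b + j = b' + j'"
  shows "b = b'" "j = j'"
proof -
  have "(b + j) mod d = j" "(b' + j') mod d = j'" using assms(1-4) by (auto elim!: dvdE)
  then show "j = j'" using assms(5) by simp
  then show "b = b'" using assms(5) by simp
qed

text \<open>On a line of \<open>G\<close> two coordinates of \<open>u\<close> are multiples of \<open>d\<close>; reducing the position modulo \<open>d\<close> in these
  coordinates recovers \<open>i\<close> and \<open>j\<close>.\<close>

lemma sheet_pos_inject:
  assumes "x \<in> sqV d" "x' \<in> sqV d" "u \<in> frV d k" "u' \<in> frV d k"
    and ax: "axis_of d u = axis_of d u'" and eq: "sheet_pos (x, u) = sheet_pos (x', u')"
  shows "x = x' \<and> u = u'"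
proof -
  obtain i j i' j' where x: "x = (i, j)" "x' = (i', j')" by (metis surj_pair)
  obtain a b c a' b' c' where u: "u = (a, b, c)" "u' = (a', b', c')" by (metis surj_pair)
  have lt: "i < d" "j < d" "i' < d" "j' < d" using assms(1,2) by (auto simp: x sqV_def)
  have e: "a + i = a' + i'" "b + j = b' + j'" "c + i + j = c' + i' + j'" using eq by (auto simp: x u)
  consider "d dvd b \<and> d dvd c \<and> d dvd b' \<and> d dvd c'" | "d dvd a \<and> d dvd c \<and> d dvd a' \<and> d dvd c'"
    | "d dvd a \<and> d dvd b \<and> d dvd a' \<and> d dvd b'"
    using assms(3,4) ax by (auto simp: u axis_of_def frV_def split: if_splits)
  then show ?thesis
  proof cases
    case 1
    then have j: "b = b'" "j = j'" using multiple_plus_remainder[of d b b' j j'] lt e by auto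
    \<comment> \<open>The third coordinate contains both sheet coordinates, so \<open>j\<close> has
      to be known before it yields \<open>i\<close>.\<close>
    then have "c = c'" "i = i'" using multiple_plus_remainder[of d c c' i i'] 1 lt e by auto
    then show ?thesis using j e by (simp add: x u)
  next
    case 2
    then have i: "a = a'" "i = i'" using multiple_plus_remainder[of d a a' i i'] lt e by auto
    then have "c = c'" "j = j'" using multiple_plus_remainder[of d c c' j j'] 2 lt e by auto
    then show ?thesis using i e by (simp add: x u)
  next
    case 3
    then have i: "a = a'" "i = i'" using multiple_plus_remainder[of d a a' i i'] lt e by auto
    then have "b = b'" "j = j'" using multiple_plus_remainder[of d b b' j j'] 3 lt e by auto
    then show ?thesis using i e by (simp add: x u)
  qed
qed

text \<open>Finite information that determines a qubit together with its position. The position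
  fixes where an edge starts, and its direction is coded by which coordinates stay fixed along
  it.\<close>

fun tag :: "nat \<Rightarrow> (nat \<times> nat, nat \<times> nat \<times> nat) qubit \<Rightarrow> nat \<times> bool \<times> bool \<times> bool \<times> bool" where
  "tag d (Inl (x, u)) = (axis_of d u, True, True, True, True)"
| "tag d (Inr (f, e)) = (axis_of d (fst e), False, fst (fst f) = fst (snd f),
     fst (fst e) = fst (snd e), fst (snd (fst e)) = fst (snd (snd e)))"

lemma sqE_determined:
  assumes "f \<in> sqE d" "f' \<in> sqE d" "fst f = fst f'"
    and "fst (fst f) = fst (snd f) \<longleftrightarrow> fst (fst f') = fst (snd f')"
  shows "f = f'"
  using assms(1)
proof (cases rule: sqE_cases)
  case (1 i j)
  from assms(2) show ?thesis by (cases rule: sqE_cases) (use 1 assms(3,4) in auto)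
next
  case (2 i j)
  from assms(2) show ?thesis by (cases rule: sqE_cases) (use 2 assms(3,4) in auto)
qed

lemma frE_determined:
  assumes "e \<in> frE d k" "e' \<in> frE d k" "fst e = fst e'"
    and "fst (fst e) = fst (snd e) \<longleftrightarrow> fst (fst e') = fst (snd e')"
    and "fst (snd (fst e)) = fst (snd (snd e)) \<longleftrightarrow> fst (snd (fst e')) = fst (snd (snd e'))"
  shows "e = e'"
proof -
  obtain a b c p q r p' q' r' where e: "e = ((a, b, c), (p, q, r))" "e' = ((a, b, c), (p', q', r'))"
    using assms(3) by (metis prod.collapse)
  have "p = Suc a \<and> q = b \<and> r = c \<or> p = a \<and> q = Suc b \<and> r = c \<or> p = a \<and> q = b \<and> r = Suc c"
    "p' = Suc a \<and> q' = b \<and> r' = c \<or> p' = a \<and> q' = Suc b \<and> r' = c \<or> p' = a \<and> q' = b \<and> r' = Suc c"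
    using assms(1,2) by (simp_all add: e frE_def)
  moreover have "a = p \<longleftrightarrow> a = p'" "b = q \<longleftrightarrow> b = q'" using assms(4,5) by (simp_all add: e)
  ultimately have "p = p' \<and> q = q' \<and> r = r'" by linarith
  then show ?thesis by (simp add: e)
qed

lemma tag_pos_inject:
  assumes q: "q \<in> (sqV d \<times> frV d k) <+> (sqE d \<times> frE d k)" "q' \<in> (sqV d \<times> frV d k) <+> (sqE d \<times> frE d k)"
    and eq: "tag d q = tag d q'" "qubit_pos q = qubit_pos q'"
  shows "q = q'"
proof (cases q)
  case (Inl xu)
  then obtain x u where 1: "q = Inl (x, u)" "x \<in> sqV d" "u \<in> frV d k" using q(1) by blast
  then obtain x' u' where 2: "q' = Inl (x', u')" "x' \<in> sqV d" "u' \<in> frV d k"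
    using q(2) eq(1) by (cases q') auto
  then show ?thesis using sheet_pos_inject[of x d x' u k u'] 1 eq by simp
next
  case (Inr fe)
  then obtain f e where 1: "q = Inr (f, e)" "f \<in> sqE d" "e \<in> frE d k" using q(1) by blast
  then obtain f' e' where 2: "q' = Inr (f', e')" "f' \<in> sqE d" "e' \<in> frE d k"
    using q(2) eq(1) by (cases q') auto
  have "fst f \<in> sqV d" "fst f' \<in> sqV d" "fst e \<in> frV d k" "fst e' \<in> frV d k"
    using 1 2 by (auto simp: sqV_def frE_def elim!: sqE_cases)
  then have "fst f = fst f'" "fst e = fst e'"
    using sheet_pos_inject[of "fst f" d "fst f'" "fst e" k "fst e'"] eq 1(1) 2(1) by simp_all
  moreover have "fst (fst f) = fst (snd f) \<longleftrightarrow> fst (fst f') = fst (snd f')"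
    "fst (fst e) = fst (snd e) \<longleftrightarrow> fst (fst e') = fst (snd e')"
    "fst (snd (fst e)) = fst (snd (snd e)) \<longleftrightarrow> fst (snd (fst e')) = fst (snd (snd e'))"
    using eq(1) 1(1) 2(1) by simp_all
  ultimately have "f = f'" "e = e'"
    using sqE_determined[OF 1(2) 2(2)] frE_determined[OF 1(3) 2(3)] by blast+
  then show ?thesis using 1 2 by simp
qed

section \<open>Counting qubits\<close>

lemma card_nats_in_unit_interval:
  "finite {x :: nat. a \<le> real x \<and> real x \<le> a + 1}" "card {x :: nat. a \<le> real x \<and> real x \<le> a + 1} \<le> 2"
proof -
  let ?N = "{x :: nat. a \<le> real x \<and> real x \<le> a + 1}"
  have sub: "?N \<subseteq> {nat \<lceil>a\<rceil>, Suc (nat \<lceil>a\<rceil>)}"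
  proof
    fix x assume "x \<in> ?N"
    then have "\<lceil>a\<rceil> \<le> int x" "real x \<le> of_int \<lceil>a\<rceil> + 1" by (auto simp: ceiling_le_iff) linarith
    then have "\<lceil>a\<rceil> \<le> int x" "int x \<le> \<lceil>a\<rceil> + 1" by linarith+
    then show "x \<in> {nat \<lceil>a\<rceil>, Suc (nat \<lceil>a\<rceil>)}" by auto
  qed
  show "finite ?N" by (rule finite_subset[OF sub]) simp
  show "card ?N \<le> 2" using card_mono[OF _ sub] by simp
qed

text \<open>384 = 48 * 8: there are \<open>3 * 2 ^ 4\<close> tags, and a closed cube of side 1
  contains at most \<open>2 ^ 3\<close> points with natural coordinates.\<close>

lemma density:
  "card {q \<in> (sqV d \<times> frV d k) <+> (sqE d \<times> frE d k). point (qubit_pos q) \<in> cube v 1} \<le> 384"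
proof -
  let ?N = "\<lambda>i. {x :: nat. vec_nth v i \<le> real x \<and> real x \<le> vec_nth v i + 1}"
  let ?D = "{q \<in> (sqV d \<times> frV d k) <+> (sqE d \<times> frE d k). point (qubit_pos q) \<in> cube v 1}"
  let ?T = "{..<3 :: nat} \<times> (UNIV :: bool set) \<times> (UNIV :: bool set) \<times> (UNIV :: bool set) \<times> (UNIV :: bool set)"
  have "card ?D \<le> card (?T \<times> (?N 1 \<times> ?N 2 \<times> ?N 3))"
  proof (rule card_inj_on_le)
    show "inj_on (\<lambda>q. (tag d q, qubit_pos q)) ?D"
    proof (rule inj_onI)
      fix q q' assume "q \<in> ?D" "q' \<in> ?D" "(tag d q, qubit_pos q) = (tag d q', qubit_pos q')"
      then show "q = q'" by (intro tag_pos_inject[of q d k q']) (simp_all only: prod.inject mem_Collect_eq)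
    qed
    show "(\<lambda>q. (tag d q, qubit_pos q)) ` ?D \<subseteq> ?T \<times> (?N 1 \<times> ?N 2 \<times> ?N 3)"
    proof
      fix z assume "z \<in> (\<lambda>q. (tag d q, qubit_pos q)) ` ?D"
      then obtain q where z: "z = (tag d q, qubit_pos q)" and q: "point (qubit_pos q) \<in> cube v 1" by blast
      have "tag d q \<in> ?T" by (cases "(d, q)" rule: tag.cases) (auto simp: axis_of_def)
      moreover have "qubit_pos q \<in> ?N 1 \<times> ?N 2 \<times> ?N 3"
        using q by (cases "qubit_pos q") (simp add: point_in_cube)
      ultimately show "z \<in> ?T \<times> (?N 1 \<times> ?N 2 \<times> ?N 3)" unfolding z by blast
    qed
    show "finite (?T \<times> (?N 1 \<times> ?N 2 \<times> ?N 3))" by (intro finite_cartesian_product card_nats_in_unit_interval) auto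
  qed
  also have "\<dots> = 48 * (card (?N 1) * (card (?N 2) * card (?N 3)))"
    by (simp only: card_cartesian_product card_lessThan card_UNIV_bool)
  also have "\<dots> \<le> 48 * (2 * (2 * 2))"
    by (intro mult_left_mono mult_mono card_nats_in_unit_interval) auto
  finally show ?thesis by simp
qed

text \<open>21 = (1 + 2 * 3) * 3, from at most \<open>2 * d ^ 2\<close> grid edges, at most three
  edges per point of \<open>frV\<close>, and at most \<open>3 * d * k ^ 3\<close> such
  points.\<close>

lemma qubit_count:
  "card ((sqV d \<times> frV d k) <+> (sqE d \<times> frE d k)) \<le> 21 * (d * k) ^ 3"
proof -
  have fin: "finite (sqV d \<times> frV d k)" "finite (sqE d \<times> frE d k)"
    using finite_frV finite_frE by (auto simp: sqV_def sqE_def)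
  have "card ((sqV d \<times> frV d k) <+> (sqE d \<times> frE d k)) = d * d * card (frV d k) + card (sqE d) * card (frE d k)"
    using fin by (simp add: card_Plus card_cartesian_product sqV_def)
  also have "\<dots> \<le> d * d * card (frV d k) + (2 * (d * d)) * (3 * card (frV d k))"
    by (intro add_left_mono mult_mono card_sqE card_frE) auto
  also have "\<dots> = 7 * (d * d) * card (frV d k)" by simp
  also have "\<dots> \<le> 7 * (d * d) * (3 * (d * k ^ 3))" by (intro mult_left_mono card_frV) auto
  also have "\<dots> = 21 * (d * k) ^ 3" by (simp add: power_mult_distrib power3_eq_cube)
  finally show ?thesis .
qed

lemma code_family:
  fixes k :: nat
  assumes k: "4 \<le> k"
  shows "\<exists>n (pos :: nat \<Rightarrow> real ^ 3) S R.
    n \<le> 21 * (k ^ 9) \<and> stabilizer_group n S \<and> (\<exists>E. nontrivial_logical n S E) \<and> generating_set n S R \<and>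
    (\<forall>a. card {q. q < n \<and> pos q \<in> cube a 1} \<le> 384) \<and>
    (\<forall>h\<in>R. \<exists>a. pos ` pauli_support n h \<subseteq> cube a 4) \<and>
    2 * real (k\<^sup>2 div 8) \<le> energy_barrier n S R \<and> energy_barrier n S R \<le> 2 * real (k\<^sup>2 + 1)"
proof -
  define d where "d = k\<^sup>2"
  have "4 ^ 2 \<le> k\<^sup>2" using k by (rule power_mono) simp
  then have d: "2 \<le> d" unfolding d_def by simp
  then have d0: "0 < d" by simp
  define labels where "labels = (sqV d \<times> frV d k) <+> (sqE d \<times> frE d k)"
  define n where "n = card labels"
  have "finite labels" using finite_frV finite_frE by (auto simp: labels_def sqV_def sqE_def)
  then obtain en where bij: "bij_betw en {..<n} labels"
    unfolding n_def lessThan_atLeast0 using ex_bij_betw_nat_finite by blast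
  interpret product_code "sqV d" "sqE d" "(0, 0)" "frV d k" "frE d k" "(0, 0, 0)" "sq_faces d" en n
  proof (intro product_code.intro product_code_axioms.intro)
    show "rooted_graph (sqV d) (sqE d) (0, 0)" using d0 by (intro sq_rooted_graph)
    show "rooted_graph (frV d k) (frE d k) (0, 0, 0)" using d0 k by (intro fr_rooted_graph) auto
    show "finite (sq_faces d)" by (simp add: sq_faces_def)
    show "bij_betw en {..<n} ((sqV d \<times> frV d k) <+> (sqE d \<times> frE d k))" using bij unfolding labels_def .
    show "g \<subseteq> sqE d" if "g \<in> sq_faces d" for g
      using that by (rule sq_faces_subset)
    show "(\<Sum>f\<in>g. inc x f) = 0" if "g \<in> sq_faces d" "x \<in> sqV d" for g x
      using that(1) by (rule sq_faces_cycle)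
    show "\<exists>\<phi>. \<forall>f\<in>sqE d. b f = (\<Sum>g\<in>sq_faces d. \<phi> g * of_bool (f \<in> g))"
      if "\<And>x. x \<in> sqV d \<Longrightarrow> (\<Sum>f\<in>sqE d. b f * inc x f) = 0" for b
      by (rule sq_cycle_exact) (rule that)
    show "\<exists>\<beta>. \<forall>f\<in>sqE d. b f = \<beta> (fst f) + \<beta> (snd f)"
      if "\<And>g. g \<in> sq_faces d \<Longrightarrow> (\<Sum>f\<in>g. b f) = 0" for b :: "_ \<Rightarrow> bit"
      by (rule sq_cocycle_exact) (rule that)
  qed
  define pos where "pos = (\<lambda>q. point (qubit_pos (en q)))"
  have "ising_barrier (sqV d) (sqE d) (k\<^sup>2 div 8)" "ising_barrier (frV d k) (frE d k) (k\<^sup>2 div 8)"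
    using sq_ising_barrier[OF d] fr_ising_barrier[OF d0] k by (simp_all add: d_def)
  note barrier = product_barrier[OF this, of "lex_fill d" "d * d" "d + 1",
      OF lex_fill_start lex_fill_end lex_fill_step lex_fill_walls]
  have "card {q. q < n \<and> pos q \<in> cube a 1} \<le> 384" for a
  proof -
    have "card {q. q < n \<and> pos q \<in> cube a 1} \<le> card {q \<in> labels. point (qubit_pos q) \<in> cube a 1}"
    proof (rule card_inj_on_le)
      show "inj_on en {q. q < n \<and> pos q \<in> cube a 1}"
        using bij by (auto simp: bij_betw_def inj_on_def)
      show "en ` {q. q < n \<and> pos q \<in> cube a 1} \<subseteq> {q \<in> labels. point (qubit_pos q) \<in> cube a 1}"
        using bij by (auto simp: bij_betw_def pos_def)
      show "finite {q \<in> labels. point (qubit_pos q) \<in> cube a 1}" using \<open>finite labels\<close> by simp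
    qed
    then show ?thesis using density[of d k a] unfolding labels_def by linarith
  qed
  moreover have "\<exists>a. pos ` pauli_support n h \<subseteq> cube a 4" if h: "h \<in> css.gens" for h
  proof -
    have labels: "en q \<in> labels" if "q \<in> pauli_support n h" for q
      using that bij by (auto simp: pauli_support_def bij_betw_def)
    have "\<exists>p. \<forall>q\<in>pauli_support n h. near p (qubit_pos (en q))"
      using gens_support[OF h]
    proof (elim disjE bexE)
      fix i assume i: "i \<in> sqV d \<times> frE d k" "en ` pauli_support n h \<subseteq> {q. star i q \<noteq> 0}"
      then obtain x e where "i = (x, e)" "e \<in> frE d k" by blast
      then show ?thesis
        using i(2) labels star_local[of e d k _ x] unfolding labels_def by (intro exI[of _ "sheet_pos (x, fst e)"]) blast
    next
      fix j assume j: "j \<in> (sqE d \<times> frV d k) <+> (sq_faces d \<times> frE d k)" "en ` pauli_support n h \<subseteq> {q. check j q \<noteq> 0}"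
      obtain p where "\<forall>q\<in>labels. check j q \<noteq> 0 \<longrightarrow> near p (qubit_pos q)"
        using check_local[OF j(1)] unfolding labels_def by blast
      then show ?thesis using j(2) labels by blast
    qed
    then obtain p where "\<forall>q\<in>pauli_support n h. near p (qubit_pos (en q))" by blast
    then have "pos ` pauli_support n h \<subseteq> cube (point p - 2 *\<^sub>R One) 4"
      unfolding pos_def by (auto intro: near_in_cube)
    then show ?thesis by blast
  qed
  moreover have "n \<le> 21 * k ^ 9"
  proof -
    have "n \<le> 21 * (d * k) ^ 3" unfolding n_def labels_def by (rule qubit_count)
    \<comment> \<open>Here the choice of \<open>d\<close> makes the linear size of the code
      \<open>k ^ 3\<close>, which is of order \<open>L\<close>.\<close>
    also have "d * k = k ^ 3" by (simp add: d_def power2_eq_square power3_eq_cube)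
    finally show ?thesis by (simp flip: power_mult)
  qed
  moreover have "2 * real (k\<^sup>2 div 8) \<le> energy_barrier n css.stab css.gens"
    "energy_barrier n css.stab css.gens \<le> 2 * real (k\<^sup>2 + 1)" "\<exists>E. nontrivial_logical n css.stab E"
    using barrier unfolding d_def by blast+
  ultimately show ?thesis
    using css.stabilizer_group_stab css.generating_set_gens
    by (intro exI[of _ n] exI[of _ pos] exI[of _ css.stab] exI[of _ css.gens]) blast
qed

theorem mainTheorem1:
  "\<exists>C r m c\<^sub>1 c\<^sub>2 :: real. C > 0 \<and> r > 0 \<and> m > 0 \<and> c\<^sub>1 > 0 \<and> c\<^sub>2 > 0 \<and>
     (\<exists>L\<^sub>0 :: nat. \<forall>L\<ge>L\<^sub>0.
        \<exists>(n :: nat) (pos :: nat \<Rightarrow> real ^ 3) S R.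
          real n \<le> C * real L ^ 3 \<and>
          stabilizer_group n S \<and>
          (\<exists>E. nontrivial_logical n S E) \<and>
          generating_set n S R \<and>
          (\<forall>a. real (card {q. q < n \<and> pos q \<in> cube a 1}) \<le> m) \<and>
          (\<forall>h\<in>R. \<exists>a. pos ` pauli_support n h \<subseteq> cube a r) \<and>
          c\<^sub>1 * real L powr (2 / 3) \<le> energy_barrier n S R \<and>
          energy_barrier n S R \<le> c\<^sub>2 * real L powr (2 / 3))"
\<comment> \<open>Let \<open>y\<close> be the cube root of \<open>L\<close>, so that
  \<open>y \<le> k \<le> 2 * y\<close>. Then 10752 = 21 * 2^9; the lower constant comes from
  \<open>k\<^sup>2 / 8 \<le> 2 * (k\<^sup>2 div 8)\<close> and the upper one from
  \<open>2 * (k\<^sup>2 + 1) \<le> 8 * y\<^sup>2 + 2\<close>. The threshold 64 = 4^3 ensures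
  \<open>y \<ge> 4\<close>.\<close>
proof (rule exI[of _ 10752], rule exI[of _ 4], rule exI[of _ 384], rule exI[of _ "1 / 8"], rule exI[of _ 16],
    (rule conjI, simp)+, rule exI[of _ 64], intro allI impI)
  fix L :: nat assume L: "64 \<le> L"
  define y where "y = real L powr (1 / 3)"
  define k where "k = nat \<lceil>y\<rceil>"
  have y3: "y ^ 3 = real L" using L by (simp add: y_def powr_power)
  have y2: "y\<^sup>2 = real L powr (2 / 3)" using L by (simp add: y_def powr_power)
  have y4: "4 \<le> y"
  proof (rule ccontr)
    assume "\<not> 4 \<le> y"
    then have "y ^ 3 < 4 ^ 3" by (intro power_strict_mono) (auto simp: y_def)
    then show False using L y3 by simp
  qed
  have k: "y \<le> real k" "real k \<le> 2 * y" using y4 unfolding k_def by linarith+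
  then have "4 \<le> k" using y4 by linarith
  then obtain n and pos :: "nat \<Rightarrow> real ^ 3" and S R where code: "n \<le> 21 * k ^ 9" "stabilizer_group n S"
    "\<exists>E. nontrivial_logical n S E" "generating_set n S R"
    "\<forall>a. card {q. q < n \<and> pos q \<in> cube a 1} \<le> 384"
    "\<forall>h\<in>R. \<exists>a. pos ` pauli_support n h \<subseteq> cube a 4"
    "2 * real (k\<^sup>2 div 8) \<le> energy_barrier n S R" "energy_barrier n S R \<le> 2 * real (k\<^sup>2 + 1)"
    using code_family by blast
  have "real n \<le> 21 * real k ^ 9" using code(1) by (metis of_nat_le_iff of_nat_mult of_nat_numeral of_nat_power)
  also have "\<dots> \<le> 21 * (2 * y) ^ 9" using k by (intro mult_left_mono power_mono) auto
  also have "\<dots> = 10752 * (y ^ 3) ^ 3" by (simp add: power_mult_distrib flip: power_mult)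
  finally have size: "real n \<le> 10752 * real L ^ 3" unfolding y3 .
  have "4 ^ 2 \<le> k\<^sup>2" using \<open>4 \<le> k\<close> by (rule power_mono) simp
  \<comment> \<open>Rounding down to a multiple of 8 loses less than half of a number that is at
    least 16.\<close>
  then have "k\<^sup>2 \<le> 16 * (k\<^sup>2 div 8)" by simp
  then have "real (k\<^sup>2) \<le> real (16 * (k\<^sup>2 div 8))" by (rule of_nat_mono)
  moreover have "y\<^sup>2 \<le> (real k)\<^sup>2" using k y4 by (intro power_mono) auto
  ultimately have lower: "1 / 8 * real L powr (2 / 3) \<le> energy_barrier n S R"
    using code(7) unfolding y2[symmetric] by simp
  have "(real k)\<^sup>2 \<le> (2 * y)\<^sup>2" using k by (intro power_mono) auto
  moreover have "4 ^ 2 \<le> y\<^sup>2" using y4 by (intro power_mono) auto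
  ultimately have upper: "energy_barrier n S R \<le> 16 * real L powr (2 / 3)"
    using code(8) unfolding y2[symmetric] by (simp add: power_mult_distrib)
  show "\<exists>(n :: nat) (pos :: nat \<Rightarrow> real ^ 3) S R.
          real n \<le> 10752 * real L ^ 3 \<and>
          stabilizer_group n S \<and>
          (\<exists>E. nontrivial_logical n S E) \<and>
          generating_set n S R \<and>
          (\<forall>a. real (card {q. q < n \<and> pos q \<in> cube a 1}) \<le> 384) \<and>
          (\<forall>h\<in>R. \<exists>a. pos ` pauli_support n h \<subseteq> cube a 4) \<and>
          1 / 8 * real L powr (2 / 3) \<le> energy_barrier n S R \<and>
          energy_barrier n S R \<le> 16 * real L powr (2 / 3)"
    using code size lower upper
    by (intro exI[of _ n] exI[of _ pos] exI[of _ S] exI[of _ R]) auto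
qed

end
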